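(* Let $R$ be a regular local ring of dimension two, and let $S$ be a subsemigroup of the positive elements of a totally ordered abelian group. Then there exists a valuation $\nu$ of the quotient field of $R$ dominating $R$ such that $S$ is the semigroup of $\nu$ in $R$ (that is, $S^R(\nu)=S\cup\{0\}$) if and only if there exist a finite or countable index set $I$, equal to $\{0,1,\ldots,\Lambda\}$ for some integer $\Lambda\ge 1$ or to $\mathbb N=\{0,1,2,\ldots\}$ (in which case put $\Lambda=\infty$), and elements $\beta_i\in S$ for $i\in I$, such that: 1) The semigroup $S$ is generated by $\{\beta_i\}_{i\in I}$. 2) Let $\overline n_i=[G(\beta_0,\ldots,\beta_i):G(\beta_0,\ldots,\beta_{i-1})]\in\mathbb Z_{>0}\cup\{\infty\}$ for $i\in I$, $i\geq 1$. Then $\overline n_i<\infty$ and $\beta_{i+1}>\overline n_i\beta_i$ for $1\le i<\Lambda$. (If $\Lambda<\infty$, then $\overline n_\Lambda\le\infty$, i.e. $\overline n_\Lambda$ is allowed to be finite or infinite.)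
   Context: For a valuation $\nu$ of the quotient field of a local domain $R$ with maximal ideal $\mathfrak m_R$, $V_\nu$ denotes its valuation ring and $\mathfrak m_\nu$ the maximal ideal of $V_\nu$. The valuation $\nu$ dominates $R$ if $R\subset V_\nu$ and $\mathfrak m_\nu\cap R=\mathfrak m_R$. The semigroup of $\nu$ in $R$ is $S^R(\nu)=\{\nu(f)\mid f\in R\setminus\{0\}\}$. $G(z_1,\ldots,z_n)$ is the subgroup generated by elements $z_1,\ldots,z_n$ of an abelian group. The equality of $S$ with the semigroup of $\nu$ is understood after an identification of ordered groups (the ordered group generated by $S$ with the value group of $\nu$). *)

theory Defs
  imports
    "HOL-Computational_Algebra.Computational_Algebra"
    "HOL-Computational_Algebra.Group_Closure"
    "HOL-Library.Extended_Nat"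
begin

section \<open>Regular local rings\<close>

text \<open>Ideals are the submodules of the ring regarded as a module over itself.\<close>

lemma module_times: "module ((*) :: 'a::comm_ring_1 \<Rightarrow> 'a \<Rightarrow> 'a)"
  by unfold_locales (simp_all add: algebra_simps)

definition ring_ideal :: "'a::comm_ring_1 set \<Rightarrow> bool"
  where "ring_ideal J \<longleftrightarrow> module.subspace (*) J"

definition ideal_generated :: "'a::comm_ring_1 set \<Rightarrow> 'a set"
  where "ideal_generated X = module.span (*) X"

definition prime_ideal :: "'a::comm_ring_1 set \<Rightarrow> bool"
  where "prime_ideal P \<longleftrightarrow>
    ring_ideal P \<and> P \<noteq> UNIV \<and> (\<forall>a b. a * b \<in> P \<longrightarrow> a \<in> P \<or> b \<in> P)"

definition maximal_ideal :: "'a::comm_ring_1 set \<Rightarrow> bool"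
  where "maximal_ideal M \<longleftrightarrow>
    ring_ideal M \<and> M \<noteq> UNIV \<and> (\<forall>J. ring_ideal J \<longrightarrow> M \<subseteq> J \<longrightarrow> J = M \<or> J = UNIV)"

definition noetherian :: "'a::comm_ring_1 itself \<Rightarrow> bool"
  where "noetherian _ \<longleftrightarrow>
    (\<forall>J :: 'a set. ring_ideal J \<longrightarrow> (\<exists>X. finite X \<and> J = ideal_generated X))"

definition krull_dim :: "'a::comm_ring_1 itself \<Rightarrow> enat"
  where "krull_dim _ =
    Sup {enat n | n. \<exists>P :: nat \<Rightarrow> 'a set.
      (\<forall>i\<le>n. prime_ideal (P i)) \<and> (\<forall>i<n. P i \<subset> P (Suc i))}"

definition local_ring :: "'a::comm_ring_1 set \<Rightarrow> bool"
  where "local_ring \<mm> \<longleftrightarrow> maximal_ideal \<mm> \<and> (\<forall>M. maximal_ideal M \<longrightarrow> M = \<mm>)"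

text \<open>The ring \<open>'a\<close>, with maximal ideal \<open>\<mm>\<close>, is a regular local ring of dimension \<open>d\<close>.\<close>

definition regular_local_ring :: "'a::comm_ring_1 set \<Rightarrow> nat \<Rightarrow> bool"
  where "regular_local_ring \<mm> d \<longleftrightarrow>
    noetherian TYPE('a) \<and> local_ring \<mm> \<and> krull_dim TYPE('a) = enat d \<and>
    (\<exists>X. finite X \<and> card X = d \<and> \<mm> = ideal_generated X)"


section \<open>Valuations\<close>

text \<open>The value of \<open>\<nu>\<close> at \<open>0\<close> plays the role of infinity: it is left unspecified and never used.
  The value group of \<open>\<nu>\<close> is \<open>\<nu> ` (- {0})\<close>, a subgroup of \<open>'g\<close>.\<close>

definition valuation :: "('k::field \<Rightarrow> 'g::linordered_ab_group_add) \<Rightarrow> bool"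
  where "valuation \<nu> \<longleftrightarrow>
    (\<forall>x y. x \<noteq> 0 \<longrightarrow> y \<noteq> 0 \<longrightarrow> \<nu> (x * y) = \<nu> x + \<nu> y) \<and>
    (\<forall>x y. x \<noteq> 0 \<longrightarrow> y \<noteq> 0 \<longrightarrow> x + y \<noteq> 0 \<longrightarrow> min (\<nu> x) (\<nu> y) \<le> \<nu> (x + y))"

definition valuation_ring :: "('k::field \<Rightarrow> 'g::linordered_ab_group_add) \<Rightarrow> 'k set"
  where "valuation_ring \<nu> = {x. x = 0 \<or> 0 \<le> \<nu> x}"

definition valuation_ideal :: "('k::field \<Rightarrow> 'g::linordered_ab_group_add) \<Rightarrow> 'k set"
  where "valuation_ideal \<nu> = {x. x = 0 \<or> 0 < \<nu> x}"

definition dominates ::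
    "('a::idom fract \<Rightarrow> 'g::linordered_ab_group_add) \<Rightarrow> 'a set \<Rightarrow> bool"
  where "dominates \<nu> \<mm> \<longleftrightarrow>
    range to_fract \<subseteq> valuation_ring \<nu> \<and>
    valuation_ideal \<nu> \<inter> range to_fract = to_fract ` \<mm>"

definition value_semigroup :: "('a::idom fract \<Rightarrow> 'g::linordered_ab_group_add) \<Rightarrow> 'g set"
  where "value_semigroup \<nu> = {\<nu> (to_fract f) | f. f \<noteq> 0}"


section \<open>Semigroups and indices of subgroups\<close>

definition subsemigroup :: "'g::semigroup_add set \<Rightarrow> bool"
  where "subsemigroup T \<longleftrightarrow> (\<forall>x\<in>T. \<forall>y\<in>T. x + y \<in> T)"

definition semigroup_generated :: "'g::semigroup_add set \<Rightarrow> 'g set"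
  where "semigroup_generated X = subsemigroup hull X"

definition subgroup_index :: "'g::ab_group_add set \<Rightarrow> 'g set \<Rightarrow> enat"
  where "subgroup_index G H =
    (let cosets = (\<lambda>x. (+) x ` H) ` G
     in if finite cosets then enat (card cosets) else \<infinity>)"

text \<open>\<open>nbar \<beta> i = [G(\<beta>\<^sub>0, \<dots>, \<beta>\<^sub>i) : G(\<beta>\<^sub>0, \<dots>, \<beta>\<^bsub>i-1\<^esub>)]\<close>, for \<open>i \<ge> 1\<close>.\<close>

definition nbar :: "(nat \<Rightarrow> 'g::ab_group_add) \<Rightarrow> nat \<Rightarrow> enat"
  where "nbar \<beta> i = subgroup_index (group_closure (\<beta> ` {..i})) (group_closure (\<beta> ` {..<i}))"

definition nat_multiple :: "nat \<Rightarrow> 'g::comm_monoid_add \<Rightarrow> 'g"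
  where "nat_multiple n x = (\<Sum>j<n. x)"


section \<open>Independence of the choice of the value group\<close>

text \<open>
  Whether \<open>S \<union> {0}\<close> is a value semigroup up to an isomorphism of ordered groups
  can be tested with valuations having values in the group \<open>'g\<close> that contains \<open>S\<close>: if \<open>\<nu>\<close> has
  values in another ordered group \<open>'h\<close>, and an embedding \<open>\<phi>\<close> of the ordered group generated
  by \<open>S\<close> takes \<open>S \<union> {0}\<close> to the semigroup of \<open>\<nu>\<close>, then \<open>\<nu>\<close> can be replaced by an equivalent
  valuation with values in \<open>'g\<close> whose semigroup is \<open>S \<union> {0}\<close> itself.
\<close>

lemma value_group_identification:
  fixes \<nu> :: "'a::idom fract \<Rightarrow> 'h::linordered_ab_group_add"
    and \<phi> :: "'g::linordered_ab_group_add \<Rightarrow> 'h"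
  assumes val: "valuation \<nu>" and dom: "dominates \<nu> \<mm>"
    and add: "\<And>x y. x \<in> group_closure S \<Longrightarrow> y \<in> group_closure S \<Longrightarrow> \<phi> (x + y) = \<phi> x + \<phi> y"
    and mono: "strict_mono_on (group_closure S) \<phi>"
    and sem: "value_semigroup \<nu> = \<phi> ` (S \<union> {0})"
  shows "\<exists>\<nu>' :: 'a fract \<Rightarrow> 'g. valuation \<nu>' \<and> valuation_ring \<nu>' = valuation_ring \<nu> \<and>
    dominates \<nu>' \<mm> \<and> value_semigroup \<nu>' = S \<union> {0}"
proof -
  let ?G = "group_closure S"
  have SG: "S \<union> {0} \<subseteq> ?G"
    by (auto intro: group_closure.base)
  have inj: "inj_on \<phi> ?G"
    using mono by (rule strict_mono_on_imp_inj_on)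
  have le: "\<phi> x \<le> \<phi> y \<longleftrightarrow> x \<le> y" if "x \<in> ?G" "y \<in> ?G" for x y
    using strict_mono_on_less_eq[OF mono that] .
  have less: "\<phi> x < \<phi> y \<longleftrightarrow> x < y" if "x \<in> ?G" "y \<in> ?G" for x y
    using strict_mono_on_less[OF mono that] .
  have zero: "\<phi> 0 = 0"
    using add[of 0 0] by simp
  have diff: "\<phi> (x - y) = \<phi> x - \<phi> y" if "x \<in> ?G" "y \<in> ?G" for x y
    using add[OF group_closure.diff[OF that] that(2)] by (simp add: algebra_simps)
  have image: "\<nu> x \<in> \<phi> ` ?G" if "x \<noteq> 0" for x
  proof -
    obtain a b where x: "x = Fract a b" and b: "b \<noteq> 0"
      by (cases x)
    have a: "a \<noteq> 0"
      using that x b by (auto simp: Zero_fract_def eq_fract)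
    have eq: "x * to_fract b = to_fract a"
      using b by (simp add: x to_fract_def eq_fract)
    have "\<nu> (to_fract a) = \<nu> x + \<nu> (to_fract b)"
      using val that b unfolding valuation_def eq[symmetric] by (metis to_fract_eq_0_iff)
    moreover obtain s t where "s \<in> S \<union> {0}" "t \<in> S \<union> {0}"
        "\<nu> (to_fract a) = \<phi> s" "\<nu> (to_fract b) = \<phi> t"
      using sem a b unfolding value_semigroup_def by blast
    moreover from this have st: "s \<in> ?G" "t \<in> ?G"
      using SG by blast+
    ultimately have "\<nu> x = \<phi> (s - t)"
      using diff[OF st] by (simp add: algebra_simps)
    moreover have "s - t \<in> ?G"
      using st by (rule group_closure.diff)
    ultimately show ?thesis by blast
  qed
  define \<nu>' where "\<nu>' x = inv_into ?G \<phi> (\<nu> x)" for x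
  have G: "\<nu>' x \<in> ?G" and \<phi>: "\<phi> (\<nu>' x) = \<nu> x" if "x \<noteq> 0" for x
    unfolding \<nu>'_def using image[OF that] by (auto intro: inv_into_into f_inv_into_f)
  have "valuation \<nu>'"
    unfolding valuation_def
  proof (intro conjI allI impI)
    fix x y :: "'a fract" assume xy: "x \<noteq> 0" "y \<noteq> 0"
    have "\<phi> (\<nu>' (x * y)) = \<phi> (\<nu>' x + \<nu>' y)"
      using val xy by (simp add: valuation_def \<phi> G add)
    then show "\<nu>' (x * y) = \<nu>' x + \<nu>' y"
      using inj xy by (auto dest!: inj_onD intro: G group_closure_add)
    assume s: "x + y \<noteq> 0"
    have "min (\<phi> (\<nu>' x)) (\<phi> (\<nu>' y)) \<le> \<phi> (\<nu>' (x + y))"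
      using val xy s by (simp add: valuation_def \<phi>)
    then show "min (\<nu>' x) (\<nu>' y) \<le> \<nu>' (x + y)"
      using xy s by (simp add: min_le_iff_disj le G)
  qed
  moreover have ring: "valuation_ring \<nu>' = valuation_ring \<nu>"
    unfolding valuation_ring_def
    using le[OF group_closure.base[of 0 S] G] by (auto simp: zero \<phi>)
  moreover have "valuation_ideal \<nu>' = valuation_ideal \<nu>"
    unfolding valuation_ideal_def
    using less[OF group_closure.base[of 0 S] G] by (auto simp: zero \<phi>)
  then have "dominates \<nu>' \<mm>"
    using dom ring by (simp add: dominates_def)
  moreover have "value_semigroup \<nu>' = inv_into ?G \<phi> ` value_semigroup \<nu>"
    unfolding value_semigroup_def \<nu>'_def by blast
  then have "value_semigroup \<nu>' = S \<union> {0}"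
    unfolding sem using inv_into_image_cancel[OF inj SG] by simp
  ultimately show ?thesis by blast
qed

end

theory Submission
  imports Defs "HOL-Library.Multiset" "HOL-Library.Product_Lexorder" "HOL-Library.Product_Plus"
begin

text \<open>
  Let \<open>x, y\<close> be regular parameters. The ring modulo \<open>x\<close> is a discrete valuation ring, so every element
  that is not divisible by \<open>x\<close> has a degree, the order of its residue; it replaces the degree in \<open>y\<close> of
  a polynomial in MacLane's theory of key polynomials, and division with remainder modulo \<open>x\<close> is
  combined with Nakayama's lemma in place of a completion.

  Given a dominating valuation, let \<open>\<beta>\<^sub>0\<close> be the value of \<open>x\<close>. The values \<open>s\<close> for which \<open>s - \<beta>\<^sub>0\<close> is
  not a value are strictly increasing functions of the degree, and the successive minimal
  generators of the semigroup over \<open>\<beta>\<^sub>0\<close> are among them. If \<open>P\<close> has value \<open>\<beta>\<^sub>i\<close>, then up to the value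
  \<open>n\<^sub>i \<beta>\<^sub>i\<close> the valuation ideals are generated by products of powers of \<open>x\<close> and \<open>P\<close> with an element of
  degree less than that of \<open>P\<close>, so the next generator exceeds \<open>n\<^sub>i \<beta>\<^sub>i\<close>.

  Conversely, \<open>n\<^sub>i \<beta>\<^sub>i\<close> is a combination of \<open>\<beta>\<^sub>0, \<dots>, \<beta>\<^bsub>i-1\<^esub>\<close> in which \<open>\<beta>\<^sub>0\<close> occurs. Subtracting the
  corresponding monomial from the \<open>n\<^sub>i\<close>-th power of the key element \<open>P\<^sub>i\<close> gives \<open>P\<^bsub>i+1\<^esub>\<close>, starting from
  \<open>P\<^sub>0 = x\<close> and \<open>P\<^sub>1 = y\<close>. The ideals generated by the monomials in the \<open>P\<^sub>i\<close> of weight at least \<open>\<gamma>\<close>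
  are the valuation ideals of the required valuation.
\<close>

section \<open>Ideals in Noetherian rings\<close>

text \<open>The ring need be neither complete nor contain a field, and the residue field of \<nu>
  may be larger than that of the ring. So for a given valuation leading coefficients in powers of a
  key element are not under control; ideals of elements of large value are compared instead, and
  \<open>nbar\<close> enters through the multiples of a generator that fall into the group of the
  earlier ones. A generator that exceeds all multiples of \<open>\<beta> 0\<close>, or has no
  positive multiple in that group, completes the semigroup; hence an infinite index occurs only at
  the end. In the construction \<open>\<beta> 0\<close> occurs in the relation for
  \<open>n i \<cdot> \<beta> i\<close> because the other generators, with bounded exponents,
  contribute less than \<open>\<beta> i\<close>; this makes degrees multiplicative modulo
  \<open>x\<close>. Two cases resist. A finite last generator may satisfy a relation without any
  later key element to absorb it; it is perturbed by an infinitesimal. An infinite sequence with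
  \<open>n i\<close> = 1 from some point on has bounded degrees, so reduction to standard monomials
  need not stop; it is cut after finitely many generators.\<close>

lemma ring_ideal_iff:
  "ring_ideal J \<longleftrightarrow> 0 \<in> J \<and> (\<forall>a\<in>J. \<forall>b\<in>J. a + b \<in> J) \<and> (\<forall>c. \<forall>a\<in>J. c * a \<in> J)"
  unfolding ring_ideal_def module.subspace_def[OF module_times] by simp

lemma ring_ideal_zero: "ring_ideal J \<Longrightarrow> 0 \<in> J"
  and ring_ideal_add: "ring_ideal J \<Longrightarrow> a \<in> J \<Longrightarrow> b \<in> J \<Longrightarrow> a + b \<in> J"
  and ring_ideal_mult: "ring_ideal J \<Longrightarrow> a \<in> J \<Longrightarrow> c * a \<in> J"
  by (auto simp: ring_ideal_iff)

lemma ring_ideal_uminus: "ring_ideal J \<Longrightarrow> a \<in> J \<Longrightarrow> - a \<in> J"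
  using ring_ideal_mult[of J a "- 1"] by simp

lemma ring_ideal_diff: "ring_ideal J \<Longrightarrow> a \<in> J \<Longrightarrow> b \<in> J \<Longrightarrow> a - b \<in> J"
  using ring_ideal_add[of J a "- b"] ring_ideal_uminus[of J b] by simp

lemma ring_idealI:
  assumes "0 \<in> J" "\<And>a b. a \<in> J \<Longrightarrow> b \<in> J \<Longrightarrow> a + b \<in> J" "\<And>c a. a \<in> J \<Longrightarrow> c * a \<in> J"
  shows "ring_ideal J"
  using assms by (auto simp: ring_ideal_iff)

lemma ring_ideal_generated: "ring_ideal (ideal_generated X)"
  unfolding ring_ideal_def ideal_generated_def
  by (rule module.subspace_span[OF module_times])

lemma ideal_generated_base: "a \<in> X \<Longrightarrow> a \<in> ideal_generated X"
  unfolding ideal_generated_def by (rule module.span_base[OF module_times])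

lemma ideal_generated_least: "X \<subseteq> J \<Longrightarrow> ring_ideal J \<Longrightarrow> ideal_generated X \<subseteq> J"
  unfolding ideal_generated_def ring_ideal_def by (rule module.span_minimal[OF module_times])

lemma ring_ideal_UN_chain:
  assumes "A \<noteq> {}" "\<And>a. a \<in> A \<Longrightarrow> ring_ideal (J a)"
    and "\<And>a b. a \<in> A \<Longrightarrow> b \<in> A \<Longrightarrow> J a \<subseteq> J b \<or> J b \<subseteq> J a"
  shows "ring_ideal (\<Union>a\<in>A. J a)"
proof (rule ring_idealI)
  show "0 \<in> (\<Union>a\<in>A. J a)" using assms(1,2) ring_ideal_zero by blast
next
  fix a b assume "a \<in> (\<Union>a\<in>A. J a)" "b \<in> (\<Union>a\<in>A. J a)"
  then obtain i j where ij: "i \<in> A" "j \<in> A" "a \<in> J i" "b \<in> J j" by blast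
  then obtain k where "k \<in> A" "a \<in> J k" "b \<in> J k" using assms(3)[OF ij(1,2)] by blast
  then have "a + b \<in> J k" using assms(2) by (simp add: ring_ideal_add)
  then show "a + b \<in> (\<Union>a\<in>A. J a)" using \<open>k \<in> A\<close> by blast
next
  fix c a assume "a \<in> (\<Union>a\<in>A. J a)"
  then show "c * a \<in> (\<Union>a\<in>A. J a)" using assms(2) ring_ideal_mult by blast
qed

lemma ring_ideal_plus_multiples:
  assumes "ring_ideal J" shows "ring_ideal {j + a * z | j a. j \<in> J}"
proof (rule ring_idealI)
  show "0 \<in> {j + a * z | j a. j \<in> J}"
    using ring_ideal_zero[OF assms] by (auto intro!: exI[of _ 0])
next
  fix a b assume "a \<in> {j + a * z | j a. j \<in> J}" "b \<in> {j + a * z | j a. j \<in> J}"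
  then obtain j a' k b' where "j \<in> J" "k \<in> J" "a = j + a' * z" "b = k + b' * z" by blast
  then have "a + b = (j + k) + (a' + b') * z" "j + k \<in> J"
    using ring_ideal_add[OF assms] by (auto simp: algebra_simps)
  then show "a + b \<in> {j + a * z | j a. j \<in> J}" by blast
next
  fix c a assume "a \<in> {j + a * z | j a. j \<in> J}"
  then obtain j a' where "j \<in> J" "a = j + a' * z" by blast
  then have "c * a = c * j + (c * a') * z" "c * j \<in> J"
    by (simp_all add: algebra_simps ring_ideal_mult[OF assms, of j c])
  then show "c * a \<in> {j + a * z | j a. j \<in> J}" by blast
qed

lemma noetherian_chain_stabilizes:
  fixes J :: "nat \<Rightarrow> 'a::comm_ring_1 set"
  assumes noeth: "noetherian TYPE('a)" and J: "\<And>n. ring_ideal (J n)"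
    and mono: "\<And>n. J n \<subseteq> J (Suc n)"
  shows "\<exists>n. \<forall>m\<ge>n. J m = J n"
proof -
  have le: "J m \<subseteq> J n" if "m \<le> n" for m n
    using lift_Suc_mono_le[of J m n] mono that by blast
  have "ring_ideal (\<Union>n\<in>UNIV. J n)"
  proof (rule ring_ideal_UN_chain)
    show "J m \<subseteq> J n \<or> J n \<subseteq> J m" for m n 
      using le[of m n] le[of n m] by (cases "m \<le> n") auto
  qed (simp_all add: J)
  with noeth have "\<exists>X. finite X \<and> (\<Union>n. J n) = ideal_generated X"
    unfolding noetherian_def by simp
  then obtain X where X: "finite X" "(\<Union>n. J n) = ideal_generated X" by auto
  have "\<forall>a\<in>X. \<exists>n. a \<in> J n"
    using X(2) ideal_generated_base by blast
  then obtain f where f: "\<And>a. a \<in> X \<Longrightarrow> a \<in> J (f a)" by metis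
  define N where "N = (\<Sum>a\<in>X. f a)"
  have "f a \<le> N" if "a \<in> X" for a
    unfolding N_def using X(1) that by (simp add: member_le_sum)
  then have "X \<subseteq> J N" using f le by blast
  then have "(\<Union>n. J n) \<subseteq> J N" unfolding X(2) by (rule ideal_generated_least[OF _ J])
  then show ?thesis using le by (intro exI[of _ N]) blast
qed

text \<open>Here \<open>t\<close> lies in the Jacobson radical.\<close>

lemma nakayama_principal:
  fixes J N :: "'a::comm_ring_1 set"
  assumes noeth: "noetherian TYPE('a)" and J: "ring_ideal J"
    and t: "\<And>a. 1 - a * t dvd 1"
    and N: "\<And>z. z \<in> N \<Longrightarrow> \<exists>j\<in>J. \<exists>w\<in>N. z = j + t * w"
  shows "N \<subseteq> J"
proof
  fix z assume z: "z \<in> N"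
  obtain g where g: "\<And>z. z \<in> N \<Longrightarrow> g z \<in> N \<and> (\<exists>j\<in>J. z = j + t * g z)"
    using N by metis
  define s where "s n = (g ^^ n) z" for n
  have sN: "s n \<in> N" for n by (induction n) (auto simp: s_def z g)
  have step: "\<exists>j\<in>J. s n = j + t * s (Suc n)" for n
    using g[OF sN[of n]] by (simp add: s_def)
  \<comment> \<open>\<open>N\<close> is an arbitrary set, so finitely many generators are not at
    hand. Instead the ideals J + (s n) increase, as \<open>s n\<close> is a multiple of
    \<open>s (Suc n)\<close> modulo \<open>J\<close>; once they stop, \<open>s (Suc n)\<close> is
    modulo \<open>J\<close> a multiple of \<open>t\<close> times itself.\<close>
  define K where "K n = {j + a * s n | j a. j \<in> J}" for n
  have K: "ring_ideal (K n)" for n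
    unfolding K_def by (rule ring_ideal_plus_multiples[OF J])
  have KS: "K n \<subseteq> K (Suc n)" for n
  proof
    fix r assume "r \<in> K n"
    then obtain j a where r: "r = j + a * s n" "j \<in> J" by (auto simp: K_def)
    obtain i where i: "i \<in> J" "s n = i + t * s (Suc n)" using step by blast
    have "r = (j + a * i) + (a * t) * s (Suc n)" using r i by (simp add: algebra_simps)
    moreover have "j + a * i \<in> J"
      using r i J by (simp add: ring_ideal_add ring_ideal_mult)
    ultimately show "r \<in> K (Suc n)" unfolding K_def by blast
  qed
  obtain n where "K (Suc n) = K n"
    using noetherian_chain_stabilizes[where J = K, OF noeth K KS] by (meson Suc_n_not_le_n nat_le_linear)
  moreover have "0 + 1 * s (Suc n) \<in> K (Suc n)"
    unfolding K_def using ring_ideal_zero[OF J] by blast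
  ultimately obtain j a where j: "j \<in> J" "s (Suc n) = j + a * s n"
    unfolding K_def by auto
  obtain i where i: "i \<in> J" "s n = i + t * s (Suc n)" using step by blast
  have "(1 - a * t) * s (Suc n) = j + a * i"
    using j(2) i(2) by (simp add: algebra_simps)
  then have "(1 - a * t) * s (Suc n) \<in> J"
    using j(1) i(1) J by (simp add: ring_ideal_add ring_ideal_mult)
  moreover obtain b where b: "1 = (1 - a * t) * b" using t[of a] ..
  have "b * ((1 - a * t) * s (Suc n)) = (1 - a * t) * b * s (Suc n)"
    by (simp only: ac_simps)
  then have "s (Suc n) = b * ((1 - a * t) * s (Suc n))"
    by (simp flip: b)
  ultimately have "s (Suc n) \<in> J" using ring_ideal_mult[OF J] by metis
  moreover have "s m \<in> J" if "s (Suc m) \<in> J" for m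
    using step[of m] that J by (auto simp: ring_ideal_add ring_ideal_mult)
  ultimately have "s 0 \<in> J"
    by (induction n) auto
  then show "z \<in> J" by (simp add: s_def)
qed

text \<open>In place of the Artin-Rees lemma, the colon ideals of \<open>J\<close> by powers of
  \<open>t\<close> increase, and at an index n where they stop one factor \<open>t\<close> of
  t^(n+1) can be cancelled modulo \<open>J\<close>. If z = j + t^(n+1) a lies in every J + (t^m),
  this cancellation puts t^n a there as well, and Nakayama's lemma applies to the
  intersection.\<close>

lemma krull_intersection_principal:
  fixes J :: "'a::comm_ring_1 set"
  assumes noeth: "noetherian TYPE('a)" and J: "ring_ideal J"
    and t: "\<And>a. 1 - a * t dvd 1"
    and z: "\<And>n. \<exists>j\<in>J. \<exists>a. z = j + t ^ n * a"
  shows "z \<in> J"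
proof -
  define N where "N = {z. \<forall>n. \<exists>j\<in>J. \<exists>a. z = j + t ^ n * a}"
  define K where "K n = {a. t ^ n * a \<in> J}" for n
  have K: "ring_ideal (K n)" for n
    unfolding K_def using J
    by (intro ring_idealI) (auto simp: ring_ideal_zero ring_ideal_add distrib_left
        mult.left_commute[of "t ^ n"] ring_ideal_mult)
  have KS: "K n \<subseteq> K (Suc n)" for n
    unfolding K_def using J by (auto simp: ring_ideal_mult mult.assoc)
  obtain n where n: "K (Suc n) = K n"
    using noetherian_chain_stabilizes[where J = K, OF noeth K KS] by (meson Suc_n_not_le_n nat_le_linear)
  have "N \<subseteq> J"
  proof (rule nakayama_principal[OF noeth J t])
    fix z assume "z \<in> N"
    then have zN: "\<exists>j\<in>J. \<exists>a. z = j + t ^ m * a" for m by (auto simp: N_def)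
    obtain j a where ja: "j \<in> J" "z = j + t ^ Suc n * a" using zN by blast
    have "t ^ n * a \<in> N"
      unfolding N_def
    proof (intro CollectI allI)
      fix m
      obtain i b where ib: "i \<in> J" "z = i + t ^ Suc (n + m) * b" using zN by blast
      have "t ^ Suc n * (a - t ^ m * b) = i - j"
        using ja(2) ib(2) by (simp add: algebra_simps power_add)
      then have "a - t ^ m * b \<in> K (Suc n)"
        unfolding K_def using ja ib J by (simp add: ring_ideal_diff)
      then have "a - t ^ m * b \<in> K n" using n by simp
      then have "t ^ n * (a - t ^ m * b) \<in> J" by (simp add: K_def)
      moreover have "t ^ n * a = t ^ n * (a - t ^ m * b) + t ^ m * (t ^ n * b)"
        by (simp add: algebra_simps)
      ultimately show "\<exists>j\<in>J. \<exists>c. t ^ n * a = j + t ^ m * c" by blast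
    qed
    then show "\<exists>j\<in>J. \<exists>w\<in>N. z = j + t * w" using ja by (auto simp: mult.assoc)
  qed
  then show ?thesis using z by (auto simp: N_def)
qed

section \<open>Maximal ideals and local rings\<close>

lemma proper_ideal_subset_maximal:
  fixes J :: "'a::comm_ring_1 set"
  assumes J: "ring_ideal J" "1 \<notin> J"
  shows "\<exists>M. maximal_ideal M \<and> J \<subseteq> M"
proof -
  define \<A> where "\<A> = {K. ring_ideal K \<and> 1 \<notin> K \<and> J \<subseteq> K}"
  have "\<exists>M\<in>\<A>. \<forall>X\<in>\<A>. M \<subseteq> X \<longrightarrow> X = M"
  proof (rule subset_Zorn_nonempty)
    show "\<A> \<noteq> {}" using J by (auto simp: \<A>_def)
  next
    fix C assume C: "C \<noteq> {}" "subset.chain \<A> C"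
    then have "ring_ideal (\<Union>K\<in>C. K)"
      by (intro ring_ideal_UN_chain) (auto simp: subset.chain_def \<A>_def)
    then show "\<Union>C \<in> \<A>"
      using C by (auto simp: \<A>_def subset.chain_def)
  qed
  then obtain M where M: "M \<in> \<A>" "\<And>X. X \<in> \<A> \<Longrightarrow> M \<subseteq> X \<Longrightarrow> X = M" by blast
  have "K = M \<or> K = UNIV" if K: "ring_ideal K" "M \<subseteq> K" for K
  proof (cases "1 \<in> K")
    case True
    then have "K = UNIV" using ring_ideal_mult[OF K(1), of 1] by auto
    then show ?thesis ..
  next
    case False
    then show ?thesis using M(1) K by (intro disjI1 M(2)) (auto simp: \<A>_def)
  qed
  then show ?thesis using M(1) by (auto simp: \<A>_def maximal_ideal_def)
qed

lemma local_ring_mem_iff: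
  fixes \<mm> :: "'a::comm_ring_1 set"
  assumes "local_ring \<mm>"
  shows "f \<in> \<mm> \<longleftrightarrow> \<not> f dvd 1"
proof
  have m: "ring_ideal \<mm>" "\<mm> \<noteq> UNIV" using assms by (auto simp: local_ring_def maximal_ideal_def)
  assume f: "f \<in> \<mm>"
  show "\<not> f dvd 1"
  proof
    assume "f dvd 1"
    then obtain g where "1 = f * g" ..
    then have "a \<in> \<mm>" for a
      using ring_ideal_mult[OF m(1) f, of "a * g"] by (simp add: mult.assoc mult.commute[of g] flip: \<open>1 = f * g\<close>)
    then show False using m(2) by blast
  qed
next
  assume f: "\<not> f dvd 1"
  have z: "ring_ideal {0 :: 'a}" by (auto simp: ring_ideal_iff)
  have "{j + a * f | j a. j \<in> {0}} = {a * f | a. True}" by auto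
  then have "ring_ideal {a * f | a. True}"
    using ring_ideal_plus_multiples[OF z, of f] by simp
  moreover have "1 \<notin> {a * f | a. True}"
  proof
    assume "1 \<in> {a * f | a. True}"
    then obtain a where "1 = a * f" by blast
    then show False using f by (metis dvd_triv_right)
  qed
  ultimately obtain M where "maximal_ideal M" "{a * f | a. True} \<subseteq> M"
    using proper_ideal_subset_maximal by blast
  moreover have "1 * f \<in> {a * f | a. True}" by blast
  ultimately have "f \<in> M" "M = \<mm>"
    using assms by (auto simp: local_ring_def)
  then show "f \<in> \<mm>" by simp
qed

lemma ideal_generated_pair: "ideal_generated {x, y} = {a * x + b * y | a b. True}"
proof
  have z: "ring_ideal {0 :: 'a}" by (auto simp: ring_ideal_iff)
  have "{j + a * x | j a. j \<in> {0}} = {a * x | a. True}" by auto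
  then have "ring_ideal {a * x | a. True}"
    using ring_ideal_plus_multiples[OF z, of x] by simp
  from ring_ideal_plus_multiples[OF this, of y]
  have "ring_ideal {j + a * y | j a. j \<in> {a * x | a. True}}" .
  moreover have "{j + a * y | j a. j \<in> {a * x | a. True}} = {a * x + b * y | a b. True}" by auto
  ultimately have "ring_ideal {a * x + b * y | a b. True}" by simp
  moreover have "x = 1 * x + 0 * y" "y = 0 * x + 1 * y" by simp_all
  then have "{x, y} \<subseteq> {a * x + b * y | a b. True}" by blast
  ultimately show "ideal_generated {x, y} \<subseteq> {a * x + b * y | a b. True}"
    by (rule ideal_generated_least[rotated])
next
  show "{a * x + b * y | a b. True} \<subseteq> ideal_generated {x, y}"
    by (auto intro: ring_ideal_add[OF ring_ideal_generated] ring_ideal_mult[OF ring_ideal_generated]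
        ideal_generated_base)
qed

text \<open>A nonunit coefficient of y^k is a combination of \<open>x\<close> and \<open>y\<close>,
  so modulo \<open>x\<close> it releases another factor \<open>y\<close>. Stopping at a given
  \<open>k\<close> avoids any claim that the order modulo \<open>x\<close> is finite.\<close>

lemma expand_mod_x:
  fixes x y r :: "'a::comm_ring_1"
  assumes gen: "\<And>f. f dvd 1 \<or> (\<exists>a b. f = a * x + b * y)"
  shows "(\<exists>e<k. \<exists>u h. u dvd 1 \<and> r = u * y ^ e + x * h) \<or> (\<exists>c h. r = c * y ^ k + x * h)"
proof (induction k)
  case 0
  show ?case by (intro disjI2 exI[of _ r] exI[of _ 0]) simp
next
  case (Suc k)
  show ?case
  proof (cases "\<exists>e<k. \<exists>u h. u dvd 1 \<and> r = u * y ^ e + x * h")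
    case True
    then show ?thesis using less_SucI by blast
  next
    case False
    then obtain c h where c: "r = c * y ^ k + x * h" using Suc by blast
    show ?thesis
    proof (cases "c dvd 1")
      case True
      then show ?thesis using c by blast
    next
      case False
      then obtain a b where "c = a * x + b * y" using gen by blast
      then have "r = b * y ^ Suc k + x * (a * y ^ k + h)" using c by (simp add: algebra_simps)
      then show ?thesis by blast
    qed
  qed
qed

text \<open>A special case of Krull's principal ideal theorem. The decreasing ideals \<open>J n\<close> are the
  contractions of the powers of \<open>f\<close> in the localization at \<open>Q\<close>; modulo \<open>x\<close> they
  stabilize, so by Nakayama they stabilize, which is absurd.\<close>

lemma parameter_power_not_dvd:
  fixes x y f :: "'a::idom"
  assumes noeth: "noetherian TYPE('a)"
    and units: "\<And>f. \<not> f dvd 1 \<longleftrightarrow> (\<exists>a b. f = a * x + b * y)"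
    and Q: "prime_ideal Q" and f: "f \<in> Q" "f \<noteq> 0" and g: "g \<notin> Q" "\<not> g dvd 1"
  shows "\<not> x dvd y ^ b"
proof
  assume b: "x dvd y ^ b"
  have QI: "ring_ideal Q" and Qne: "Q \<noteq> UNIV"
    and Qp: "\<And>a b. a * b \<in> Q \<Longrightarrow> a \<in> Q \<or> b \<in> Q"
    using Q by (auto simp: prime_ideal_def)
  have one: "1 \<notin> Q" using Qne ring_ideal_mult[OF QI, of 1] by auto
  have pw: "z \<in> Q" if "z ^ n \<in> Q" for z n
    using that by (induction n) (use one Qp in auto)
  have xQ: "x \<notin> Q"
  proof
    assume x: "x \<in> Q"
    then have "y ^ b \<in> Q" using b ring_ideal_mult[OF QI x] by (auto elim!: dvdE simp: mult.commute)
    then have "y \<in> Q" by (rule pw)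
    then have "g \<in> Q" using g(2) units x QI by (auto simp: ring_ideal_add ring_ideal_mult)
    then show False using g by simp
  qed
  have rad: "1 - a * x dvd 1" for a
  proof (rule ccontr)
    assume "\<not> 1 - a * x dvd 1"
    then obtain c d where "1 - a * x = c * x + d * y" using units by blast
    then have "1 = (c + a) * x + d * y" by (simp add: algebra_simps)
    then have "\<not> 1 dvd (1::'a)" using units by blast
    then show False by simp
  qed
  define J where "J n = {r. \<exists>s. s \<notin> Q \<and> f ^ n dvd s * r}" for n
  have J: "ring_ideal (J n)" for n
  proof (rule ring_idealI)
    show "0 \<in> J n" using one by (auto simp: J_def)
  next
    fix a b assume "a \<in> J n" "b \<in> J n"
    then obtain s s' where s: "s \<notin> Q" "s' \<notin> Q" "f ^ n dvd s * a" "f ^ n dvd s' * b"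
      by (auto simp: J_def)
    have "s * s' * (a + b) = s' * (s * a) + s * (s' * b)" by (simp add: algebra_simps)
    then have "f ^ n dvd s * s' * (a + b)" using s by simp
    then show "a + b \<in> J n" using s Qp unfolding J_def by blast
  next
    fix c a assume "a \<in> J n"
    then show "c * a \<in> J n" by (auto simp: J_def mult.left_commute[of _ c])
  qed
  have JS: "J (Suc n) \<subseteq> J n" for n
    by (auto simp: J_def dest: dvd_mult_right)
  \<comment> \<open>Orders modulo \<open>x\<close>, below \<open>b\<close>, of the elements of
    \<open>J n\<close>. As \<open>x\<close> divides y^b, no other orders matter, so these finite
    sets play the part of lengths modulo \<open>x\<close>; where their cardinality is minimal they
    stop shrinking.\<close>
  define W where "W n = {e. e < b \<and> (\<exists>r\<in>J n. \<exists>u h. u dvd 1 \<and> r = u * y ^ e + x * h)}" for n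
  have Wfin: "finite (W n)" for n by (auto simp: W_def)
  have WS: "W (Suc n) \<subseteq> W n" for n using JS by (fastforce simp: W_def)
  obtain n where "\<And>m. card (W n) \<le> card (W m)"
    using ex_has_least_nat[of "\<lambda>_. True" 0 "\<lambda>n. card (W n)"] by auto
  then have W: "W (Suc n) = W n"
    by (intro card_subset_eq[OF Wfin WS] antisym card_mono[OF Wfin WS])
  have "J n \<subseteq> J (Suc n)"
  proof (rule nakayama_principal[OF noeth J rad])
    fix r assume r: "r \<in> J n"
    have "\<exists>j\<in>J (Suc n). \<exists>a. r = j + x * a"
    proof (cases "x dvd r")
      case True
      then show ?thesis using ring_ideal_zero[OF J] by (auto elim!: dvdE intro!: bexI[of _ 0])
    next
      case False
      have "(\<exists>e<b. \<exists>u h. u dvd 1 \<and> r = u * y ^ e + x * h) \<or> (\<exists>c h. r = c * y ^ b + x * h)"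
        by (rule expand_mod_x) (use units in blast)
      moreover have "\<not> (\<exists>c h. r = c * y ^ b + x * h)" using b False by auto
      ultimately obtain e u h where e: "e < b" "u dvd 1" "r = u * y ^ e + x * h" by blast
      then have "e \<in> W (Suc n)" using r W by (auto simp: W_def)
      then obtain r' u' h' where r': "r' \<in> J (Suc n)" "u' dvd 1" "r' = u' * y ^ e + x * h'"
        by (auto simp: W_def)
      obtain w where w: "1 = u' * w" using r'(2) ..
      have "u * w * r' = u * (u' * w) * y ^ e + x * (u * w * h')"
        unfolding r'(3) by (simp add: algebra_simps)
      then have "r = u * w * r' + x * (h - u * w * h')"
        using e(3) w by (simp add: algebra_simps)
      then show ?thesis using ring_ideal_mult[OF J r'(1)] by blast
    qed
    then obtain j a where ja: "j \<in> J (Suc n)" "r = j + x * a" by blast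
    \<comment> \<open>As \<open>x\<close> is outside the prime \<open>Q\<close>, it can be moved
      into the denominator \<open>s\<close>. The part left over is therefore \<open>x\<close> times
      an element of \<open>J n\<close> itself, as Nakayama's lemma requires.\<close>
    have "x * a \<in> J n"
      using ring_ideal_diff[OF J r, of j] ja JS by auto
    then obtain s where "s \<notin> Q" "f ^ n dvd s * (x * a)" by (auto simp: J_def)
    then have "a \<in> J n" using xQ Qp[of s x] by (auto simp: J_def mult.assoc intro!: exI[of _ "s * x"])
    then show "\<exists>j\<in>J (Suc n). \<exists>w\<in>J n. r = j + x * w" using ja by blast
  qed
  moreover have "f ^ n \<in> J n" using one by (auto simp: J_def intro!: exI[of _ 1])
  ultimately have "f ^ n \<in> J (Suc n)" by blast
  then obtain s where s: "s \<notin> Q" "f ^ Suc n dvd s * f ^ n" by (auto simp only: J_def mem_Collect_eq)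
  then have "f dvd s" using f(2) by (simp add: mult.commute)
  then have "s \<in> Q" using ring_ideal_mult[OF QI f(1)] by (auto elim!: dvdE simp: mult.commute)
  then show False using s by simp
qed

lemma dvd_unit_cancel:
  fixes u :: "'a::comm_ring_1"
  assumes "u dvd 1" "x dvd u * z" shows "x dvd z"
proof -
  obtain w where w: "1 = u * w" using assms(1) ..
  have "z = w * (u * z)" by (metis w mult.assoc mult.commute mult_1)
  then show ?thesis using assms(2) by (metis dvd_mult)
qed

section \<open>Regular parameters in dimension two\<close>

text \<open>The maximal ideal is not named: it is the set of nonunits. \<open>not_dvd_power\<close>
  is the trace of dimension two, saying that \<open>y\<close> is not nilpotent modulo
  \<open>x\<close>.\<close>

locale regular_parameters =
  fixes x y :: "'a::idom"
  assumes noeth: "noetherian TYPE('a)"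
    and nonunit_iff: "\<And>f. \<not> f dvd 1 \<longleftrightarrow> (\<exists>a b. f = a * x + b * y)"
    and not_dvd_power: "\<And>n. \<not> x dvd y ^ n"
    and x_nonzero: "x \<noteq> 0"

lemma regular_local_ring_parameters:
  fixes \<mm> :: "'a::idom set"
  assumes "regular_local_ring \<mm> 2"
  shows "\<exists>x y :: 'a. regular_parameters x y \<and> \<mm> = {f. \<not> f dvd 1}"
proof -
  have noeth: "noetherian TYPE('a)" and loc: "local_ring \<mm>" and dim: "krull_dim TYPE('a) = enat 2"
    using assms by (auto simp: regular_local_ring_def)
  obtain X where "card X = 2" "\<mm> = ideal_generated X"
    using assms by (auto simp: regular_local_ring_def)
  then obtain x y where m: "\<mm> = {a * x + b * y | a b. True}"
    by (auto simp: card_2_iff ideal_generated_pair)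
  have mu: "f \<in> \<mm> \<longleftrightarrow> \<not> f dvd 1" for f by (rule local_ring_mem_iff[OF loc])
  have nu: "\<not> f dvd 1 \<longleftrightarrow> (\<exists>a b. f = a * x + b * y)" for f
    unfolding mu[symmetric] m by blast
  have nu': "\<not> f dvd 1 \<longleftrightarrow> (\<exists>a b. f = a * y + b * x)" for f
    unfolding nu by (metis add.commute)
  have "\<exists>n>1. \<exists>P :: nat \<Rightarrow> 'a set. (\<forall>i\<le>n. prime_ideal (P i)) \<and> (\<forall>i<n. P i \<subset> P (Suc i))"
  proof -
    have "enat 1 < krull_dim TYPE('a)" using dim by simp
    then obtain e n and P :: "nat \<Rightarrow> 'a set" where "enat 1 < e" "e = enat n"
        "(\<forall>i\<le>n. prime_ideal (P i)) \<and> (\<forall>i<n. P i \<subset> P (Suc i))"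
      unfolding krull_dim_def less_Sup_iff by blast
    then show ?thesis by auto
  qed
  then obtain n P where n: "n > 1" and P: "\<And>i. i \<le> n \<Longrightarrow> prime_ideal (P i)"
    and inc: "\<And>i. i < n \<Longrightarrow> P i \<subset> (P (Suc i) :: 'a set)" by blast
  \<comment> \<open>Lying strictly between two primes, \<open>Q\<close> contains a nonzero
    \<open>f\<close> and misses a nonunit \<open>g\<close>, as the special case of Krull's theorem
    asks.\<close>
  define Q where "Q = P 1"
  have Q: "prime_ideal Q" using P n by (simp add: Q_def)
  have "P 0 \<subset> Q" "Q \<subset> P 2" using inc[of 0] inc[of 1] n by (auto simp: Q_def numeral_2_eq_2)
  moreover have "0 \<in> P 0" using P[of 0] by (simp add: prime_ideal_def ring_ideal_zero)
  ultimately obtain f g where f: "f \<in> Q" "f \<noteq> 0" and g: "g \<in> P 2" "g \<notin> Q" by blast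
  have P2: "ring_ideal (P 2)" "P 2 \<noteq> UNIV" using P[of 2] n by (auto simp: prime_ideal_def)
  have "\<not> g dvd 1"
  proof
    assume "g dvd 1"
    then obtain h where "1 = g * h" ..
    then have "a \<in> P 2" for a
      using ring_ideal_mult[OF P2(1) g(1), of "a * h"] by (simp add: mult.assoc mult.commute[of h] flip: \<open>1 = g * h\<close>)
    then show False using P2(2) by blast
  qed
  \<comment> \<open>The second instance exchanges \<open>x\<close> and \<open>y\<close>; it excludes
    x = 0.\<close>
  note nd = parameter_power_not_dvd[OF noeth nu Q f g(2) this]
    parameter_power_not_dvd[OF noeth nu' Q f g(2) this]
  have "x \<noteq> 0" using nd(2)[of 1] by auto
  then have "regular_parameters x y"
    by (intro regular_parameters.intro noeth nu nd)
  moreover have "\<mm> = {f. \<not> f dvd 1}" using mu by auto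
  ultimately show ?thesis by blast
qed

context regular_parameters
begin

lemma x_nonunit: "\<not> x dvd 1"
  unfolding nonunit_iff by (metis add_0_right mult_1 mult_zero_left)

lemma y_nonunit: "\<not> y dvd 1"
  unfolding nonunit_iff by (metis add_0_left mult_1 mult_zero_left)

lemma y_nonzero: "y \<noteq> 0"
  using not_dvd_power[of 1] by auto

lemma nonunit_add:
  fixes f g :: 'a
  assumes "\<not> f dvd 1" "\<not> g dvd 1" shows "\<not> f + g dvd 1"
proof -
  obtain a b c d where "f = a * x + b * y" "g = c * x + d * y"
    using assms nonunit_iff by meson
  then have "f + g = (a + c) * x + (b + d) * y" by (simp add: algebra_simps)
  then show "\<not> f + g dvd 1" using nonunit_iff by blast
qed

lemma nonunit_mult: "\<not> g dvd 1 \<Longrightarrow> \<not> f * g dvd (1::'a)"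
  using dvd_mult_right by blast

lemma unit_add_nonunit:
  fixes u g :: 'a
  assumes "u dvd 1" "\<not> g dvd 1"
  shows "u + g dvd 1"
proof (rule ccontr)
  assume "\<not> u + g dvd 1"
  then have "\<not> (u + g) + - 1 * g dvd 1"
    by (rule nonunit_add[OF _ nonunit_mult[OF assms(2)]])
  then show False using assms(1) by simp
qed

lemma radical: "\<not> t dvd 1 \<Longrightarrow> 1 - a * t dvd (1::'a)"
  using unit_add_nonunit[of 1 "- a * t"] nonunit_mult[of t "- a"] by simp

lemma nakayama:
  assumes "ring_ideal J" "\<And>z. z \<in> N \<Longrightarrow> \<exists>j\<in>J. \<exists>w\<in>N. z = j + x * w"
  shows "N \<subseteq> J"
  by (rule nakayama_principal[OF noeth assms(1) radical[OF x_nonunit] assms(2)])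

lemma krull_intersection:
  fixes t :: 'a
  assumes "ring_ideal J" "\<not> t dvd 1" "\<And>n. \<exists>j\<in>J. \<exists>a. z = j + t ^ n * a"
  shows "z \<in> J"
  by (rule krull_intersection_principal[OF noeth assms(1) radical[OF assms(2)] assms(3)])

text \<open>The residue ring modulo \<open>x\<close> is a discrete valuation ring with uniformizer \<open>y\<close>;
  \<open>has_degree f c\<close> says that the residue of \<open>f\<close> has order \<open>c\<close>.\<close>

definition has_degree :: "'a \<Rightarrow> nat \<Rightarrow> bool"
  where "has_degree f c \<longleftrightarrow> (\<exists>u h. u dvd 1 \<and> f = u * y ^ c + x * h)"

lemma ring_ideal_multiples: "ring_ideal {f. z dvd f}"
  by (auto simp: ring_ideal_iff)

text \<open>An element without a finite order would lie in (x) + (y^n) for every n, hence in (x) by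
  Krull's intersection theorem.\<close>

lemma has_degree_exists:
  assumes "\<not> x dvd f" shows "\<exists>c. has_degree f c"
proof (rule ccontr)
  assume none: "\<nexists>c. has_degree f c"
  have "f \<in> {f. x dvd f}"
  proof (rule krull_intersection[OF ring_ideal_multiples y_nonunit])
    fix n
    have "(\<exists>e<n. \<exists>u h. u dvd 1 \<and> f = u * y ^ e + x * h) \<or> (\<exists>c h. f = c * y ^ n + x * h)"
      by (rule expand_mod_x) (use nonunit_iff in blast)
    then obtain c h where "f = c * y ^ n + x * h" using none unfolding has_degree_def by blast
    then show "\<exists>j\<in>{f. x dvd f}. \<exists>a. f = j + y ^ n * a"
      by (intro bexI[of _ "x * h"] exI[of _ c]) (auto simp: algebra_simps)
  qed
  then show False using assms by simp
qed

text \<open>If \<open>c\<close> were smaller than \<open>d\<close>, \<open>x\<close> would divide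
  y^c times a unit, because a unit plus a multiple of \<open>y\<close> is a unit. As
  \<open>r\<close> is arbitrary, this gives uniqueness of the degree as well as lower bounds for
  it.\<close>

lemma has_degree_le:
  assumes "has_degree f c" "f = r * y ^ d + x * h"
  shows "d \<le> c"
proof (rule ccontr)
  assume "\<not> d \<le> c"
  then obtain e where e: "d = c + Suc e" using less_imp_Suc_add[of c d] by auto
  obtain u h' where u: "u dvd 1" "f = u * y ^ c + x * h'" using assms by (auto simp: has_degree_def)
  have "(u + (- r * y ^ e) * y) * y ^ c = x * (h - h')"
    using u(2) assms(2) unfolding e by (simp add: algebra_simps power_add)
  then have "x dvd (u + (- r * y ^ e) * y) * y ^ c" by simp
  moreover have "u + (- r * y ^ e) * y dvd 1"
    by (rule unit_add_nonunit[OF u(1) nonunit_mult[OF y_nonunit]])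
  ultimately have "x dvd y ^ c" by (rule dvd_unit_cancel[rotated])
  then show False using not_dvd_power by blast
qed

lemma has_degree_not_dvd: "has_degree f c \<Longrightarrow> \<not> x dvd f"
  using has_degree_le[of f c 0 "Suc c"] by (auto elim!: dvdE)

lemma has_degree_nonzero: "has_degree f c \<Longrightarrow> f \<noteq> 0"
  using has_degree_not_dvd by fastforce

lemma has_degree_mult:
  assumes "has_degree f c" "has_degree g d" shows "has_degree (f * g) (c + d)"
proof -
  obtain u h where u: "u dvd 1" "f = u * y ^ c + x * h" using assms by (auto simp: has_degree_def)
  obtain v k where v: "v dvd 1" "g = v * y ^ d + x * k" using assms by (auto simp: has_degree_def)
  have "u * v dvd 1 * 1" using u(1) v(1) by (rule mult_dvd_mono)
  moreover have "f * g = (u * v) * y ^ (c + d) + x * (h * g + k * (u * y ^ c))"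
    unfolding u(2) v(2) by (simp add: algebra_simps power_add)
  ultimately show ?thesis unfolding has_degree_def by (metis mult_1)
qed

lemma has_degree_add_x: "has_degree f c \<Longrightarrow> has_degree (f + x * h) c"
  unfolding has_degree_def by (metis add.assoc distrib_left)

lemma has_degree_unit: "u dvd 1 \<Longrightarrow> has_degree u 0"
  unfolding has_degree_def by (intro exI[of _ u] exI[of _ 0]) simp

lemma has_degree_y: "has_degree (y ^ c) c"
  unfolding has_degree_def by (intro exI[of _ 1] exI[of _ 0]) simp

lemma has_degree_power: "has_degree f c \<Longrightarrow> has_degree (f ^ n) (n * c)"
  by (induction n) (auto simp: has_degree_unit has_degree_mult)

lemma has_degree_zero_unit: "has_degree f 0 \<Longrightarrow> f dvd 1"
  unfolding has_degree_def using unit_add_nonunit nonunit_mult[OF x_nonunit]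
  by (auto simp: mult.commute[of x])

text \<open>Division in the discrete valuation ring modulo \<open>x\<close>, lifted: the quotient is
  a unit times a power of \<open>y\<close>, and the remainder, instead of having smaller degree, is
  a multiple of \<open>x\<close>.\<close>

lemma has_degree_divide:
  assumes "has_degree f c" "has_degree g d" "d \<le> c"
  shows "\<exists>u h. u dvd 1 \<and> f = u * y ^ (c - d) * g + x * h"
proof -
  obtain u h where u: "u dvd 1" "f = u * y ^ c + x * h" using assms by (auto simp: has_degree_def)
  obtain v k where v: "v dvd 1" "g = v * y ^ d + x * k" using assms by (auto simp: has_degree_def)
  obtain w where w: "1 = v * w" using v(1) ..
  have c: "y ^ (c - d) * y ^ d = y ^ c" using assms(3) by (simp flip: power_add)
  have "u * w * y ^ (c - d) * g = u * (v * w) * (y ^ (c - d) * y ^ d) + x * (u * w * y ^ (c - d) * k)"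
    unfolding v(2) by (simp add: algebra_simps)
  then have "f = (u * w) * y ^ (c - d) * g + x * (h - u * w * y ^ (c - d) * k)"
    using u(2) c w by (simp add: algebra_simps)
  moreover have "w dvd 1" using w by (metis dvd_triv_right)
  with u(1) have "u * w dvd 1 * 1" by (rule mult_dvd_mono)
  ultimately show ?thesis by (metis mult_1)
qed

lemma x_prime: "x dvd f * g \<Longrightarrow> x dvd f \<or> x dvd g"
  using has_degree_exists has_degree_mult has_degree_not_dvd by metis

lemma x_factor:
  assumes "f \<noteq> 0" shows "\<exists>k g. f = x ^ k * g \<and> \<not> x dvd g"
proof (rule ccontr)
  assume none: "\<nexists>k g. f = x ^ k * g \<and> \<not> x dvd g"
  have "\<exists>g. f = x ^ n * g" for n
  proof (induction n)
    case (Suc n)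
    then show ?case using none by (metis dvdE mult.assoc power_Suc2)
  qed auto
  then have "f \<in> {f. 0 dvd f}"
    by (intro krull_intersection[OF ring_ideal_multiples x_nonunit]) auto
  then show False using assms by simp
qed

end

section \<open>Generated monoids and indices of subgroups\<close>

notation nat_multiple (infixr \<open>\<cdot>\<close> 75)

lemma nat_multiple_0 [simp]: "0 \<cdot> b = 0"
  by (simp add: nat_multiple_def)

lemma nat_multiple_Suc: "Suc n \<cdot> b = b + n \<cdot> b"
  by (simp add: nat_multiple_def add.commute)

lemma nat_multiple_1 [simp]: "Suc 0 \<cdot> b = b"
  by (simp add: nat_multiple_Suc)

lemma nat_multiple_add: "(m + n) \<cdot> b = m \<cdot> b + n \<cdot> b"
  by (induction m) (simp_all add: nat_multiple_Suc add.assoc)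

lemma nat_multiple_diff:
  fixes b :: "'g::ab_group_add"
  shows "m \<le> n \<Longrightarrow> (n - m) \<cdot> b = n \<cdot> b - m \<cdot> b"
  using nat_multiple_add[of "n - m" m b] by (simp add: algebra_simps)

lemma nat_multiple_nonneg: "0 \<le> b \<Longrightarrow> 0 \<le> n \<cdot> (b::'g::ordered_comm_monoid_add)"
  by (induction n) (simp_all add: nat_multiple_Suc)

lemma nat_multiple_pos: "0 < b \<Longrightarrow> 0 < n \<Longrightarrow> 0 < n \<cdot> (b::'g::linordered_ab_group_add)"
  by (cases n) (simp_all add: nat_multiple_Suc add_pos_nonneg nat_multiple_nonneg)

lemma nat_multiple_mono: "m \<le> n \<Longrightarrow> 0 \<le> b \<Longrightarrow> m \<cdot> b \<le> n \<cdot> (b::'g::ordered_comm_monoid_add)"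
  using nat_multiple_add[of m "n - m" b] nat_multiple_nonneg[of b "n - m"]
  by (simp add: add_increasing2)

lemma nat_multiple_mem_group_closure:
  "b \<in> group_closure X \<Longrightarrow> n \<cdot> b \<in> group_closure X"
  by (induction n) (simp_all add: nat_multiple_Suc group_closure_add)

lemma group_closure_mono: "X \<subseteq> Y \<Longrightarrow> group_closure X \<subseteq> group_closure Y"
proof
  fix g assume "X \<subseteq> Y" "g \<in> group_closure X"
  then show "g \<in> group_closure Y"
    by (induction rule: group_closure.induct[OF \<open>g \<in> group_closure X\<close>])
      (auto intro: group_closure.intros)
qed

text \<open>Unlike \<open>semigroup_generated\<close> it contains 0, the value of the units, so it
  is to be compared with \<open>S \<union> {0}\<close> rather than with \<open>S\<close>.\<close>

inductive_set monoid_generated :: "'g::ab_group_add set \<Rightarrow> 'g set" for X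
  where zero: "0 \<in> monoid_generated X"
  | add_base: "b \<in> X \<Longrightarrow> g \<in> monoid_generated X \<Longrightarrow> b + g \<in> monoid_generated X"

lemma monoid_generated_base: "b \<in> X \<Longrightarrow> b \<in> monoid_generated X"
  using monoid_generated.add_base[OF _ monoid_generated.zero] by fastforce

lemma monoid_generated_add:
  "g \<in> monoid_generated X \<Longrightarrow> h \<in> monoid_generated X \<Longrightarrow> g + h \<in> monoid_generated X"
  by (induction rule: monoid_generated.induct) (auto simp: add.assoc intro: monoid_generated.intros)

lemma monoid_generated_nat_multiple: "g \<in> monoid_generated X \<Longrightarrow> n \<cdot> g \<in> monoid_generated X"
  by (induction n) (auto simp: nat_multiple_Suc intro: monoid_generated.zero monoid_generated_add)

lemma monoid_generated_least:
  assumes "0 \<in> M" "\<And>g h. g \<in> M \<Longrightarrow> h \<in> M \<Longrightarrow> g + h \<in> M" "X \<subseteq> M"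
  shows "monoid_generated X \<subseteq> M"
proof
  fix g assume "g \<in> monoid_generated X"
  then show "g \<in> M" by induction (use assms in auto)
qed

lemma monoid_generated_mono: "X \<subseteq> Y \<Longrightarrow> monoid_generated X \<subseteq> monoid_generated Y"
  by (intro monoid_generated_least) (auto intro: monoid_generated.zero monoid_generated_add monoid_generated_base)

lemma monoid_generated_subset_closure: "monoid_generated X \<subseteq> group_closure X"
  by (intro monoid_generated_least) (auto intro: group_closure_add group_closure.base)

lemma semigroup_generated_Un_zero: "semigroup_generated X \<union> {0} = monoid_generated X"
proof
  have "subsemigroup (monoid_generated X)"
    by (auto simp: subsemigroup_def intro: monoid_generated_add)
  then show "semigroup_generated X \<union> {0} \<subseteq> monoid_generated X"
    unfolding semigroup_generated_def
    by (auto intro: monoid_generated.zero monoid_generated_base hull_minimal[THEN subsetD, rotated 2])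
next
  have "subsemigroup (semigroup_generated X)"
    unfolding semigroup_generated_def by (rule hull_in) (auto simp: subsemigroup_def)
  moreover have "X \<subseteq> semigroup_generated X"
    unfolding semigroup_generated_def by (rule hull_subset)
  ultimately show "monoid_generated X \<subseteq> semigroup_generated X \<union> {0}"
    by (intro monoid_generated_least) (auto simp: subsemigroup_def)
qed

lemma semigroup_generated_eq_iff:
  fixes S :: "'g::linordered_ab_group_add set"
  assumes "S \<subseteq> {0<..}" "X \<subseteq> {0<..}"
  shows "S = semigroup_generated X \<longleftrightarrow> S \<union> {0} = monoid_generated X"
proof -
  have "subsemigroup ({0<..} :: 'g set)" by (auto simp: subsemigroup_def add_pos_pos)
  then have "semigroup_generated X \<subseteq> {0<..}"
    unfolding semigroup_generated_def by (rule hull_minimal[OF assms(2)])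
  then have "0 \<notin> semigroup_generated X" "0 \<notin> S" using assms(1) by auto
  then show ?thesis unfolding semigroup_generated_Un_zero[symmetric] by (simp add: insert_ident)
qed

section \<open>Cyclic extensions of subgroups and their indices\<close>

lemma group_closure_insert:
  "g \<in> group_closure (insert b X) \<longleftrightarrow>
    (\<exists>h\<in>group_closure X. \<exists>m n. g = h + m \<cdot> b - n \<cdot> b)"
proof
  assume "g \<in> group_closure (insert b X)"
  then show "\<exists>h\<in>group_closure X. \<exists>m n. g = h + m \<cdot> b - n \<cdot> b"
  proof induction
    case (base s)
    consider "s \<in> insert 0 X" | "s = b" using base by auto
    then show ?case
    proof cases
      case 1
      then show ?thesis
        by (intro bexI[of _ s] exI[of _ 0] group_closure.base) simp_all
    next
      case 2
      then show ?thesis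
        by (intro bexI[of _ 0] exI[of _ "Suc 0"] exI[of _ 0]) simp_all
    qed
  next
    case (diff s t)
    then obtain h m n h' m' n' where
      "h \<in> group_closure X" "s = h + m \<cdot> b - n \<cdot> b"
      "h' \<in> group_closure X" "t = h' + m' \<cdot> b - n' \<cdot> b" by blast
    then have "s - t = (h - h') + (m + n') \<cdot> b - (n + m') \<cdot> b" "h - h' \<in> group_closure X"
      by (simp_all add: nat_multiple_add algebra_simps group_closure.diff)
    then show ?case by blast
  qed
next
  have "b \<in> group_closure (insert b X)" by (rule group_closure.base) simp
  then have "n \<cdot> b \<in> group_closure (insert b X)" for n
    by (rule nat_multiple_mem_group_closure)
  moreover have "group_closure X \<subseteq> group_closure (insert b X)"
    by (rule group_closure_mono) auto
  moreover assume "\<exists>h\<in>group_closure X. \<exists>m n. g = h + m \<cdot> b - n \<cdot> b"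
  ultimately show "g \<in> group_closure (insert b X)"
    by (auto intro!: group_closure.diff group_closure_add)
qed

lemma coset_eq_iff:
  fixes g g' :: "'g::ab_group_add"
  shows "(+) g ` group_closure X = (+) g' ` group_closure X \<longleftrightarrow> g - g' \<in> group_closure X"
proof
  assume "(+) g ` group_closure X = (+) g' ` group_closure X"
  moreover have "g + 0 \<in> (+) g ` group_closure X" by (rule imageI) simp
  ultimately obtain h where "g + 0 = g' + h" "h \<in> group_closure X" by auto
  then show "g - g' \<in> group_closure X" by (simp add: algebra_simps)
next
  have sub: "(+) g ` group_closure X \<subseteq> (+) g' ` group_closure X" if "g - g' \<in> group_closure X" for g g'
  proof
    fix z assume "z \<in> (+) g ` group_closure X"
    then obtain h where "z = g + h" "h \<in> group_closure X" by auto
    then have "z = g' + ((g - g') + h)" "(g - g') + h \<in> group_closure X"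
      using that by (simp_all add: group_closure_add)
    then show "z \<in> (+) g' ` group_closure X" by blast
  qed
  assume "g - g' \<in> group_closure X"
  moreover from this have "g' - g \<in> group_closure X"
    using group_closure_minus_iff[of "g - g'" X] by simp
  ultimately show "(+) g ` group_closure X = (+) g' ` group_closure X"
    by (intro antisym sub)
qed

lemma group_closure_insert_remainder:
  assumes n: "0 < n" "n \<cdot> b \<in> group_closure X" and g: "g \<in> group_closure (insert b X)"
  shows "\<exists>h\<in>group_closure X. \<exists>r<n. g = h + r \<cdot> b"
proof -
  have mult: "(n * k) \<cdot> b \<in> group_closure X" for k
    by (induction k) (simp_all add: nat_multiple_add group_closure_add n(2))
  obtain h p q where g: "h \<in> group_closure X" "g = h + p \<cdot> b - q \<cdot> b"
    using g unfolding group_closure_insert by blast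
  \<comment> \<open>This is p - q raised by n * q: a natural number since \<open>n\<close> is
    positive, while the added n * q copies of \<open>b\<close> stay in the subgroup.\<close>
  define s where "s = p + (n - 1) * q"
  have "s \<cdot> b + q \<cdot> b = p \<cdot> b + (n * q) \<cdot> b"
  proof -
    have "s + q = p + n * q"
      using n(1) by (cases n) (simp_all add: s_def)
    then show ?thesis by (simp flip: nat_multiple_add)
  qed
  then have "g = h - (n * q) \<cdot> b + s \<cdot> b"
    unfolding g(2) by (simp add: algebra_simps)
  also have "s \<cdot> b = (n * (s div n)) \<cdot> b + (s mod n) \<cdot> b"
    by (simp flip: nat_multiple_add)
  finally have "g = (h - (n * q) \<cdot> b + (n * (s div n)) \<cdot> b) + (s mod n) \<cdot> b"
    by (simp add: algebra_simps)
  moreover have "h - (n * q) \<cdot> b + (n * (s div n)) \<cdot> b \<in> group_closure X"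
    by (intro group_closure_add group_closure.diff mult g(1))
  moreover have "s mod n < n" using n(1) by simp
  ultimately show ?thesis by blast
qed

lemma subgroup_index_insert_infinite:
  assumes "\<And>m. 0 < m \<Longrightarrow> m \<cdot> b \<notin> group_closure X"
  shows "subgroup_index (group_closure (insert b X)) (group_closure X) = \<infinity>"
proof -
  let ?H = "group_closure X" and ?G = "group_closure (insert b X)"
  have b: "n \<cdot> b \<in> ?G" for n
    by (intro nat_multiple_mem_group_closure group_closure.base) simp
  have "inj (\<lambda>r. (+) (r \<cdot> b) ` ?H)"
  proof (rule linorder_injI)
    fix i j :: nat assume "i < j"
    then have "j \<cdot> b - i \<cdot> b \<notin> ?H"
      using assms[of "j - i"] by (simp add: nat_multiple_diff)
    then show "(+) (i \<cdot> b) ` ?H \<noteq> (+) (j \<cdot> b) ` ?H"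
      using coset_eq_iff[of "j \<cdot> b" X "i \<cdot> b"] by auto
  qed
  then have "infinite (range (\<lambda>r. (+) (r \<cdot> b) ` ?H))"
    using finite_imageD by blast
  moreover have "range (\<lambda>r. (+) (r \<cdot> b) ` ?H) \<subseteq> (\<lambda>g. (+) g ` ?H) ` ?G"
    using b by blast
  ultimately have "infinite ((\<lambda>g. (+) g ` ?H) ` ?G)"
    using finite_subset by blast
  then show ?thesis by (simp add: subgroup_index_def)
qed

lemma subgroup_index_insert_finite:
  assumes n: "0 < n" "n \<cdot> b \<in> group_closure X"
    and least: "\<And>m. 0 < m \<Longrightarrow> m < n \<Longrightarrow> m \<cdot> b \<notin> group_closure X"
  shows "subgroup_index (group_closure (insert b X)) (group_closure X) = enat n"
proof -
  let ?H = "group_closure X" and ?G = "group_closure (insert b X)"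
  have b: "n \<cdot> b \<in> ?G" for n
    by (intro nat_multiple_mem_group_closure group_closure.base) simp
  have "(\<lambda>g. (+) g ` ?H) ` ?G \<subseteq> (\<lambda>r. (+) (r \<cdot> b) ` ?H) ` {..<n}"
  proof
    fix C assume "C \<in> (\<lambda>g. (+) g ` ?H) ` ?G"
    then obtain g where g: "g \<in> ?G" "C = (+) g ` ?H" by blast
    obtain h r where "h \<in> ?H" "r < n" "g = h + r \<cdot> b"
      using group_closure_insert_remainder[OF n g(1)] by blast
    then have "C = (+) (r \<cdot> b) ` ?H" unfolding g(2) coset_eq_iff by simp
    then show "C \<in> (\<lambda>r. (+) (r \<cdot> b) ` ?H) ` {..<n}" using \<open>r < n\<close> by blast
  qed
  moreover have "(\<lambda>r. (+) (r \<cdot> b) ` ?H) ` {..<n} \<subseteq> (\<lambda>g. (+) g ` ?H) ` ?G"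
    using b by blast
  ultimately have eq: "(\<lambda>g. (+) g ` ?H) ` ?G = (\<lambda>r. (+) (r \<cdot> b) ` ?H) ` {..<n}" by blast
  have "inj_on (\<lambda>r. (+) (r \<cdot> b) ` ?H) {..<n}"
  proof (rule linorder_inj_onI')
    fix i j assume "i \<in> {..<n}" "j \<in> {..<n}" "i < j"
    then have "j \<cdot> b - i \<cdot> b \<notin> ?H"
      using least[of "j - i"] by (simp add: nat_multiple_diff)
    then show "(+) (i \<cdot> b) ` ?H \<noteq> (+) (j \<cdot> b) ` ?H"
      using coset_eq_iff[of "j \<cdot> b" X "i \<cdot> b"] by auto
  qed
  then have "card ((\<lambda>g. (+) g ` ?H) ` ?G) = n" unfolding eq by (simp add: card_image)
  moreover have "finite ((\<lambda>g. (+) g ` ?H) ` ?G)" unfolding eq by simp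
  ultimately show ?thesis by (simp add: subgroup_index_def)
qed

text \<open>The cosets of the multiples of \<open>b\<close> repeat exactly when a positive multiple
  falls into the subgroup. This turns \<open>nbar\<close> into a minimality statement about
  multiples of a generator.\<close>

lemma subgroup_index_insert_cases:
  obtains (infinite) "subgroup_index (group_closure (insert b X)) (group_closure X) = \<infinity>"
      "\<And>m. 0 < m \<Longrightarrow> m \<cdot> b \<notin> group_closure X"
    | (finite) n where "subgroup_index (group_closure (insert b X)) (group_closure X) = enat n"
      "0 < n" "n \<cdot> b \<in> group_closure X" "\<And>m. 0 < m \<Longrightarrow> m < n \<Longrightarrow> m \<cdot> b \<notin> group_closure X"
proof (cases "\<exists>m>0. m \<cdot> b \<in> group_closure X")
  case True
  define n where "n = (LEAST m. 0 < m \<and> m \<cdot> b \<in> group_closure X)"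
  have n: "0 < n" "n \<cdot> b \<in> group_closure X"
    using LeastI_ex[OF True] by (auto simp: n_def)
  have least: "m \<cdot> b \<notin> group_closure X" if "0 < m" "m < n" for m
    using not_less_Least[of m "\<lambda>m. 0 < m \<and> m \<cdot> b \<in> group_closure X"] that by (auto simp: n_def)
  show ?thesis
    by (rule finite[OF subgroup_index_insert_finite[OF n least] n least])
next
  case False
  then have none: "\<And>m. 0 < m \<Longrightarrow> m \<cdot> b \<notin> group_closure X" by blast
  show ?thesis
    by (rule infinite[OF subgroup_index_insert_infinite[OF none] none])
qed

lemma nbar_insert:
  "nbar \<beta> i = subgroup_index (group_closure (insert (\<beta> i) (\<beta> ` {..<i}))) (group_closure (\<beta> ` {..<i}))"
  unfolding nbar_def by (simp add: lessThan_Suc_atMost[symmetric] lessThan_Suc)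

section \<open>Generators of a value semigroup\<close>

locale dominating_valuation = regular_parameters x y for x y :: "'a::idom" +
  fixes v :: "'a \<Rightarrow> 'g::linordered_ab_group_add"
  assumes v_mult: "f \<noteq> 0 \<Longrightarrow> g \<noteq> 0 \<Longrightarrow> v (f * g) = v f + v g"
    and v_add: "f \<noteq> 0 \<Longrightarrow> g \<noteq> 0 \<Longrightarrow> f + g \<noteq> 0 \<Longrightarrow> min (v f) (v g) \<le> v (f + g)"
    and v_nonneg: "f \<noteq> 0 \<Longrightarrow> 0 \<le> v f"
    and v_pos_iff: "f \<noteq> 0 \<Longrightarrow> 0 < v f \<longleftrightarrow> \<not> f dvd 1"
begin

definition T :: "'g set" where "T = v ` (- {0})"

definition I :: "'g \<Rightarrow> 'a set" where "I \<gamma> = {f. f = 0 \<or> \<gamma> \<le> v f}"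

definition Igt :: "'g \<Rightarrow> 'a set" where "Igt \<gamma> = {f. f = 0 \<or> \<gamma> < v f}"

lemma T_I: "f \<noteq> 0 \<Longrightarrow> v f \<in> T"
  by (auto simp: T_def)

lemma T_E: assumes "t \<in> T" obtains f where "f \<noteq> 0" "v f = t"
  using assms by (auto simp: T_def)

lemma T_add: "s \<in> T \<Longrightarrow> t \<in> T \<Longrightarrow> s + t \<in> T"
  by (elim T_E) (metis T_I v_mult mult_eq_0_iff)

lemma v_unit: "u dvd 1 \<Longrightarrow> v u = 0"
  by (metis antisym_conv2 dvd_0_left_iff v_nonneg v_pos_iff zero_neq_one)

lemma T_zero: "0 \<in> T"
  using T_I[of 1] by (simp add: v_unit)

lemma T_nonneg: "t \<in> T \<Longrightarrow> 0 \<le> t"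
  by (elim T_E) (auto simp: v_nonneg)

lemma v_x_pos: "0 < v x"
  using v_pos_iff x_nonzero x_nonunit by simp

lemma v_y_pos: "0 < v y"
  using v_pos_iff y_nonzero y_nonunit by simp

lemma v_power: "f \<noteq> 0 \<Longrightarrow> v (f ^ n) = n \<cdot> v f"
  by (induction n) (simp_all add: v_unit v_mult nat_multiple_Suc)

lemma ring_ideal_I: "ring_ideal (I \<gamma>)"
proof (rule ring_idealI)
  fix f g assume "f \<in> I \<gamma>" "g \<in> I \<gamma>"
  then show "f + g \<in> I \<gamma>"
    using v_add[of f g] unfolding I_def
    by (cases "f = 0 \<or> g = 0 \<or> f + g = 0") (auto simp: min_def split: if_splits)
next
  fix c f assume "f \<in> I \<gamma>"
  then show "c * f \<in> I \<gamma>"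
    using v_mult[of c f] v_nonneg[of c] unfolding I_def
    by (cases "c = 0 \<or> f = 0") (auto intro: add_increasing)
qed (simp add: I_def)

lemma ring_ideal_Igt: "ring_ideal (Igt \<gamma>)"
proof (rule ring_idealI)
  fix f g assume "f \<in> Igt \<gamma>" "g \<in> Igt \<gamma>"
  then show "f + g \<in> Igt \<gamma>"
    using v_add[of f g] unfolding Igt_def
    by (cases "f = 0 \<or> g = 0 \<or> f + g = 0") (auto simp: min_def split: if_splits)
next
  fix c f assume "f \<in> Igt \<gamma>"
  then show "c * f \<in> Igt \<gamma>"
    using v_mult[of c f] v_nonneg[of c] unfolding Igt_def
    by (cases "c = 0 \<or> f = 0") (auto intro: add_nonneg_pos less_le_trans simp: add_increasing)
qed (simp add: Igt_def)

lemma v_add_Igt: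
  assumes "f \<noteq> 0" "g \<in> Igt (v f)"
  shows "f + g \<noteq> 0 \<and> v (f + g) = v f"
proof (cases "g = 0")
  case False
  then have g: "v f < v g" using assms by (simp add: Igt_def)
  have f: "f \<notin> Igt (v f)" using assms by (simp add: Igt_def)
  have "f + g \<notin> Igt (v f)"
    using ring_ideal_diff[OF ring_ideal_Igt _ assms(2), of "f + g"] f by auto
  then have "f + g \<noteq> 0" "v (f + g) \<le> v f" by (auto simp: Igt_def)
  moreover have "v f \<le> v (f + g)" using v_add[OF assms(1) False] calculation(1) g by simp
  ultimately show ?thesis by simp
qed (use assms in simp)

text \<open>A strictly decreasing sequence of values would give a strictly increasing sequence of
  the ideals \<open>I\<close>. The values are thus well-ordered, which allows induction on values
  and the choice of a least missing one.\<close>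

lemma T_has_min:
  assumes "X \<subseteq> T" "X \<noteq> {}"
  shows "\<exists>m\<in>X. \<forall>t\<in>X. m \<le> t"
proof (rule ccontr)
  assume "\<not> ?thesis"
  then have "\<forall>m\<in>X. \<exists>t\<in>X. t < m" by (meson not_le)
  then obtain s where s: "\<And>m. m \<in> X \<Longrightarrow> s m \<in> X \<and> s m < m" by metis
  obtain m0 where m0: "m0 \<in> X" using assms(2) by blast
  define t where "t n = (s ^^ n) m0" for n
  have tX: "t n \<in> X" for n by (induction n) (simp_all add: t_def m0 s)
  have tS: "t (Suc n) < t n" for n using s[OF tX[of n]] by (simp add: t_def)
  have "I (t n) \<subseteq> I (t (Suc n))" for n using tS[of n] by (auto simp: I_def)
  then obtain n where n: "I (t (Suc n)) = I (t n)"
    using noetherian_chain_stabilizes[where J = "\<lambda>n. I (t n)", OF noeth ring_ideal_I]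
    by (meson le_Suc_eq order_refl)
  obtain f where f: "f \<noteq> 0" "v f = t (Suc n)" using tX[of "Suc n"] assms(1) T_E by blast
  then have "f \<in> I (t (Suc n))" by (simp add: I_def)
  then show False using f tS[of n] unfolding n by (simp add: I_def)
qed

lemma T_induct [consumes 1, case_names less]:
  assumes "t \<in> T" "\<And>t. t \<in> T \<Longrightarrow> (\<And>s. s \<in> T \<Longrightarrow> s < t \<Longrightarrow> Q s) \<Longrightarrow> Q t"
  shows "Q t"
proof (rule ccontr)
  assume "\<not> Q t"
  then obtain m where m: "m \<in> {t \<in> T. \<not> Q t}" "\<forall>t\<in>{t \<in> T. \<not> Q t}. m \<le> t"
    using T_has_min[of "{t \<in> T. \<not> Q t}"] assms(1) by blast
  have "Q m" by (rule assms(2)) (use m in force)+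
  then show False using m by blast
qed

section \<open>The Apery set of the value semigroup with respect to \<open>v x\<close>\<close>

definition apery :: "'g set" where "apery = {t \<in> T. t - v x \<notin> T}"

lemma apery_T: "a \<in> apery \<Longrightarrow> a \<in> T"
  by (simp add: apery_def)

lemma T_apery_decomp: "t \<in> T \<Longrightarrow> \<exists>a\<in>apery. \<exists>k. t = a + k \<cdot> v x"
proof (induction t rule: T_induct)
  case (less t)
  show ?case
  proof (cases "t - v x \<in> T")
    case True
    moreover have "t - v x < t" using v_x_pos by simp
    ultimately obtain a k where "a \<in> apery" "t - v x = a + k \<cdot> v x" using less(2) by blast
    then have "a \<in> apery" "t = a + Suc k \<cdot> v x"
      by (simp_all add: nat_multiple_Suc algebra_simps)
    then show ?thesis by blast
  next
    case False
    then have "t \<in> apery" "t = t + 0 \<cdot> v x" using less(1) by (simp_all add: apery_def)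
    then show ?thesis by blast
  qed
qed

lemma apery_not_dvd: "f \<noteq> 0 \<Longrightarrow> v f \<in> apery \<Longrightarrow> \<not> x dvd f"
proof
  assume f: "f \<noteq> 0" "v f \<in> apery" and "x dvd f"
  then obtain h where h: "f = x * h" by blast
  then have "v f - v x = v h" "h \<noteq> 0" using f v_mult[of x h] by auto
  then show False using f(2) T_I[of h] by (simp add: apery_def)
qed

text \<open>If the degree of \<open>f\<close> were larger, division of \<open>f\<close> by \<open>g\<close> would leave a multiple of \<open>x\<close>
  with the same value as \<open>f\<close>.\<close>

lemma apery_degree_less:
  assumes f: "v f \<in> apery" "has_degree f c" and g: "has_degree g d" "v f < v g"
  shows "c < d"
proof (rule ccontr)
  assume "\<not> c < d"
  then obtain u h where u: "u dvd 1" "f = u * y ^ (c - d) * g + x * h"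
    using has_degree_divide[OF f(2) g(1)] by (auto simp: not_less)
  have f0: "f \<noteq> 0" using f(2) by (rule has_degree_nonzero)
  have "g \<in> Igt (v f)" using g(2) by (simp add: Igt_def)
  then have "- (u * y ^ (c - d)) * g \<in> Igt (v f)" by (rule ring_ideal_mult[OF ring_ideal_Igt])
  then have "f + - (u * y ^ (c - d)) * g \<noteq> 0 \<and> v (f + - (u * y ^ (c - d)) * g) = v f"
    by (rule v_add_Igt[OF f0])
  moreover have "f + - (u * y ^ (c - d)) * g = x * h" using u(2) by (simp add: algebra_simps)
  ultimately have "x * h \<noteq> 0" "v (x * h) = v f" by metis+
  then have "v (x * h) \<in> apery" using f(1) by simp
  then show False using apery_not_dvd[OF \<open>x * h \<noteq> 0\<close>] by simp
qed

text \<open>Multiplying \<open>g\<close> by \<open>y\<close> costs one degree and makes the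
  inequality of values strict.\<close>

lemma apery_degree_le:
  assumes f: "v f \<in> apery" "has_degree f c" and g: "has_degree g d" "v f \<le> v g"
  shows "c \<le> d"
proof -
  have "has_degree (y * g) (Suc d)" using has_degree_mult[OF has_degree_y[of 1] g(1)] by simp
  moreover have "v f < v (y * g)"
    using v_mult[OF y_nonzero has_degree_nonzero[OF g(1)]] v_y_pos g(2) by (simp add: add_strict_increasing)
  ultimately show ?thesis using apery_degree_less[OF f] by fastforce
qed

lemma apery_has_degree: "f \<noteq> 0 \<Longrightarrow> v f \<in> apery \<Longrightarrow> \<exists>c. has_degree f c"
  using apery_not_dvd has_degree_exists by blast

text \<open>Degrees embed the Apery set into the natural numbers, preserving the order. This is why
  a countable sequence of generators reaches every value.\<close>

lemma finite_apery_below: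
  assumes "a \<in> apery" shows "finite {s \<in> apery. s < a}"
proof -
  have "\<exists>f c. v f = s \<and> has_degree f c" if "s \<in> apery" for s
    using that apery_has_degree apery_T T_E by metis
  then obtain F D where FD: "\<And>s. s \<in> apery \<Longrightarrow> v (F s) = s \<and> has_degree (F s) (D s)" by metis
  have D: "D s < D t" if "s \<in> apery" "t \<in> apery" "s < t" for s t
    using apery_degree_less[of "F s" "D s" "F t" "D t"] FD that by simp
  have "D ` {s \<in> apery. s < a} \<subseteq> {..<D a}" using D assms by auto
  then have "finite (D ` {s \<in> apery. s < a})" by (rule finite_subset) simp
  moreover have "inj_on D {s \<in> apery. s < a}"
    by (rule linorder_inj_onI') (use D in fastforce)
  ultimately show ?thesis by (rule finite_imageD)
qed

end

text \<open>\<open>X\<close> holds the generators found so far, \<beta> is a value below which they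
  suffice, and \<open>P\<close> realizes it. Elements of degree less than \<open>b\<close> have
  values below \<beta>, so these values are already in the monoid; such elements serve as
  coefficients of the powers of \<open>P\<close>.\<close>

locale key_step = dominating_valuation x y v for x y :: "'a::idom"
    and v :: "'a \<Rightarrow> 'g::linordered_ab_group_add" +
  fixes X :: "'g set" and \<beta> :: 'g and P :: 'a and b :: nat
  assumes x_in: "v x \<in> X"
    and below: "\<And>t. t \<in> T \<Longrightarrow> t < \<beta> \<Longrightarrow> t \<in> monoid_generated X"
    and \<beta>_apery: "\<beta> \<in> apery" and \<beta>_pos: "0 < \<beta>"
    and vP: "v P = \<beta>" and P_degree: "has_degree P b"
begin

lemma P_nonzero: "P \<noteq> 0"
  using P_degree by (rule has_degree_nonzero)

lemma b_pos: "0 < b"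
  using has_degree_zero_unit[of P] P_degree v_unit[of P] vP \<beta>_pos by (cases b) auto

lemma small_degree_less: "has_degree q c \<Longrightarrow> c < b \<Longrightarrow> v q < \<beta>"
  using apery_degree_le[of P b q c] \<beta>_apery vP P_degree by (meson not_le)

lemma small_degree_mem: "has_degree q c \<Longrightarrow> c < b \<Longrightarrow> v q \<in> monoid_generated X"
  using small_degree_less below T_I has_degree_nonzero by blast

definition monomials :: "'g \<Rightarrow> 'a set"
  where "monomials \<delta> = {x ^ k * q * P ^ l | k q l. (\<exists>c<b. has_degree q c) \<and> \<delta> \<le> v (x ^ k * q * P ^ l)}"

lemma v_monomial:
  assumes "q \<noteq> 0" shows "v (x ^ k * q * P ^ l) = k \<cdot> v x + v q + l \<cdot> \<beta>"
  using assms by (simp add: v_mult x_nonzero P_nonzero v_power vP)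

lemma monomials_subset_I: "ideal_generated (monomials \<delta>) \<subseteq> I \<delta>"
  by (intro ideal_generated_least ring_ideal_I) (auto simp: monomials_def I_def)

text \<open>All values of elements of degree \<open>c\<close> lie below \<beta>. Each is one of the
  finitely many Apery values below \<beta> plus fewer than \<open>K\<close> copies of
  \<open>v x\<close>, so only finitely many occur.\<close>

lemma maximal_value_of_degree:
  assumes K: "\<beta> \<le> K \<cdot> v x" and c: "c < b"
  shows "\<exists>q. has_degree q c \<and> (\<forall>q'. has_degree q' c \<longrightarrow> v q' \<le> v q)"
proof -
  let ?V = "{v q | q. has_degree q c}"
  have "?V \<subseteq> (\<lambda>(a, k). a + k \<cdot> v x) ` ({s \<in> apery. s < \<beta>} \<times> {..<K})"
  proof
    fix t assume "t \<in> ?V"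
    then obtain q where q: "t = v q" "has_degree q c" by blast
    then have t: "t \<in> T" "t < \<beta>" using small_degree_less[OF q(2) c] T_I has_degree_nonzero by auto
    obtain a k where ak: "a \<in> apery" "t = a + k \<cdot> v x" using T_apery_decomp[OF t(1)] by blast
    have "0 \<le> a" using ak T_nonneg apery_T by blast
    then have "k \<cdot> v x \<le> t" unfolding ak(2) by simp
    then have "k \<cdot> v x < K \<cdot> v x" using t K by simp
    then have "k < K" using nat_multiple_mono[of K k "v x"] v_x_pos by (meson less_imp_le not_le)
    moreover have "a \<le> t" unfolding ak(2) using nat_multiple_nonneg[of "v x" k] v_x_pos by simp
    ultimately show "t \<in> (\<lambda>(a, k). a + k \<cdot> v x) ` ({s \<in> apery. s < \<beta>} \<times> {..<K})"
      using ak le_less_trans[OF \<open>a \<le> t\<close> t(2)] by (intro image_eqI[of _ _ "(a, k)"]) simp_all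
  qed
  then have "finite ?V"
    by (rule finite_subset) (use finite_apery_below[OF \<beta>_apery] in simp)
  moreover have "?V \<noteq> {}" using has_degree_y by blast
  ultimately have "Max ?V \<in> ?V" by (rule Max_in)
  then obtain q where q: "has_degree q c" "Max ?V = v q" by blast
  have "v q' \<le> v q" if "has_degree q' c" for q'
    unfolding q(2)[symmetric] using that by (intro Max_ge \<open>finite ?V\<close>) blast
  then show ?thesis using q(1) by blast
qed

lemma multiple_mem_closure:
  assumes "q \<noteq> 0" "q' \<noteq> 0" "v q \<in> monoid_generated X" "v q' \<in> monoid_generated X" "l < l'"
    and "k \<cdot> v x + v q + l \<cdot> \<beta> = k' \<cdot> v x + v q' + l' \<cdot> \<beta>"
  shows "(l' - l) \<cdot> \<beta> \<in> group_closure X"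
proof -
  have x: "k \<cdot> v x \<in> group_closure X" for k
    by (intro nat_multiple_mem_group_closure group_closure.base) (simp add: x_in)
  have "(l' - l) \<cdot> \<beta> = k \<cdot> v x + v q - (k' \<cdot> v x + v q')"
    using assms(5,6) by (simp add: nat_multiple_diff algebra_simps)
  then show ?thesis
    using x monoid_generated_subset_closure[of X] assms(3,4)
    by (auto intro!: group_closure.diff group_closure_add)
qed

text \<open>An element of least degree \<open>c + l * b\<close> in \<open>I \<delta>\<close> is \<open>u * Q * P ^ l\<close> plus a multiple of \<open>x\<close>,
  where \<open>Q\<close> has the greatest value among the elements of degree \<open>c\<close>. If \<open>Q * P ^ l\<close> were not in \<open>I \<delta>\<close>, its
  value would cancel against monomials with the same exponent \<open>l\<close> of \<open>P\<close>, by the bound on \<open>\<delta>\<close>, and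
  dividing by \<open>P ^ l\<close> would give an element of degree \<open>c\<close> with a greater value than \<open>Q\<close>.\<close>

lemma value_ideal_generated_by_monomials:
  assumes K: "\<beta> \<le> K \<cdot> v x"
  shows "\<delta> \<in> T \<Longrightarrow> (\<And>m. 0 < m \<Longrightarrow> m \<cdot> \<beta> \<in> group_closure X \<Longrightarrow> \<delta> \<le> m \<cdot> \<beta>) \<Longrightarrow>
    I \<delta> \<subseteq> ideal_generated (monomials \<delta>)"
proof (induction \<delta> rule: T_induct)
  case (less \<delta>)
  let ?J = "\<lambda>\<gamma>. ideal_generated (monomials \<gamma>)"
  have IH: "I \<gamma> \<subseteq> ?J \<gamma>" if "\<gamma> \<in> T" "\<gamma> < \<delta>" for \<gamma>
    using less.IH[OF that] less.prems that(2) by (meson less_imp_le order_trans)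
  \<comment> \<open>The induction on values enters here: if \<open>h\<close> is not in
    \<open>I \<delta>\<close>, it is a combination of monomials of value at least
    \<open>v h\<close>, and the factor \<open>x\<close> lifts their values to at least
    \<delta>.\<close>
  have step: "\<exists>j\<in>?J \<delta>. \<exists>w\<in>I \<delta>. x * h = j + x * w" if xh: "x * h \<in> I \<delta>" for h
  proof (cases "h \<in> I \<delta>")
    case True
    then show ?thesis
      by (intro bexI[of _ 0] bexI[of _ h]) (simp_all add: ring_ideal_zero ring_ideal_generated)
  next
    case False
    then have h: "h \<noteq> 0" "v h < \<delta>" by (auto simp: I_def)
    then have ge: "\<delta> \<le> v x + v h" using xh by (simp add: I_def x_nonzero v_mult)
    have "h \<in> ?J (v h)" using IH[OF T_I[OF h(1)] h(2)] by (auto simp: I_def)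
    moreover have "?J (v h) \<subseteq> {g. x * g \<in> ?J \<delta>}"
    proof (rule ideal_generated_least)
      show "ring_ideal {g. x * g \<in> ?J \<delta>}"
        by (rule ring_idealI)
          (auto simp: distrib_left mult.left_commute[of x] ring_ideal_zero[OF ring_ideal_generated]
            intro: ring_ideal_add[OF ring_ideal_generated] ring_ideal_mult[OF ring_ideal_generated])
      show "monomials (v h) \<subseteq> {g. x * g \<in> ?J \<delta>}"
      proof
        fix g assume "g \<in> monomials (v h)"
        then obtain k q l c where g: "g = x ^ k * q * P ^ l" "c < b" "has_degree q c"
            "v h \<le> v (x ^ k * q * P ^ l)" by (auto simp: monomials_def)
        have q: "q \<noteq> 0" using g(3) by (rule has_degree_nonzero)
        have "x * g = x ^ Suc k * q * P ^ l" by (simp add: g(1) mult.assoc)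
        moreover have "\<delta> \<le> v (x ^ Suc k * q * P ^ l)"
          using ge g(4) unfolding v_monomial[OF q] nat_multiple_Suc
          by (simp add: add.assoc) (metis add_left_mono order_trans)
        ultimately have "x * g \<in> monomials \<delta>" unfolding monomials_def using g(2,3) by blast
        then show "g \<in> {g. x * g \<in> ?J \<delta>}" by (simp add: ideal_generated_base)
      qed
    qed
    ultimately have "x * h \<in> ?J \<delta>" by blast
    then show ?thesis
      by (intro bexI[of _ "x * h"] bexI[of _ 0]) (simp_all add: ring_ideal_zero[OF ring_ideal_I])
  qed
  show ?case
  proof (rule nakayama[OF ring_ideal_generated])
    fix f assume f: "f \<in> I \<delta>"
    show "\<exists>j\<in>?J \<delta>. \<exists>w\<in>I \<delta>. f = j + x * w"
    proof (cases "x dvd f")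
      case True
      then show ?thesis using step f by (auto elim!: dvdE)
    next
      case False
      define d where "d = (LEAST d. \<exists>f\<in>I \<delta>. has_degree f d)"
      obtain e where e: "has_degree f e" using has_degree_exists[OF False] by blast
      then have ex: "\<exists>e. \<exists>f\<in>I \<delta>. has_degree f e" using f by blast
      obtain f0 where f0: "f0 \<in> I \<delta>" "has_degree f0 d"
        using LeastI_ex[OF ex] unfolding d_def by blast
      have de: "d \<le> e" unfolding d_def by (rule Least_le) (use e f in blast)
      \<comment> \<open>Division by \<open>b\<close> splits \<open>d\<close> into the degree of a
        coefficient and an exponent of \<open>P\<close>, so that \<open>M\<close> has degree exactly
        \<open>d\<close>.\<close>
      define c where "c = d mod b"
      define l where "l = d div b"
      have c: "c < b" and d: "c + l * b = d" using b_pos by (simp_all add: c_def l_def)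
      obtain Q where Q: "has_degree Q c" "\<And>q. has_degree q c \<Longrightarrow> v q \<le> v Q"
        using maximal_value_of_degree[OF K c] by blast
      have Q0: "Q \<noteq> 0" using Q(1) by (rule has_degree_nonzero)
      define M where "M = Q * P ^ l"
      have M: "has_degree M d"
        unfolding M_def d[symmetric] by (intro has_degree_mult has_degree_power Q P_degree)
      have M0: "M \<noteq> 0" using M by (rule has_degree_nonzero)
      have "\<delta> \<le> v M"
      proof (rule ccontr)
        assume "\<not> \<delta> \<le> v M"
        then have M\<delta>: "v M < \<delta>" by simp
        define \<gamma> where "\<gamma> = v M"
        have \<gamma>: "\<gamma> = v Q + l \<cdot> \<beta>"
          using v_monomial[OF Q0, of 0 l] by (simp add: \<gamma>_def M_def)
        obtain u h where u: "u dvd 1" "f0 = u * M + x * h"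
          using has_degree_divide[OF f0(2) M] by auto
        have u0: "u \<noteq> 0" using u(1) by auto
        have f0gt: "f0 \<in> Igt \<gamma>" using f0(1) M\<delta> by (auto simp: I_def Igt_def \<gamma>_def)
        have uM: "- (u * M) \<noteq> 0" "v (- (u * M)) = \<gamma>"
          using u0 M0 v_mult[of "- u" M] v_unit[of "- u"] u(1) by (simp_all add: \<gamma>_def)
        have "- (u * M) + f0 \<noteq> 0 \<and> v (- (u * M) + f0) = v (- (u * M))"
          by (rule v_add_Igt) (use uM f0gt in simp_all)
        then have xh: "x * h \<noteq> 0" "v (x * h) = \<gamma>" using u(2) uM(2) by simp_all
        then have h: "h \<noteq> 0" "\<gamma> = v x + v h" using v_mult[of x h] by (auto simp: x_nonzero)
        then have "v h < \<delta>" using M\<delta> v_x_pos by (simp add: \<gamma>_def) (metis less_add_same_cancel2 less_trans)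
        then have hJ: "h \<in> ?J (v h)" using IH[OF T_I[OF h(1)]] by (auto simp: I_def)
        \<comment> \<open>The multiples of x * P^l up to larger values. The element
          \<open>x * h\<close> lies in this ideal monomial by monomial: a term of value exactly
          \<gamma> has exponent \<open>l\<close> of \<open>P\<close>.\<close>
        define Z where "Z = {z. \<exists>w s. z = P ^ l * (x * w) + s \<and> s \<in> Igt \<gamma>}"
        have Z: "ring_ideal Z"
        proof (rule ring_idealI)
          show "0 \<in> Z" unfolding Z_def
            by (intro CollectI exI[of _ 0]) (simp add: ring_ideal_zero[OF ring_ideal_Igt])
        next
          fix z z' assume "z \<in> Z" "z' \<in> Z"
          then obtain w s w' s' where "z = P ^ l * (x * w) + s" "s \<in> Igt \<gamma>"
            "z' = P ^ l * (x * w') + s'" "s' \<in> Igt \<gamma>" unfolding Z_def by blast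
          then have "z + z' = P ^ l * (x * (w + w')) + (s + s')" "s + s' \<in> Igt \<gamma>"
            by (simp_all add: algebra_simps ring_ideal_add[OF ring_ideal_Igt])
          then show "z + z' \<in> Z" unfolding Z_def by blast
        next
          fix a z assume "z \<in> Z"
          then obtain w s where "z = P ^ l * (x * w) + s" "s \<in> Igt \<gamma>" unfolding Z_def by blast
          then have "a * z = P ^ l * (x * (a * w)) + a * s" "a * s \<in> Igt \<gamma>"
            by (simp_all add: algebra_simps ring_ideal_mult[OF ring_ideal_Igt])
          then show "a * z \<in> Z" unfolding Z_def by blast
        qed
        have "?J (v h) \<subseteq> {g. x * g \<in> Z}"
        proof (rule ideal_generated_least)
          show "ring_ideal {g. x * g \<in> Z}"
            by (rule ring_idealI)
              (auto simp: distrib_left mult.left_commute[of x] ring_ideal_zero[OF Z]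
                intro: ring_ideal_add[OF Z] ring_ideal_mult[OF Z])
          show "monomials (v h) \<subseteq> {g. x * g \<in> Z}"
          proof
            fix g assume "g \<in> monomials (v h)"
            then obtain k q l' c' where g: "g = x ^ k * q * P ^ l'" "c' < b" "has_degree q c'"
                "v h \<le> v (x ^ k * q * P ^ l')" by (auto simp: monomials_def)
            have q: "q \<noteq> 0" using g(3) by (rule has_degree_nonzero)
            have g0: "g \<noteq> 0" using q by (simp add: g(1) x_nonzero P_nonzero)
            have vg: "v (x * g) = Suc k \<cdot> v x + v q + l' \<cdot> \<beta>"
              using g0 by (simp add: v_mult x_nonzero g(1) v_monomial[OF q] nat_multiple_Suc add.assoc)
            have "\<gamma> \<le> v (x * g)" using g(4) g0 h(2) by (simp add: v_mult x_nonzero flip: g(1))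
            then consider "\<gamma> < v (x * g)" | "\<gamma> = v (x * g)" by fastforce
            then have "x * g \<in> Z"
            proof cases
              case 1
              then have "x * g = P ^ l * (x * 0) + x * g" "x * g \<in> Igt \<gamma>" by (simp_all add: Igt_def)
              then show ?thesis unfolding Z_def by blast
            next
              case 2
              then have eq: "Suc k \<cdot> v x + v q + l' \<cdot> \<beta> = 0 \<cdot> v x + v Q + l \<cdot> \<beta>" using \<gamma> vg by simp
              \<comment> \<open>Different exponents of \<open>P\<close> would place a positive
                multiple of \<beta> in the group generated by \<open>X\<close>. That multiple is at
                most \<gamma>, hence smaller than \<delta>, against the bound on \<delta>.\<close>
              have le: "\<not> \<delta> \<le> (m - n) \<cdot> \<beta>" if "m \<cdot> \<beta> \<le> \<gamma>" for m n
              proof -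
                have "(m - n) \<cdot> \<beta> \<le> m \<cdot> \<beta>" using \<beta>_pos by (intro nat_multiple_mono) simp_all
                then show ?thesis using that M\<delta> by (simp add: \<gamma>_def)
              qed
              have nn: "0 \<le> v q" "0 \<le> v Q" "0 \<le> Suc k \<cdot> v x"
                using q Q0 v_nonneg v_x_pos by (auto intro: nat_multiple_nonneg)
              note mem = small_degree_mem[OF g(3,2)] small_degree_mem[OF Q(1) c]
              have "l' = l"
              proof (rule ccontr)
                assume "l' \<noteq> l"
                then consider "l' < l" | "l < l'" by linarith
                then show False
                proof cases
                  case 1
                  have "(l - l') \<cdot> \<beta> \<in> group_closure X"
                    by (rule multiple_mem_closure[OF q Q0 mem 1 eq])
                  then show ?thesis using less.prems[of "l - l'"] 1 le[of l l'] nn(2) \<gamma> by simp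
                next
                  case 2
                  have "(l' - l) \<cdot> \<beta> \<in> group_closure X"
                    by (rule multiple_mem_closure[OF Q0 q mem(2,1) 2 eq[symmetric]])
                  moreover have "l' \<cdot> \<beta> \<le> \<gamma>"
                    unfolding \<open>\<gamma> = v (x * g)\<close> vg using nn by simp
                  ultimately show ?thesis using less.prems[of "l' - l"] 2 le[of l' l] by simp
                qed
              qed
              then have "x * g = P ^ l * (x * (x ^ k * q)) + 0" by (simp add: g(1) algebra_simps)
              then show ?thesis unfolding Z_def using ring_ideal_zero[OF ring_ideal_Igt] by blast
            qed
            then show "g \<in> {g. x * g \<in> Z}" by simp
          qed
        qed
        then have "x * h \<in> Z" using hJ by blast
        then obtain w s where ws: "x * h = P ^ l * (x * w) + s" "s \<in> Igt \<gamma>" unfolding Z_def by blast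
        define Q' where "Q' = u * Q + x * w"
        have "has_degree (u * Q) (0 + c)" by (intro has_degree_mult has_degree_unit u(1) Q(1))
        then have Q': "has_degree Q' c" unfolding Q'_def by (intro has_degree_add_x) simp
        have Q'0: "Q' \<noteq> 0" using Q' by (rule has_degree_nonzero)
        have "Q' * P ^ l = f0 - s" using u(2) ws(1) by (simp add: Q'_def M_def algebra_simps)
        then have "Q' * P ^ l \<in> Igt \<gamma>" using ring_ideal_diff[OF ring_ideal_Igt f0gt ws(2)] by simp
        then have "\<gamma> < v Q' + l \<cdot> \<beta>"
          using Q'0 v_monomial[OF Q'0, of 0 l] P_nonzero by (simp add: Igt_def)
        then have "v Q < v Q'" unfolding \<gamma> by simp
        then show False using Q(2)[OF Q'] by simp
      qed
      moreover have "M = x ^ 0 * Q * P ^ l" by (simp add: M_def)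
      ultimately have "M \<in> monomials \<delta>"
        unfolding monomials_def mem_Collect_eq using Q(1) c by metis
      then have MJ: "M \<in> ?J \<delta>" by (rule ideal_generated_base)
      obtain u h where u: "f = u * y ^ (e - d) * M + x * h"
        using has_degree_divide[OF e M de] by blast
      have uM: "u * y ^ (e - d) * M \<in> ?J \<delta>" by (rule ring_ideal_mult[OF ring_ideal_generated MJ])
      moreover have "x * h = f - u * y ^ (e - d) * M" using u by simp
      ultimately have "x * h \<in> I \<delta>"
        using ring_ideal_diff[OF ring_ideal_I f] monomials_subset_I by auto
      then obtain j w where jw: "j \<in> ?J \<delta>" "w \<in> I \<delta>" "x * h = j + x * w" using step by blast
      then have "f = (u * y ^ (e - d) * M + j) + x * w" using u by (simp add: add.assoc)
      then show ?thesis using ring_ideal_add[OF ring_ideal_generated uM jw(1)] jw(2) by blast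
    qed
  qed
qed

text \<open>An element of value exactly \<delta> is not in \<open>Igt \<delta>\<close>, so some
  monomial among the generators of \<open>I \<delta>\<close> is not either. Its value is \<delta>,
  and all its factors have values in the monoid.\<close>

lemma mem_of_le_multiples:
  assumes K: "\<beta> \<le> K \<cdot> v x" and \<delta>: "\<delta> \<in> T"
    and le: "\<And>m. 0 < m \<Longrightarrow> m \<cdot> \<beta> \<in> group_closure X \<Longrightarrow> \<delta> \<le> m \<cdot> \<beta>"
  shows "\<delta> \<in> monoid_generated (insert \<beta> X)"
proof -
  obtain f where f: "f \<noteq> 0" "v f = \<delta>" using \<delta> by (rule T_E)
  then have "f \<in> ideal_generated (monomials \<delta>)"
    using value_ideal_generated_by_monomials[OF K \<delta> le] by (auto simp: I_def)
  moreover have "f \<notin> Igt \<delta>" using f by (simp add: Igt_def)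
  ultimately have "\<not> monomials \<delta> \<subseteq> Igt \<delta>"
    using ideal_generated_least[OF _ ring_ideal_Igt] by blast
  then obtain k q l c where q: "c < b" "has_degree q c" "\<delta> \<le> v (x ^ k * q * P ^ l)"
      "x ^ k * q * P ^ l \<notin> Igt \<delta>" by (auto simp: monomials_def)
  then have "\<delta> = v (x ^ k * q * P ^ l)" by (simp add: Igt_def)
  then have "\<delta> = k \<cdot> v x + v q + l \<cdot> \<beta>" using v_monomial has_degree_nonzero[OF q(2)] by simp
  moreover have "v q \<in> monoid_generated (insert \<beta> X)"
    using small_degree_mem[OF q(2,1)] monoid_generated_mono[of X "insert \<beta> X"] by auto
  ultimately show ?thesis
    by (auto intro!: monoid_generated_add monoid_generated_nat_multiple intro: monoid_generated_base x_in)
qed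

text \<open>When \<beta> exceeds all multiples of \<open>v x\<close> while every smaller value is
  bounded by one, division by \<open>x\<close> does not lead out of \<open>I \<beta>\<close>, and
  Nakayama's lemma shows that its elements are multiples of \<open>P\<close>. Every value from
  \<beta> on can then be lowered by \<beta>.\<close>

lemma mem_of_infinitely_large:
  assumes large: "\<And>k. k \<cdot> v x < \<beta>"
    and arch: "\<And>t. t \<in> T \<Longrightarrow> t < \<beta> \<Longrightarrow> \<exists>k. t \<le> k \<cdot> v x"
    and t: "t \<in> T"
  shows "t \<in> monoid_generated (insert \<beta> X)"
  using t
proof (induction t rule: T_induct)
  case (less t)
  show ?case
  proof (cases "t < \<beta>")
    case True
    then show ?thesis using below less(1) monoid_generated_mono[of X "insert \<beta> X"] by auto
  next
    case False
    have "I \<beta> \<subseteq> {f. P dvd f}"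
    proof (rule nakayama[OF ring_ideal_multiples])
      fix f assume f: "f \<in> I \<beta>"
      have xh: "h \<in> I \<beta>" if "x * h \<in> I \<beta>" for h
      proof (rule ccontr)
        assume "h \<notin> I \<beta>"
        then have h: "h \<noteq> 0" "v h < \<beta>" by (auto simp: I_def)
        then obtain k where "v h \<le> k \<cdot> v x" using arch T_I by blast
        then have "v (x * h) \<le> Suc k \<cdot> v x" using h by (simp add: v_mult x_nonzero nat_multiple_Suc)
        then show False using that large[of "Suc k"] h x_nonzero by (simp add: I_def)
      qed
      show "\<exists>j\<in>{f. P dvd f}. \<exists>w\<in>I \<beta>. f = j + x * w"
      proof (cases "x dvd f")
        case True
        then obtain h where "f = x * h" ..
        then show ?thesis using xh f by (intro bexI[of _ 0] bexI[of _ h]) simp_all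
      next
        case False
        then obtain e where e: "has_degree f e" using has_degree_exists by blast
        have "v P \<le> v f" using f has_degree_nonzero[OF e] by (simp add: I_def vP)
        then have "b \<le> e" using apery_degree_le[OF _ P_degree e] \<beta>_apery vP by simp
        then obtain u h where u: "f = u * y ^ (e - b) * P + x * h"
          using has_degree_divide[OF e P_degree] by blast
        have "P \<in> I \<beta>" by (simp add: I_def vP)
        then have "f - u * y ^ (e - b) * P \<in> I \<beta>"
          by (intro ring_ideal_diff[OF ring_ideal_I] ring_ideal_mult[OF ring_ideal_I] f)
        then have "h \<in> I \<beta>" using xh u by simp
        then show ?thesis using u by (intro bexI[of _ "u * y ^ (e - b) * P"] bexI[of _ h]) simp_all
      qed
    qed
    moreover obtain f where f: "f \<noteq> 0" "v f = t" using less(1) by (rule T_E)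
    moreover have "f \<in> I \<beta>" using f False by (simp add: I_def)
    ultimately have "P dvd f" by blast
    then obtain g where g: "f = P * g" ..
    then have g0: "g \<noteq> 0" and t: "t = \<beta> + v g" using f v_mult[of P g] by (auto simp: vP)
    have "v g < t" using t \<beta>_pos by simp
    then have "v g \<in> monoid_generated (insert \<beta> X)" using less(2) T_I g0 by blast
    then show ?thesis unfolding t by (intro monoid_generated.add_base) simp_all
  qed
qed

end

section \<open>The sequence of minimal generators\<close>

context dominating_valuation
begin

definition next_generator :: "'g set \<Rightarrow> 'g"
  where "next_generator X = (SOME t. t \<in> T - monoid_generated X \<and> (\<forall>s\<in>T - monoid_generated X. t \<le> s))"

primrec generators :: "nat \<Rightarrow> 'g set"
  where "generators 0 = {v x}"
  | "generators (Suc i) = insert (next_generator (generators i)) (generators i)"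

definition gen :: "nat \<Rightarrow> 'g"
  where "gen i = (case i of 0 \<Rightarrow> v x | Suc j \<Rightarrow> next_generator (generators j))"

lemma gen_0: "gen 0 = v x"
  by (simp add: gen_def)

lemma generators_eq: "generators i = gen ` {..i}"
  by (induction i) (simp_all add: gen_def atMost_Suc)

lemma generators_eq_less: "generators i = gen ` {..<Suc i}"
  by (simp add: generators_eq lessThan_Suc_atMost)

lemma generators_mono: "i \<le> j \<Longrightarrow> generators i \<subseteq> generators j"
  unfolding generators_eq by (intro image_mono) simp

definition incomplete :: "nat \<Rightarrow> bool"
  where "incomplete i \<longleftrightarrow> \<not> T \<subseteq> monoid_generated (generators i)"

lemma incomplete_antimono: "incomplete j \<Longrightarrow> i \<le> j \<Longrightarrow> incomplete i"
  unfolding incomplete_def using monoid_generated_mono[OF generators_mono] by blast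

lemma gen_Suc:
  assumes "incomplete i"
  shows "gen (Suc i) \<in> T" "gen (Suc i) \<notin> monoid_generated (generators i)"
    and "\<And>t. t \<in> T \<Longrightarrow> t < gen (Suc i) \<Longrightarrow> t \<in> monoid_generated (generators i)"
proof -
  have "\<exists>t. t \<in> T - monoid_generated (generators i) \<and> (\<forall>s\<in>T - monoid_generated (generators i). t \<le> s)"
    using T_has_min[of "T - monoid_generated (generators i)"] assms by (auto simp: incomplete_def)
  then have *: "gen (Suc i) \<in> T - monoid_generated (generators i) \<and>
      (\<forall>s\<in>T - monoid_generated (generators i). gen (Suc i) \<le> s)"
    unfolding gen_def next_generator_def nat.case by (rule someI_ex)
  then show "gen (Suc i) \<in> T" "gen (Suc i) \<notin> monoid_generated (generators i)" by auto
  show "t \<in> monoid_generated (generators i)" if "t \<in> T" "t < gen (Suc i)" for t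
    using * that by (meson DiffI leD)
qed

lemma v_x_mem_generators: "v x \<in> generators i"
  using generators_mono[of 0 i] by simp

text \<open>If subtracting \<open>v x\<close> left a value, minimality would put it in the monoid,
  and adding \<open>v x\<close> back would generate the missing value.\<close>

lemma gen_Suc_apery: "incomplete i \<Longrightarrow> gen (Suc i) \<in> apery"
proof -
  assume i: "incomplete i"
  have "gen (Suc i) - v x \<notin> T"
  proof
    assume "gen (Suc i) - v x \<in> T"
    then have "gen (Suc i) - v x \<in> monoid_generated (generators i)"
      using gen_Suc(3)[OF i] v_x_pos by simp
    then have "v x + (gen (Suc i) - v x) \<in> monoid_generated (generators i)"
      by (rule monoid_generated.add_base[OF v_x_mem_generators])
    then show False using gen_Suc(2)[OF i] by simp
  qed
  then show ?thesis using gen_Suc(1)[OF i] by (simp add: apery_def)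
qed

lemma gen_Suc_pos: "incomplete i \<Longrightarrow> 0 < gen (Suc i)"
  using gen_Suc(1,2)[of i] T_nonneg monoid_generated.zero by (metis order_less_le)

lemma gen_Suc_key_step:
  assumes "incomplete i"
  shows "\<exists>P b. key_step x y v (generators i) (gen (Suc i)) P b"
proof -
  obtain P where P: "P \<noteq> 0" "v P = gen (Suc i)" using gen_Suc(1)[OF assms] by (rule T_E)
  then obtain b where b: "has_degree P b"
    using apery_has_degree gen_Suc_apery[OF assms] by metis
  have "key_step x y v (generators i) (gen (Suc i)) P b"
    by (intro key_step.intro key_step_axioms.intro dominating_valuation_axioms v_x_mem_generators
        gen_Suc(3) gen_Suc_apery gen_Suc_pos assms P b)
  then show ?thesis by blast
qed

text \<open>Both claims rest on a value still missing after \<open>gen (Suc i)\<close>. If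
  \<open>gen (Suc i)\<close> exceeded all multiples of \<open>v x\<close>, it would complete the
  semigroup; if none of its positive multiples in the earlier group lay below the next generator,
  that next generator would already belong to the monoid.\<close>

lemma gen_Suc_commensurable:
  assumes arch: "\<And>s. s \<in> generators i \<Longrightarrow> \<exists>k. s \<le> k \<cdot> v x"
    and i: "incomplete (Suc i)"
  shows "\<exists>k. gen (Suc i) \<le> k \<cdot> v x"
    and "\<exists>m>0. m \<cdot> gen (Suc i) \<in> group_closure (generators i) \<and> m \<cdot> gen (Suc i) < gen (Suc (Suc i))"
proof -
  have i': "incomplete i" using incomplete_antimono[OF i] by simp
  obtain P b where "key_step x y v (generators i) (gen (Suc i)) P b"
    using gen_Suc_key_step[OF i'] by blast
  then interpret key_step x y v "generators i" "gen (Suc i)" P b .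
  have gS: "generators (Suc i) = insert (gen (Suc i)) (generators i)" by (simp add: gen_def)
  have arch_mon: "\<exists>k. t \<le> k \<cdot> v x" if "t \<in> monoid_generated (generators i)" for t
    using that
  proof induction
    case zero
    show ?case by (intro exI[of _ 0]) simp
  next
    case (add_base s t)
    then obtain k l where "s \<le> k \<cdot> v x" "t \<le> l \<cdot> v x" using arch by blast
    then have "s + t \<le> (k + l) \<cdot> v x" unfolding nat_multiple_add by (rule add_mono)
    then show ?case by blast
  qed
  show *: "\<exists>k. gen (Suc i) \<le> k \<cdot> v x"
  proof (rule ccontr)
    assume "\<nexists>k. gen (Suc i) \<le> k \<cdot> v x"
    then have "T \<subseteq> monoid_generated (generators (Suc i))"
      unfolding gS using mem_of_infinitely_large arch_mon below by (meson not_le subsetI)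
    then show False using i by (simp add: incomplete_def)
  qed
  show "\<exists>m>0. m \<cdot> gen (Suc i) \<in> group_closure (generators i) \<and> m \<cdot> gen (Suc i) < gen (Suc (Suc i))"
  proof (rule ccontr)
    assume none: "\<not> ?thesis"
    obtain K where K: "gen (Suc i) \<le> K \<cdot> v x" using * by blast
    have "gen (Suc (Suc i)) \<in> monoid_generated (generators (Suc i))"
      unfolding gS by (rule mem_of_le_multiples[OF K gen_Suc(1)[OF i]]) (use none not_le in blast)
    then show False using gen_Suc(2)[OF i] by simp
  qed
qed

lemma generators_arch:
  "incomplete i \<Longrightarrow> s \<in> generators i \<Longrightarrow> \<exists>k. s \<le> k \<cdot> v x"
proof (induction i arbitrary: s)
  case 0
  then show ?case by (intro exI[of _ "Suc 0"]) simp
next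
  case (Suc i)
  have "incomplete i" using incomplete_antimono[OF Suc.prems(1)] by simp
  then have arch: "\<And>s. s \<in> generators i \<Longrightarrow> \<exists>k. s \<le> k \<cdot> v x" by (rule Suc.IH)
  show ?case
    using gen_Suc_commensurable(1)[OF arch Suc.prems(1)] arch Suc.prems(2) by (auto simp: gen_def)
qed

lemma nbar_gen:
  assumes "1 \<le> i" "incomplete i"
  shows "nbar gen i < \<infinity> \<and> the_enat (nbar gen i) \<cdot> gen i < gen (Suc i)"
proof -
  obtain j where j: "i = Suc j" using assms(1) by (cases i) auto
  have "incomplete j" using incomplete_antimono[OF assms(2)] j by simp
  then obtain m where m: "0 < m" "m \<cdot> gen i \<in> group_closure (generators j)" "m \<cdot> gen i < gen (Suc i)"
    using gen_Suc_commensurable(2)[OF generators_arch[OF \<open>incomplete j\<close>] assms(2)[unfolded j]]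
    unfolding j by auto
  have pos: "0 < gen i" using gen_Suc_pos[OF \<open>incomplete j\<close>] by (simp add: j)
  have gj: "gen ` {..<i} = generators j" unfolding j generators_eq_less ..
  obtain n where n: "nbar gen i = enat n"
    "\<And>m. 0 < m \<Longrightarrow> m < n \<Longrightarrow> m \<cdot> gen i \<notin> group_closure (generators j)"
  proof (rule subgroup_index_insert_cases[of "gen i" "generators j"])
    assume "\<And>m. 0 < m \<Longrightarrow> m \<cdot> gen i \<notin> group_closure (generators j)"
    then show ?thesis using m by blast
  qed (rule that, simp_all add: nbar_insert gj)
  then have "n \<le> m" using m by (meson not_le)
  then have "n \<cdot> gen i \<le> m \<cdot> gen i" using pos by (intro nat_multiple_mono) simp_all
  then show ?thesis using m(3) unfolding n(1) by simp
qed

text \<open>A missed Apery value would exceed the infinitely many distinct Apery values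
  \<open>gen (Suc i)\<close>, while only finitely many Apery values lie below it.\<close>

lemma union_generators:
  assumes "\<And>i. incomplete i"
  shows "T = monoid_generated (range gen)"
proof
  have "range gen \<subseteq> T"
    using gen_Suc(1)[OF assms] T_I[OF x_nonzero] by (auto simp: gen_def split: nat.splits)
  then show "monoid_generated (range gen) \<subseteq> T"
    by (intro monoid_generated_least T_zero T_add)
next
  have sub: "monoid_generated (generators i) \<subseteq> monoid_generated (range gen)" for i
    unfolding generators_eq by (intro monoid_generated_mono) auto
  show "T \<subseteq> monoid_generated (range gen)"
  proof
    fix t assume "t \<in> T"
    then obtain a k where ak: "a \<in> apery" "t = a + k \<cdot> v x" using T_apery_decomp by blast
    have "a \<in> monoid_generated (range gen)"
    proof (rule ccontr)
      assume "a \<notin> monoid_generated (range gen)"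
      then have "gen (Suc i) < a" for i
        using gen_Suc(3)[OF assms, of a i] sub[of i] gen_Suc(1)[OF assms, of i] apery_T[OF ak(1)]
          monoid_generated_base[of "gen (Suc i)" "range gen"]
        by (metis linorder_less_linear rangeI subsetD)
      then have "(\<lambda>i. gen (Suc i)) ` UNIV \<subseteq> {s \<in> apery. s < a}"
        using gen_Suc_apery[OF assms] by auto
      then have "finite (range (\<lambda>i. gen (Suc i)))"
        using finite_apery_below[OF ak(1)] finite_subset by blast
      moreover have "inj (\<lambda>i. gen (Suc i))"
      proof (rule linorder_injI)
        fix i j :: nat assume "i < j"
        then have "gen (Suc i) \<in> generators j" unfolding generators_eq by auto
        then show "gen (Suc i) \<noteq> gen (Suc j)"
          using gen_Suc(2)[OF assms, of j] monoid_generated_base by metis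
      qed
      ultimately show False using finite_imageD by blast
    qed
    moreover have "gen 0 \<in> monoid_generated (range gen)" by (rule monoid_generated_base) simp
    then have "v x \<in> monoid_generated (range gen)" unfolding gen_0 .
    ultimately show "t \<in> monoid_generated (range gen)"
      unfolding ak(2) by (intro monoid_generated_add monoid_generated_nat_multiple)
  qed
qed

theorem value_monoid_structure:
  "\<exists>(\<Lambda> :: enat) (\<beta> :: nat \<Rightarrow> 'g).
    1 \<le> \<Lambda> \<and> (\<forall>i. enat i \<le> \<Lambda> \<longrightarrow> \<beta> i \<in> T \<and> 0 < \<beta> i) \<and>
    T = monoid_generated (\<beta> ` {i. enat i \<le> \<Lambda>}) \<and>
    (\<forall>i\<ge>1. enat i < \<Lambda> \<longrightarrow> nbar \<beta> i < \<infinity> \<and> the_enat (nbar \<beta> i) \<cdot> \<beta> i < \<beta> (Suc i))"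
proof -
  have gen0: "gen 0 \<in> T \<and> 0 < gen 0" using v_x_pos T_I[OF x_nonzero] by (simp add: gen_def)
  show ?thesis
  proof (cases "\<forall>i. incomplete i")
    case True
    have "gen i \<in> T \<and> 0 < gen i" for i
      using gen0 gen_Suc(1) gen_Suc_pos True by (cases i) auto
    then show ?thesis
      using union_generators nbar_gen True by (intro exI[of _ \<infinity>] exI[of _ gen]) simp
  next
    case False
    define n where "n = (LEAST n. \<not> incomplete n)"
    have n: "\<not> incomplete n" unfolding n_def using False by (metis LeastI)
    have less: "incomplete i" if "i < n" for i
      using that not_less_Least unfolding n_def by blast
    have gens: "gen i \<in> T \<and> 0 < gen i" if "i \<le> n" for i
      using gen0 gen_Suc(1)[OF less] gen_Suc_pos[OF less] that by (cases i) auto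
    have T: "T = monoid_generated (gen ` {..n})"
    proof
      show "T \<subseteq> monoid_generated (gen ` {..n})" using n by (simp add: incomplete_def generators_eq)
      show "monoid_generated (gen ` {..n}) \<subseteq> T"
        using gens by (intro monoid_generated_least T_zero T_add) auto
    qed
    show ?thesis
    proof (cases "n = 0")
      case True
      \<comment> \<open>A single generator is listed twice, as \<Lambda> must be at least 1; for
        \<Lambda> = 1 the gap conditions are vacuous.\<close>
      have "(\<lambda>_. v x) ` {i. enat i \<le> 1} = {v x}" by (auto simp: one_enat_def)
      then show ?thesis
        using T True gen0
        by (intro exI[of _ 1] exI[of _ "\<lambda>_. v x"]) (auto simp: gen_def one_enat_def)
    next
      case False
      then show ?thesis
        using T gens nbar_gen less
        by (intro exI[of _ "enat n"] exI[of _ gen]) (auto simp: one_enat_def atMost_def)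
    qed
  qed
qed

end

theorem value_semigroup_structure:
  fixes \<mm> :: "'a::idom set" and S :: "'g::linordered_ab_group_add set"
  assumes R: "regular_local_ring \<mm> 2" and S: "S \<subseteq> {0<..}"
    and \<nu>: "valuation \<nu>" "dominates \<nu> \<mm>" "value_semigroup \<nu> = S \<union> {0}"
  shows "\<exists>(\<Lambda> :: enat) (\<beta> :: nat \<Rightarrow> 'g).
    1 \<le> \<Lambda> \<and> (\<forall>i. enat i \<le> \<Lambda> \<longrightarrow> \<beta> i \<in> S) \<and>
    S = semigroup_generated (\<beta> ` {i. enat i \<le> \<Lambda>}) \<and>
    (\<forall>i\<ge>1. enat i < \<Lambda> \<longrightarrow>
      nbar \<beta> i < \<infinity> \<and> the_enat (nbar \<beta> i) \<cdot> \<beta> i < \<beta> (Suc i))"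
proof -
  define v where "v f = \<nu> (to_fract f)" for f
  obtain x y :: 'a where xy: "regular_parameters x y" and m: "\<mm> = {f. \<not> f dvd 1}"
    using regular_local_ring_parameters[OF R] by blast
  have nonneg: "0 \<le> v f" if "f \<noteq> 0" for f
    using \<nu>(2) that unfolding dominates_def valuation_ring_def v_def
    by (auto simp: image_subset_iff)
  have pos: "0 < v f \<longleftrightarrow> \<not> f dvd 1" if "f \<noteq> 0" for f
  proof -
    have "0 < v f \<longleftrightarrow> to_fract f \<in> valuation_ideal \<nu> \<inter> range to_fract"
      using that by (simp add: valuation_ideal_def v_def)
    also have "\<dots> \<longleftrightarrow> to_fract f \<in> to_fract ` \<mm>" using \<nu>(2) by (simp add: dominates_def)
    also have "\<dots> \<longleftrightarrow> f \<in> \<mm>" by (auto simp: image_iff)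
    finally show ?thesis by (simp add: m)
  qed
  interpret regular_parameters x y by (rule xy)
  interpret dominating_valuation x y v
  proof unfold_locales
    show "v (f * g) = v f + v g" if "f \<noteq> 0" "g \<noteq> 0" for f g
      using \<nu>(1) that by (simp add: v_def valuation_def)
    show "min (v f) (v g) \<le> v (f + g)" if "f \<noteq> 0" "g \<noteq> 0" "f + g \<noteq> 0" for f g
      using \<nu>(1) that unfolding valuation_def v_def to_fract_add
      by (metis to_fract_add to_fract_eq_0_iff)
  qed (use nonneg pos in auto)
  have T: "T = S \<union> {0}"
    using \<nu>(3) unfolding T_def value_semigroup_def v_def by auto
  obtain \<Lambda> :: enat and \<beta> :: "nat \<Rightarrow> 'g" where \<Lambda>: "1 \<le> \<Lambda>"
    and \<beta>: "\<And>i. enat i \<le> \<Lambda> \<Longrightarrow> \<beta> i \<in> T \<and> 0 < \<beta> i"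
    and gen: "T = monoid_generated (\<beta> ` {i. enat i \<le> \<Lambda>})"
    and nb: "\<forall>i\<ge>1. enat i < \<Lambda> \<longrightarrow> nbar \<beta> i < \<infinity> \<and> the_enat (nbar \<beta> i) \<cdot> \<beta> i < \<beta> (Suc i)"
    using value_monoid_structure by blast
  have \<beta>S: "\<beta> i \<in> S" if "enat i \<le> \<Lambda>" for i using \<beta>[OF that] T by auto
  then have "\<beta> ` {i. enat i \<le> \<Lambda>} \<subseteq> {0<..}" using S by auto
  then have "S = semigroup_generated (\<beta> ` {i. enat i \<le> \<Lambda>})"
    using semigroup_generated_eq_iff[OF S] T gen by metis
  then show ?thesis using \<Lambda> \<beta>S nb by blast
qed

section \<open>Valuations from key elements\<close>

text \<open>Multisets of indices serve as exponent vectors, \<open>count M i\<close> being the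
  exponent at index \<open>i\<close>. The same sum measures values, degrees and the termination of a
  reduction.\<close>

definition weight :: "(nat \<Rightarrow> 'g::comm_monoid_add) \<Rightarrow> nat multiset \<Rightarrow> 'g"
  where "weight \<beta> M = (\<Sum>i\<in>#M. \<beta> i)"

lemma weight_simps [simp]:
  "weight \<beta> {#} = 0"
  "weight \<beta> (add_mset i M) = \<beta> i + weight \<beta> M"
  "weight \<beta> (M + N) = weight \<beta> M + weight \<beta> N"
  by (simp_all add: weight_def)

lemma weight_replicate [simp]: "weight \<beta> (replicate_mset k i) = k \<cdot> \<beta> i"
  by (induction k) (simp_all add: nat_multiple_Suc)

lemma weight_nonneg:
  "(\<And>i. i \<in># M \<Longrightarrow> 0 \<le> \<beta> i) \<Longrightarrow> 0 \<le> weight (\<beta> :: nat \<Rightarrow> 'g::linordered_ab_group_add) M"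
  by (induction M) simp_all

lemma monoid_generated_eq_weights:
  "monoid_generated (\<beta> ` A) = {weight \<beta> M | M. set_mset M \<subseteq> A}"
proof
  show "monoid_generated (\<beta> ` A) \<subseteq> {weight \<beta> M | M. set_mset M \<subseteq> A}"
  proof (rule monoid_generated_least)
    show "0 \<in> {weight \<beta> M | M. set_mset M \<subseteq> A}" by (auto intro!: exI[of _ "{#}"])
    show "\<beta> ` A \<subseteq> {weight \<beta> M | M. set_mset M \<subseteq> A}"
    proof
      fix g assume "g \<in> \<beta> ` A"
      then obtain i where "i \<in> A" "g = weight \<beta> {#i#}" by auto
      then show "g \<in> {weight \<beta> M | M. set_mset M \<subseteq> A}" by (intro CollectI exI[of _ "{#i#}"]) simp
    qed
    fix g h assume "g \<in> {weight \<beta> M | M. set_mset M \<subseteq> A}" "h \<in> {weight \<beta> M | M. set_mset M \<subseteq> A}"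
    then obtain M N where "set_mset M \<subseteq> A" "set_mset N \<subseteq> A" "g = weight \<beta> M" "h = weight \<beta> N" by blast
    then show "g + h \<in> {weight \<beta> M | M. set_mset M \<subseteq> A}"
      by (intro CollectI exI[of _ "M + N"]) simp
  qed
  have "weight \<beta> M \<in> monoid_generated (\<beta> ` A)" if "set_mset M \<subseteq> A" for M
    using that by (induction M) (auto intro: monoid_generated.intros)
  then show "{weight \<beta> M | M. set_mset M \<subseteq> A} \<subseteq> monoid_generated (\<beta> ` A)" by blast
qed

lemma nat_multiple_nat: "k \<cdot> (j::nat) = k * j"
  by (induction k) (simp_all add: nat_multiple_Suc)

lemma mset_split: "M = filter_mset (\<lambda>j. j < i) M + replicate_mset (count M i) i + filter_mset (\<lambda>j. i < j) M"
  for i :: nat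
  by (rule multiset_eqI) auto

text \<open>The multiset is a numeral in mixed radix, with digits \<open>count M j\<close> below
  \<open>n j\<close> and place values \<open>f j\<close>, so it stays below the next place value.
  The general target type covers weights and degrees alike.\<close>

lemma weight_less_of_gaps:
  fixes f :: "nat \<Rightarrow> 'b::{linorder, ordered_cancel_comm_monoid_add}"
  assumes "1 \<le> i" "0 < f 1" "\<And>j. 1 \<le> j \<Longrightarrow> j < i \<Longrightarrow> 0 \<le> f j" "\<And>j. 1 \<le> j \<Longrightarrow> j < i \<Longrightarrow> n j \<cdot> f j \<le> f (Suc j)"
    and "set_mset M \<subseteq> {1..<i}" "\<And>j. 1 \<le> j \<Longrightarrow> j < i \<Longrightarrow> count M j < n j"
  shows "weight f M < f i"
  using assms
proof (induction i arbitrary: M rule: dec_induct)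
  case base
  then have "M = {#}" by simp
  then show ?case using base by simp
next
  case (step i)
  define M' where "M' = filter_mset (\<lambda>j. j < i) M"
  define c where "c = count M i"
  have "filter_mset (\<lambda>j. i < j) M = filter_mset (\<lambda>_. False) M"
    using step.prems(4) by (intro filter_mset_cong) auto
  then have last: "filter_mset (\<lambda>j. i < j) M = {#}" by (simp only: filter_mset_False)
  have M: "M = M' + replicate_mset c i"
    using mset_split[of M i] unfolding last M'_def c_def by (simp only: add_0_right)
  have "weight f M' < f i"
    using step.prems by (intro step.IH) (auto simp: M'_def)
  then have "weight f M < Suc c \<cdot> f i"
    unfolding M nat_multiple_Suc by (simp add: add_strict_right_mono)
  also have "\<dots> \<le> n i \<cdot> f i"
    using step.prems(2,5)[of i] step.hyps(1) by (intro nat_multiple_mono) (simp_all add: c_def Suc_le_eq)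
  also have "\<dots> \<le> f (Suc i)" using step.prems(3) step.hyps(1) by simp
  finally show ?case .
qed

lemma mset_split_replicate:
  assumes "k \<le> count M i" obtains M' where "M = M' + replicate_mset k i"
proof -
  have "replicate_mset k i \<subseteq># M" using assms by (simp flip: count_le_replicate_mset_subset_eq)
  then show ?thesis using that[of "M - replicate_mset k i"] by simp
qed

lemma mset_last_difference:
  fixes M N :: "nat multiset"
  assumes "M \<noteq> N"
  obtains i where "count M i \<noteq> count N i" "\<And>j. i < j \<Longrightarrow> count M j = count N j"
proof -
  let ?D = "{i. count M i \<noteq> count N i}"
  have "?D \<subseteq> set_mset M \<union> set_mset N" by (auto simp: not_in_iff)
  then have fin: "finite ?D" by (rule finite_subset) simp
  moreover have "?D \<noteq> {}" using assms by (auto simp: multiset_eq_iff)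
  ultimately have "Max ?D \<in> ?D" by (rule Max_in)
  moreover have "count M j = count N j" if "Max ?D < j" for j
    using that Max_ge[OF fin, of j] by auto
  ultimately show ?thesis using that[of "Max ?D"] by blast
qed

lemma filter_mset_eq_of_count:
  "(\<And>j. i < j \<Longrightarrow> count M j = count N j) \<Longrightarrow> filter_mset (\<lambda>j. i < j) M = filter_mset (\<lambda>j. i < (j::nat)) N"
  by (rule multiset_eqI) simp

lemma dvd_diff_mult:
  fixes z :: "'a::comm_ring_1"
  assumes "z dvd a - b" "z dvd c - d" shows "z dvd a * c - b * d"
proof -
  have "a * c - b * d = (a - b) * c + b * (c - d)" by (simp add: algebra_simps)
  then show ?thesis using assms by simp
qed

lemma dvd_diff_power:
  fixes z :: "'a::comm_ring_1"
  shows "z dvd a - b \<Longrightarrow> z dvd a ^ n - b ^ n"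
  by (induction n) (simp_all add: dvd_diff_mult)

definition monomial :: "(nat \<Rightarrow> 'a::comm_monoid_mult) \<Rightarrow> nat multiset \<Rightarrow> 'a"
  where "monomial P M = (\<Prod>i\<in>#M. P i)"

lemma monomial_simps [simp]:
  "monomial P {#} = 1"
  "monomial P (add_mset i M) = P i * monomial P M"
  "monomial P (M + N) = monomial P M * monomial P N"
  by (simp_all add: monomial_def)

lemma monomial_replicate [simp]: "monomial P (replicate_mset k i) = P i ^ k"
  by (induction k) simp_all

lemma ring_ideal_linear_combinations:
  assumes "ring_ideal J" shows "ring_ideal {a * q + x * z | a z. z \<in> J}"
proof (rule ring_idealI)
  show "0 \<in> {a * q + x * z | a z. z \<in> J}"
    using ring_ideal_zero[OF assms] by (intro CollectI exI[of _ 0]) simp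
next
  fix f g assume "f \<in> {a * q + x * z | a z. z \<in> J}" "g \<in> {a * q + x * z | a z. z \<in> J}"
  then obtain a z b w where "z \<in> J" "w \<in> J" "f = a * q + x * z" "g = b * q + x * w" by blast
  then have "f + g = (a + b) * q + x * (z + w)" "z + w \<in> J"
    by (simp_all add: algebra_simps ring_ideal_add[OF assms])
  then show "f + g \<in> {a * q + x * z | a z. z \<in> J}" by blast
next
  fix c f assume "f \<in> {a * q + x * z | a z. z \<in> J}"
  then obtain a z where "z \<in> J" "f = a * q + x * z" by blast
  then have "c * f = (c * a) * q + x * (c * z)" "c * z \<in> J"
    by (simp_all add: algebra_simps ring_ideal_mult[OF assms])
  then show "c * f \<in> {a * q + x * z | a z. z \<in> J}" by blast
qed

text \<open>The degrees of the key elements modulo \<open>x\<close>, with the convention that \<open>x\<close> has degree \<open>0\<close>.\<close>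

definition key_degree :: "(nat \<Rightarrow> nat) \<Rightarrow> nat \<Rightarrow> nat"
  where "key_degree n i = (if i = 0 then 0 else \<Prod>j\<in>{1..<i}. n j)"

lemma key_degree_simps [simp]:
  "key_degree n 0 = 0"
  "key_degree n (Suc 0) = 1"
  by (simp_all add: key_degree_def)

lemma key_degree_Suc: "1 \<le> i \<Longrightarrow> key_degree n (Suc i) = n i * key_degree n i"
  by (simp add: key_degree_def prod.atLeastLessThan_Suc)

lemma enat_le_downward: "enat j \<le> \<Lambda> \<Longrightarrow> i \<le> j \<Longrightarrow> enat i \<le> \<Lambda>"
  by (meson enat_ord_simps(1) order_trans)

lemma enat_less_downward: "enat j \<le> \<Lambda> \<Longrightarrow> i < j \<Longrightarrow> enat i < \<Lambda>"
  by (meson enat_ord_simps(2) less_le_trans)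

text \<open>Below \<Lambda>, \<open>independent\<close> concerns only multiples smaller than
  \<open>n i\<close>, but at a finite last index it demands that no positive multiple of the
  generator is a difference of earlier weights. By \<open>degrees_unbounded\<close> only finitely
  many key elements have degree at most \<open>c\<close>, so that rewriting which preserves the
  degree stops.\<close>

locale key_sequence = regular_parameters x y for x y :: "'a::idom" +
  fixes \<beta> :: "nat \<Rightarrow> 'g::linordered_ab_group_add" and \<Lambda> :: enat
    and n :: "nat \<Rightarrow> nat" and R :: "nat \<Rightarrow> nat multiset" and P :: "nat \<Rightarrow> 'a"
  assumes \<Lambda>: "1 \<le> \<Lambda>"
    and pos: "enat i \<le> \<Lambda> \<Longrightarrow> 0 < \<beta> i"
    and P_0: "P 0 = x" and P_1: "P (Suc 0) = y"
    and P_Suc: "1 \<le> i \<Longrightarrow> enat i < \<Lambda> \<Longrightarrow> P (Suc i) = P i ^ n i - monomial P (R i)"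
    and R_subset: "1 \<le> i \<Longrightarrow> enat i < \<Lambda> \<Longrightarrow> set_mset (R i) \<subseteq> {..<i}"
    and R_0: "1 \<le> i \<Longrightarrow> enat i < \<Lambda> \<Longrightarrow> 0 \<in># R i"
    and R_weight: "1 \<le> i \<Longrightarrow> enat i < \<Lambda> \<Longrightarrow> weight \<beta> (R i) = n i \<cdot> \<beta> i"
    and n_pos: "1 \<le> i \<Longrightarrow> enat i < \<Lambda> \<Longrightarrow> 0 < n i"
    and gap: "1 \<le> i \<Longrightarrow> enat i < \<Lambda> \<Longrightarrow> n i \<cdot> \<beta> i < \<beta> (Suc i)"
    and independent: "1 \<le> i \<Longrightarrow> enat i \<le> \<Lambda> \<Longrightarrow> 0 < m \<Longrightarrow> (enat i < \<Lambda> \<longrightarrow> m < n i) \<Longrightarrow>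
      set_mset M \<subseteq> {..<i} \<Longrightarrow> set_mset N \<subseteq> {..<i} \<Longrightarrow> weight \<beta> M + m \<cdot> \<beta> i \<noteq> weight \<beta> N"
    and degrees_unbounded: "\<exists>B. \<forall>i. enat i \<le> \<Lambda> \<longrightarrow> key_degree n i \<le> c \<longrightarrow> i \<le> B"
begin

abbreviation wt :: "nat multiset \<Rightarrow> 'g" where "wt \<equiv> weight \<beta>"
abbreviation mon :: "nat multiset \<Rightarrow> 'a" where "mon \<equiv> monomial P"
abbreviation d :: "nat \<Rightarrow> nat" where "d \<equiv> key_degree n"
abbreviation dg :: "nat multiset \<Rightarrow> nat" where "dg \<equiv> weight d"

section \<open>Standard monomials, compared by weight and by degree\<close>

definition idx :: "nat multiset \<Rightarrow> bool"
  where "idx M \<longleftrightarrow> (\<forall>i\<in>#M. enat i \<le> \<Lambda>)"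

text \<open>The exponent of \<open>x\<close> and that of a finite last key element are unrestricted:
  there is no rule to rewrite their powers.\<close>

definition standard :: "nat multiset \<Rightarrow> bool"
  where "standard M \<longleftrightarrow> idx M \<and> (\<forall>i\<ge>1. enat i < \<Lambda> \<longrightarrow> count M i < n i)"

definition standard0 :: "nat multiset \<Rightarrow> bool"
  where "standard0 M \<longleftrightarrow> standard M \<and> 0 \<notin># M"

lemma idx_simps [simp]:
  "idx {#}"
  "idx (add_mset i M) \<longleftrightarrow> enat i \<le> \<Lambda> \<and> idx M"
  "idx (M + N) \<longleftrightarrow> idx M \<and> idx N"
  by (auto simp: idx_def)

lemma idx_0 [simp]: "enat 0 \<le> \<Lambda>"
  by (simp add: zero_enat_def[symmetric])

lemma idx_1 [simp]: "enat (Suc 0) \<le> \<Lambda>"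
  using \<Lambda> by (simp add: one_enat_def)

lemma idx_replicate_0 [simp]: "idx (replicate_mset k 0)"
  by (auto simp: idx_def)

lemma idx_Suc: "enat i < \<Lambda> \<Longrightarrow> enat (Suc i) \<le> \<Lambda>"
  by (metis ileI1 eSuc_enat)

lemma idx_R: "1 \<le> i \<Longrightarrow> enat i < \<Lambda> \<Longrightarrow> idx (R i)"
  unfolding idx_def using R_subset[of i] enat_le_downward[of i] by (meson lessThan_iff less_imp_le subsetD)

lemma wt_nonneg: "idx M \<Longrightarrow> 0 \<le> wt M"
  by (rule weight_nonneg) (auto simp: idx_def intro: less_imp_le pos)

lemma standard_less:
  assumes "1 \<le> i" "enat i \<le> \<Lambda>" "standard0 M" "set_mset M \<subseteq> {..<i}"
  shows "wt M < \<beta> i \<and> dg M < d i"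
proof -
  have j: "enat j < \<Lambda>" "enat j \<le> \<Lambda>" if "j < i" for j
    using that enat_less_downward[OF assms(2)] enat_le_downward[OF assms(2)] by auto
  have M: "set_mset M \<subseteq> {1..<i}"
  proof
    fix j assume "j \<in># M"
    moreover from this have "j \<noteq> 0" using assms(3) by (metis standard0_def)
    ultimately show "j \<in> {1..<i}" using assms(4) by auto
  qed
  have count: "count M j < n j" if "1 \<le> j" "j < i" for j
    using assms(3) that j by (simp add: standard0_def standard_def)
  have "wt M < \<beta> i"
    using assms(1) pos[OF idx_1] less_imp_le[OF pos] less_imp_le[OF gap] j M count
    by (intro weight_less_of_gaps[of i \<beta> n]) simp_all
  moreover have "dg M < d i"
    using assms(1) M count
    by (intro weight_less_of_gaps[of i d n]) (simp_all add: nat_multiple_nat key_degree_Suc)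
  ultimately show ?thesis ..
qed

text \<open>The factors of \<open>M\<close> with index below \<open>i\<close> contribute less than
  one unit of \<open>\<beta> i\<close> to the weight and of \<open>d i\<close> to the degree, so one
  step in the exponent at \<open>i\<close> outweighs them.\<close>

lemma standard_less_of_count:
  assumes M: "standard0 M" and N: "idx N" "0 \<notin># N" and i: "count M i < count N i"
    and eq: "\<And>j. i < j \<Longrightarrow> count M j = count N j"
  shows "wt M < wt N \<and> dg M < dg N"
proof -
  define L where "L = filter_mset (\<lambda>j. j < i) M"
  define L' where "L' = filter_mset (\<lambda>j. j < i) N"
  define V where "V = filter_mset (\<lambda>j. i < j) N"
  have "filter_mset (\<lambda>j. i < j) M = V" unfolding V_def by (rule filter_mset_eq_of_count[OF eq])
  then have MM: "M = L + replicate_mset (count M i) i + V" using mset_split[of M i] by (simp add: L_def)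
  have NN: "N = L' + replicate_mset (count N i) i + V"
    unfolding L'_def V_def by (rule mset_split)
  have iN: "i \<in># N" using i by (metis count_greater_zero_iff gr_implies_not0 not_gr_zero)
  then have i1: "1 \<le> i" using N(2) by (metis One_nat_def Suc_leI neq0_conv)
  have i2: "enat i \<le> \<Lambda>" using iN N by (auto simp: idx_def)
  have "standard0 L" "set_mset L \<subseteq> {..<i}" using M by (auto simp: standard0_def standard_def L_def idx_def)
  then have less: "wt L < \<beta> i" "dg L < d i" using standard_less[OF i1 i2] by auto
  have L': "0 \<le> wt L'" using N by (intro wt_nonneg) (auto simp: idx_def L'_def)
  have "wt M < Suc (count M i) \<cdot> \<beta> i + wt V" using less unfolding nat_multiple_Suc by (subst MM) simp
  also have "\<dots> \<le> count N i \<cdot> \<beta> i + wt V"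
    using i pos[OF i2] by (intro add_right_mono nat_multiple_mono) auto
  also have "\<dots> \<le> wt N" using L' by (subst (2) NN) simp
  finally have *: "wt M < wt N" .
  have "dg M < Suc (count M i) * d i + dg V" using less by (subst MM) (simp add: nat_multiple_nat)
  also have "\<dots> \<le> count N i * d i + dg V"
    using i by (intro add_right_mono mult_right_mono) auto
  also have "\<dots> \<le> dg N" by (subst (2) NN) (simp add: nat_multiple_nat)
  finally show ?thesis using * by simp
qed

text \<open>Weight and degree are both decided at the greatest index where the exponents differ. In
  particular a degree determines at most one such monomial; this is the counterpart of the monotone
  degrees of Apery values.\<close>

lemma standard0_linear:
  assumes M: "standard0 M" and N: "standard0 N" and "M \<noteq> N"
  shows "wt M < wt N \<and> dg M < dg N \<or> wt N < wt M \<and> dg N < dg M"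
proof -
  obtain i where i: "count M i \<noteq> count N i" "\<And>j. i < j \<Longrightarrow> count M j = count N j"
    using mset_last_difference[OF assms(3)] by blast
  have MN: "idx M" "0 \<notin># M" "idx N" "0 \<notin># N" using M N by (auto simp: standard0_def standard_def)
  from i(1) consider "count M i < count N i" | "count N i < count M i" by linarith
  then show ?thesis
  proof cases
    case 1
    then show ?thesis using standard_less_of_count[OF M MN(3,4) 1 i(2)] by blast
  next
    case 2
    then show ?thesis using standard_less_of_count[OF N MN(1,2) 2 i(2)[symmetric]] by blast
  qed
qed

text \<open>Cancelling the common part above \<open>i\<close> would exhibit a positive multiple of
  \<open>\<beta> i\<close> as a difference of earlier weights, which \<open>independent\<close>
  excludes; for i = 0 positivity does.\<close>

lemma standard_weight_neq:
  assumes M: "standard M" and N: "standard N" and i: "count M i < count N i"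
    and eq: "\<And>j. i < j \<Longrightarrow> count M j = count N j"
  shows "wt M \<noteq> wt N"
proof
  assume wt: "wt M = wt N"
  define L where "L = filter_mset (\<lambda>j. j < i) M"
  define L' where "L' = filter_mset (\<lambda>j. j < i) N"
  define V where "V = filter_mset (\<lambda>j. i < j) N"
  have "filter_mset (\<lambda>j. i < j) M = V" unfolding V_def by (rule filter_mset_eq_of_count[OF eq])
  then have MM: "M = L + replicate_mset (count M i) i + V" using mset_split[of M i] by (simp add: L_def)
  have NN: "N = L' + replicate_mset (count N i) i + V"
    unfolding L'_def V_def by (rule mset_split)
  have "wt L' + count N i \<cdot> \<beta> i = wt L + count M i \<cdot> \<beta> i"
    using arg_cong[OF MM, of wt] arg_cong[OF NN, of wt] wt by simp
  then have eq: "wt L' + (count N i - count M i) \<cdot> \<beta> i = wt L"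
    using i by (simp add: nat_multiple_diff algebra_simps)
  have "i \<in># N" using i by (metis count_greater_zero_iff gr_implies_not0 not_gr_zero)
  then have i2: "enat i \<le> \<Lambda>" using N by (auto simp: idx_def standard_def)
  show False
  proof (cases "i = 0")
    case True
    then have "L = {#}" "L' = {#}" by (auto simp: L_def L'_def)
    then show False using eq nat_multiple_pos[OF pos[OF i2], of "count N i - count M i"] i by simp
  next
    case False
    have "enat i < \<Lambda> \<longrightarrow> count N i - count M i < n i"
      using N False by (auto simp: standard_def less_imp_diff_less)
    then show False
      using independent[OF _ i2 _ _ _ _, of "count N i - count M i" L' L] False i eq
      by (auto simp: L_def L'_def)
  qed
qed

lemma standard_weight_inj:
  assumes M: "standard M" and N: "standard N" and wt: "wt M = wt N"
  shows "M = N"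
proof (rule ccontr)
  assume "M \<noteq> N"
  then obtain i where i: "count M i \<noteq> count N i" "\<And>j. i < j \<Longrightarrow> count M j = count N j"
    using mset_last_difference by blast
  from i(1) consider "count M i < count N i" | "count N i < count M i" by linarith
  then show False
  proof cases
    case 1
    then show ?thesis using standard_weight_neq[OF M N 1 i(2)] wt by blast
  next
    case 2
    then show ?thesis using standard_weight_neq[OF N M 2 i(2)[symmetric]] wt by simp
  qed
qed

lemma monomial_0_mem: "0 \<in># M \<Longrightarrow> mon M = x * mon (M - {#0#})"
  using monomial_simps(2)[of P 0 "M - {#0#}"] by (simp add: P_0)

lemma weight_0_mem: "0 \<in># M \<Longrightarrow> wt (M - {#0#}) = wt M - \<beta> 0"
  using weight_simps(2)[of \<beta> 0 "M - {#0#}"] by (simp add: algebra_simps)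

lemma idx_diff: "idx M \<Longrightarrow> idx (M - N)"
  unfolding idx_def by (meson in_diffD)

text \<open>The subtracted monomial contains the index 0, hence the factor \<open>x\<close>, so
  modulo \<open>x\<close> each key element is a power of the previous one.\<close>

lemma P_mod_x: "1 \<le> i \<Longrightarrow> enat i \<le> \<Lambda> \<Longrightarrow> x dvd P i - y ^ d i"
proof (induction i rule: dec_induct)
  case base
  show ?case by (simp add: P_1)
next
  case (step i)
  have i: "enat i < \<Lambda>" "enat i \<le> \<Lambda>" using enat_less_downward enat_le_downward step.prems by auto
  have "x dvd P i ^ n i - (y ^ d i) ^ n i" by (rule dvd_diff_power[OF step.IH[OF i(2)]])
  moreover have "x dvd monomial P (R i)"
    using monomial_0_mem[OF R_0[OF step.hyps(1) i(1)]] by simp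
  moreover have "(y ^ d i) ^ n i = y ^ d (Suc i)"
    using key_degree_Suc[OF step.hyps(1), of n] by (simp add: power_mult[symmetric] mult.commute)
  ultimately have "x dvd (P i ^ n i - y ^ d (Suc i)) - monomial P (R i)" by (simp only: dvd_diff)
  moreover have "P (Suc i) - y ^ d (Suc i) = (P i ^ n i - y ^ d (Suc i)) - monomial P (R i)"
    unfolding P_Suc[OF step.hyps(1) i(1)] by simp
  ultimately show ?case by (simp only:)
qed

lemma mon_mod_x: "idx M \<Longrightarrow> 0 \<notin># M \<Longrightarrow> x dvd mon M - y ^ dg M"
proof (induction M)
  case (add i M)
  then have "x dvd P i - y ^ d i" by (intro P_mod_x) auto
  then show ?case using add by (simp add: power_add dvd_diff_mult)
qed simp

lemma mon_has_degree:
  assumes "idx M" "0 \<notin># M" shows "has_degree (mon M) (dg M)"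
proof -
  obtain h where "mon M - y ^ dg M = x * h" using mon_mod_x[OF assms] ..
  then have "mon M = y ^ dg M + x * h" by (simp add: algebra_simps)
  then show ?thesis using has_degree_add_x[OF has_degree_y] by simp
qed

section \<open>The ideals generated by monomials of large weight\<close>

definition I :: "'g \<Rightarrow> 'a set"
  where "I \<gamma> = ideal_generated {mon M | M. idx M \<and> \<gamma> \<le> wt M}"

definition Igt :: "'g \<Rightarrow> 'a set"
  where "Igt \<gamma> = ideal_generated {mon M | M. idx M \<and> \<gamma> < wt M}"

lemma ring_ideal_I: "ring_ideal (I \<gamma>)" and ring_ideal_Igt: "ring_ideal (Igt \<gamma>)"
  unfolding I_def Igt_def by (rule ring_ideal_generated)+

lemma mon_mem_I: "idx M \<Longrightarrow> \<gamma> \<le> wt M \<Longrightarrow> mon M \<in> I \<gamma>"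
  unfolding I_def by (rule ideal_generated_base) blast

lemma mon_mem_Igt: "idx M \<Longrightarrow> \<gamma> < wt M \<Longrightarrow> mon M \<in> Igt \<gamma>"
  unfolding Igt_def by (rule ideal_generated_base) blast

lemma I_least: "ring_ideal J \<Longrightarrow> (\<And>M. idx M \<Longrightarrow> \<gamma> \<le> wt M \<Longrightarrow> mon M \<in> J) \<Longrightarrow> I \<gamma> \<subseteq> J"
  unfolding I_def by (rule ideal_generated_least) blast+

lemma Igt_least: "ring_ideal J \<Longrightarrow> (\<And>M. idx M \<Longrightarrow> \<gamma> < wt M \<Longrightarrow> mon M \<in> J) \<Longrightarrow> Igt \<gamma> \<subseteq> J"
  unfolding Igt_def by (rule ideal_generated_least) blast+

lemma I_antimono: "\<gamma> \<le> \<delta> \<Longrightarrow> I \<delta> \<subseteq> I \<gamma>"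
  by (rule I_least[OF ring_ideal_I]) (simp add: mon_mem_I)

lemma I_subset_Igt: "\<gamma> < \<delta> \<Longrightarrow> I \<delta> \<subseteq> Igt \<gamma>"
  by (rule I_least[OF ring_ideal_Igt]) (simp add: mon_mem_Igt)

lemma Igt_subset_I: "Igt \<gamma> \<subseteq> I \<gamma>"
  by (rule Igt_least[OF ring_ideal_I]) (simp add: mon_mem_I)

text \<open>The ideals belonging to larger weights form a chain, so their union is an ideal
  containing all generators of \<open>Igt (wt K)\<close>. Larger weights exist because of the
  additional factor \<open>x\<close>.\<close>

lemma Igt_mem:
  assumes "idx K" "f \<in> Igt (wt K)"
  shows "\<exists>M. idx M \<and> wt K < wt M \<and> f \<in> I (wt M)"
proof -
  let ?A = "{M. idx M \<and> wt K < wt M}"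
  have "add_mset 0 K \<in> ?A" using assms(1) pos[of 0] by simp
  then have "?A \<noteq> {}" by blast
  moreover have "I (wt M) \<subseteq> I (wt N) \<or> I (wt N) \<subseteq> I (wt M)" for M N
    by (cases "wt M \<le> wt N") (use I_antimono in \<open>simp_all\<close>)
  ultimately have "ring_ideal (\<Union>M\<in>?A. I (wt M))"
    by (intro ring_ideal_UN_chain ring_ideal_I) simp_all
  then have "Igt (wt K) \<subseteq> (\<Union>M\<in>?A. I (wt M))"
    by (rule Igt_least) (use mon_mem_I in blast)
  then show ?thesis using assms(2) by blast
qed

text \<open>Replacing \<open>P i ^ n i\<close> by \<open>P (Suc i)\<close> changes a monomial by \<open>x\<close> times a monomial
  of the complementary weight, since the index \<open>0\<close> occurs in \<open>R i\<close>.\<close>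

lemma reduce_to_standard0:
  assumes "idx M" "0 \<notin># M"
  shows "\<exists>N. standard0 N \<and> dg N = dg M \<and> wt M \<le> wt N \<and> (\<exists>z\<in>I (wt M - \<beta> 0). mon M = mon N + x * z)"
proof -
  obtain B where B: "\<And>i. enat i \<le> \<Lambda> \<Longrightarrow> d i \<le> dg M \<Longrightarrow> i \<le> B"
    using degrees_unbounded[of "dg M"] by blast
  \<comment> \<open>The degree is preserved, so the new indices are at most \<open>B\<close>.
    Trading \<open>n i\<close> copies of \<open>i\<close> for one \<open>Suc i\<close> lowers the
    sum of the distances to \<open>Suc B\<close>, even when \<open>n i\<close> is 1.\<close>
  define \<mu> where "\<mu> K = weight (\<lambda>i. Suc B - i) K" for K
  have "\<exists>N. standard0 N \<and> dg N = dg K \<and> wt K \<le> wt N \<and> (\<exists>z\<in>I (wt K - \<beta> 0). mon K = mon N + x * z)"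
    if "idx K" "0 \<notin># K" "dg K = dg M" for K
    using that
  proof (induction K rule: measure_induct_rule[of \<mu>])
    case (less K)
    show ?case
    proof (cases "standard K")
      case True
      then show ?thesis using less.prems
        by (intro exI[of _ K]) (auto simp: standard0_def intro!: bexI[of _ 0] ring_ideal_zero[OF ring_ideal_I])
    next
      case False
      then obtain i where i: "1 \<le> i" "enat i < \<Lambda>" "n i \<le> count K i"
        using less.prems(1) by (auto simp: standard_def not_less)
      obtain K' where K': "K = K' + replicate_mset (n i) i" using mset_split_replicate[OF i(3)] .
      have ni: "0 < n i" using n_pos i by simp
      define K1 where "K1 = add_mset (Suc i) K'"
      have K1: "idx K1" "0 \<notin># K1"
        using less.prems(1,2) idx_Suc[OF i(2)] by (auto simp: K1_def K')
      have dgK1: "dg K1 = dg M"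
        using less.prems(3) key_degree_Suc[OF i(1), of n] by (simp add: K1_def K' nat_multiple_nat)
      have "d (Suc i) \<le> dg M" unfolding dgK1[symmetric] K1_def by simp
      then have iB: "Suc i \<le> B" using B idx_Suc[OF i(2)] by blast
      have "B - i < n i * (Suc B - i)"
      proof -
        have "B - i < Suc B - i" using iB by simp
        also have "\<dots> \<le> n i * (Suc B - i)" using ni by simp
        finally show ?thesis .
      qed
      then have "\<mu> K1 < \<mu> K" by (simp add: \<mu>_def K1_def K' nat_multiple_nat)
      then obtain N z where N: "standard0 N" "dg N = dg K1" "wt K1 \<le> wt N"
          "z \<in> I (wt K1 - \<beta> 0)" "mon K1 = mon N + x * z"
        using less.IH[OF _ K1 dgK1] by blast
      have wtK1: "wt K < wt K1" using gap i by (simp add: K1_def K')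
      define L where "L = K' + (R i - {#0#})"
      have L: "idx L" using less.prems(1) idx_R i by (simp add: L_def K' idx_diff)
      have wtL: "wt L = wt K - \<beta> 0"
        using weight_0_mem[OF R_0] R_weight i by (simp add: L_def K')
      have "P i ^ n i = P (Suc i) + x * mon (R i - {#0#})"
        using P_Suc[OF i(1,2)] monomial_0_mem[OF R_0[OF i(1,2)]] by simp
      then have "mon K = mon K1 + x * mon L"
        by (simp add: K' K1_def L_def algebra_simps)
      then have "mon K = mon N + x * (z + mon L)" using N(5) by (simp add: algebra_simps)
      moreover have "z + mon L \<in> I (wt K - \<beta> 0)"
        using N(4) less_imp_le[OF wtK1] L wtL I_antimono[of "wt K - \<beta> 0" "wt K1 - \<beta> 0"]
        by (intro ring_ideal_add[OF ring_ideal_I]) (auto intro: mon_mem_I)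
      ultimately show ?thesis using N dgK1 less.prems(3) wtK1
        by (intro exI[of _ N]) auto
    qed
  qed
  then show ?thesis using assms by blast
qed

text \<open>This rewriting preserves the weight, but in general not the degree. Powers are replaced
  by the earlier key elements in \<open>R i\<close>, which decreases the multiset order, and the
  discarded monomial with \<open>P (Suc i)\<close> has larger weight by the gap.\<close>

lemma reduce_to_standard:
  assumes "idx M"
  shows "\<exists>N. standard N \<and> wt N = wt M \<and> mon M - mon N \<in> Igt (wt M)"
  using assms
proof (induction M rule: wf_induct_rule[OF wf_mult[OF wf_less_than]])
  case (1 M)
  show ?case
  proof (cases "standard M")
    case True
    then show ?thesis by (intro exI[of _ M]) (simp add: ring_ideal_zero[OF ring_ideal_Igt])
  next
    case False
    then obtain i where i: "1 \<le> i" "enat i < \<Lambda>" "n i \<le> count M i"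
      using 1(2) by (auto simp: standard_def not_less)
    obtain M' where M': "M = M' + replicate_mset (n i) i" using mset_split_replicate[OF i(3)] .
    have ni: "0 < n i" using n_pos i by simp
    define M1 where "M1 = M' + R i"
    have "(M1, M) \<in> mult less_than"
      unfolding M1_def M' using ni R_subset[OF i(1,2)] by (intro one_step_implies_mult) auto
    moreover have "idx M1" using 1(2) idx_R i by (simp add: M1_def M')
    ultimately obtain N where N: "standard N" "wt N = wt M1" "mon M1 - mon N \<in> Igt (wt M1)"
      using 1(1) by blast
    have wt: "wt M1 = wt M" using R_weight i by (simp add: M1_def M')
    have "P i ^ n i = P (Suc i) + mon (R i)" using P_Suc[OF i(1,2)] by simp
    then have "mon M - mon M1 = mon (add_mset (Suc i) M')"
      by (simp add: M' M1_def algebra_simps)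
    moreover have "mon (add_mset (Suc i) M') \<in> Igt (wt M)"
      by (rule mon_mem_Igt) (use 1(2) gap i idx_Suc in \<open>simp_all add: M'\<close>)
    ultimately have "(mon M - mon M1) + (mon M1 - mon N) \<in> Igt (wt M)"
      using N(3) wt by (intro ring_ideal_add[OF ring_ideal_Igt]) simp_all
    then show ?thesis using N wt by (intro exI[of _ N]) simp
  qed
qed

text \<open>Modulo \<open>x\<close> times the ideal of weight \<open>\<gamma> - \<beta> 0\<close>
  the ideal is principal. A generator without the factor \<open>x\<close> has the same degree as the
  product of \<open>Q\<close> with a suitable power of \<open>y\<close>, so both reduce to the same
  standard monomial and differ by a multiple of \<open>x\<close>.\<close>

lemma I_decomposition:
  assumes least: "\<And>N. standard0 N \<Longrightarrow> \<gamma> \<le> wt N \<Longrightarrow> c \<le> dg N"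
    and ex: "(\<exists>N. standard0 N \<and> \<gamma> \<le> wt N) \<Longrightarrow> \<exists>Q. standard0 Q \<and> \<gamma> \<le> wt Q \<and> dg Q = c"
  shows "\<exists>q. (q = 0 \<or> has_degree q c \<and> q \<in> I \<gamma>) \<and> I \<gamma> \<subseteq> {a * q + x * z | a z. z \<in> I (\<gamma> - \<beta> 0)}"
proof -
  have zero_mem: "mon M \<in> {a * q + x * z | a z. z \<in> I (\<gamma> - \<beta> 0)}" if "idx M" "\<gamma> \<le> wt M" "0 \<in># M" for M q
  proof -
    have "mon M = 0 * q + x * mon (M - {#0#})" using monomial_0_mem[OF that(3)] by simp
    moreover have "mon (M - {#0#}) \<in> I (\<gamma> - \<beta> 0)"
      using that weight_0_mem[OF that(3)] by (intro mon_mem_I) (simp_all add: idx_diff)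
    ultimately show ?thesis by blast
  qed
  show ?thesis
  proof (cases "\<exists>N. standard0 N \<and> \<gamma> \<le> wt N")
    case False
    have "I \<gamma> \<subseteq> {a * 0 + x * z | a z. z \<in> I (\<gamma> - \<beta> 0)}"
    proof (rule I_least[OF ring_ideal_linear_combinations[OF ring_ideal_I]])
      fix M assume M: "idx M" "\<gamma> \<le> wt M"
      then have "0 \<in># M" using False reduce_to_standard0[of M] by (meson order_trans)
      then show "mon M \<in> {a * 0 + x * z | a z. z \<in> I (\<gamma> - \<beta> 0)}" using zero_mem M by blast
    qed
    then show ?thesis by blast
  next
    case True
    then obtain Q where Q: "standard0 Q" "\<gamma> \<le> wt Q" "dg Q = c" using ex by blast
    have Q': "idx Q" "0 \<notin># Q" using Q by (auto simp: standard0_def standard_def)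
    have "I \<gamma> \<subseteq> {a * mon Q + x * z | a z. z \<in> I (\<gamma> - \<beta> 0)}"
    proof (rule I_least[OF ring_ideal_linear_combinations[OF ring_ideal_I]])
      fix M assume M: "idx M" "\<gamma> \<le> wt M"
      show "mon M \<in> {a * mon Q + x * z | a z. z \<in> I (\<gamma> - \<beta> 0)}"
      proof (cases "0 \<in># M")
        case True
        then show ?thesis using zero_mem M by blast
      next
        case False
        obtain N z where N: "standard0 N" "dg N = dg M" "wt M \<le> wt N"
            "z \<in> I (wt M - \<beta> 0)" "mon M = mon N + x * z"
          using reduce_to_standard0[OF M(1) False] by blast
        have c: "c \<le> dg M" using least[OF N(1)] N(2,3) M(2) by simp
        define M' where "M' = Q + replicate_mset (dg M - c) (Suc 0)"
        have "0 \<le> (dg M - c) \<cdot> \<beta> (Suc 0)" using pos[OF idx_1] by (intro nat_multiple_nonneg) simp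
        then have M': "idx M'" "0 \<notin># M'" "\<gamma> \<le> wt M'" "dg M' = dg M"
          using Q Q' c by (auto simp: M'_def nat_multiple_nat idx_def add_increasing2)
        obtain N' z' where N': "standard0 N'" "dg N' = dg M'" "wt M' \<le> wt N'"
            "z' \<in> I (wt M' - \<beta> 0)" "mon M' = mon N' + x * z'"
          using reduce_to_standard0[OF M'(1,2)] by blast
        have "N = N'" using standard0_linear[OF N(1) N'(1)] N(2) N'(2) M'(4) by auto
        then have "mon M = y ^ (dg M - c) * mon Q + x * (z - z')"
          using N(5) N'(5) by (simp add: M'_def P_1 algebra_simps)
        moreover have "z - z' \<in> I (\<gamma> - \<beta> 0)"
          using N(4) N'(4) M(2) M'(3) I_antimono[of "\<gamma> - \<beta> 0"]
          by (intro ring_ideal_diff[OF ring_ideal_I]) (meson diff_right_mono subsetD)+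
        ultimately show ?thesis by blast
      qed
    qed
    moreover have "has_degree (mon Q) c" using mon_has_degree[OF Q'] Q(3) by simp
    ultimately show ?thesis using mon_mem_I[OF Q'(1) Q(2)] by blast
  qed
qed

text \<open>In x h = a q + x z the prime \<open>x\<close> does not divide a nonzero
  \<open>q\<close>, so it divides \<open>a\<close> and cancels. Division by \<open>x\<close> thus
  lowers the weight by at most \<open>\<beta> 0\<close>.\<close>

lemma I_colon_x:
  assumes "x * h \<in> I \<gamma>" shows "h \<in> I (\<gamma> - \<beta> 0)"
proof -
  define c where "c = (LEAST c. \<exists>N. standard0 N \<and> \<gamma> \<le> wt N \<and> dg N = c)"
  have "c \<le> dg N" if "standard0 N" "\<gamma> \<le> wt N" for N
    unfolding c_def by (rule Least_le) (use that in blast)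
  moreover have "\<exists>Q. standard0 Q \<and> \<gamma> \<le> wt Q \<and> dg Q = c" if "\<exists>N. standard0 N \<and> \<gamma> \<le> wt N"
    unfolding c_def by (rule LeastI_ex) (use that in blast)
  ultimately obtain q where q: "q = 0 \<or> has_degree q c \<and> q \<in> I \<gamma>"
    "I \<gamma> \<subseteq> {a * q + x * z | a z. z \<in> I (\<gamma> - \<beta> 0)}"
    using I_decomposition[of \<gamma> c] by blast
  obtain a z where z: "x * h = a * q + x * z" "z \<in> I (\<gamma> - \<beta> 0)" using q(2) assms by blast
  show ?thesis
  proof (cases "q = 0")
    case True
    then show ?thesis using z x_nonzero by simp
  next
    case False
    then have qq: "has_degree q c" "q \<in> I \<gamma>" using q(1) by auto
    have "a * q = x * (h - z)" using z(1) by (simp add: algebra_simps)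
    then have "x dvd a" using x_prime[of a q] has_degree_not_dvd[OF qq(1)] by simp
    then obtain b where "a = x * b" ..
    then have "x * h = x * (b * q + z)" using z(1) by (simp add: algebra_simps)
    then have "h = b * q + z" using x_nonzero by simp
    moreover have "q \<in> I (\<gamma> - \<beta> 0)" using qq(2) I_antimono[of "\<gamma> - \<beta> 0" \<gamma>] less_imp_le[OF pos[of 0]] by auto
    ultimately show ?thesis
      using z(2) by (simp add: ring_ideal_add[OF ring_ideal_I] ring_ideal_mult[OF ring_ideal_I])
  qed
qed

lemma I_colon_x_power: "x ^ k * h \<in> I \<gamma> \<Longrightarrow> h \<in> I (\<gamma> - k \<cdot> \<beta> 0)"
proof (induction k arbitrary: \<gamma>)
  case (Suc k)
  then have "x ^ k * h \<in> I (\<gamma> - \<beta> 0)" using I_colon_x[of "x ^ k * h"] by (simp add: mult.assoc)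
  then have "h \<in> I (\<gamma> - \<beta> 0 - k \<cdot> \<beta> 0)" by (rule Suc.IH)
  then show ?case by (simp add: nat_multiple_Suc algebra_simps)
qed simp

text \<open>Otherwise every generator of the ideal is a multiple of \<open>x\<close> or has degree
  above \<open>c\<close>, and modulo \<open>x\<close> all its elements would be multiples of
  y^(c+1).\<close>

lemma I_degree_bound:
  assumes "f \<in> I \<gamma>" "has_degree f c"
  shows "\<exists>N. standard0 N \<and> \<gamma> \<le> wt N \<and> dg N \<le> c"
proof (rule ccontr)
  assume none: "\<not> ?thesis"
  have U: "ring_ideal (UNIV :: 'a set)" by (simp add: ring_ideal_iff)
  have "I \<gamma> \<subseteq> {a * y ^ Suc c + x * z | a z. z \<in> UNIV}"
  proof (rule I_least[OF ring_ideal_linear_combinations[OF U]])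
    fix M assume M: "idx M" "\<gamma> \<le> wt M"
    show "mon M \<in> {a * y ^ Suc c + x * z | a z. z \<in> UNIV}"
    proof (cases "0 \<in># M")
      case True
      then have "mon M = 0 * y ^ Suc c + x * mon (M - {#0#})" using monomial_0_mem by simp
      then show ?thesis by blast
    next
      case False
      obtain N where "standard0 N" "dg N = dg M" "wt M \<le> wt N"
        using reduce_to_standard0[OF M(1) False] by blast
      then have "Suc c \<le> dg M" using none M(2) by (metis not_less_eq_eq order_trans)
      then have pw: "y ^ (dg M - Suc c) * y ^ Suc c = y ^ dg M"
        by (metis le_add_diff_inverse2 power_add)
      obtain h where "mon M - y ^ dg M = x * h" using mon_mod_x[OF M(1) False] ..
      then have "mon M = y ^ (dg M - Suc c) * y ^ Suc c + x * h"
        unfolding pw by (simp add: algebra_simps)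
      then show ?thesis by blast
    qed
  qed
  then obtain a z where "f = a * y ^ Suc c + x * z" using assms(1) by blast
  then show False using has_degree_le[OF assms(2)] by fastforce
qed

lemma best_standard0:
  "\<exists>N. standard0 N \<and> dg N \<le> c \<and> (\<forall>K. standard0 K \<longrightarrow> dg K \<le> c \<longrightarrow> wt K \<le> wt N)"
proof -
  have "standard0 {#}" using n_pos by (auto simp: standard0_def standard_def)
  then have "\<exists>N. (standard0 N \<and> dg N \<le> c) \<and> (\<forall>K. standard0 K \<and> dg K \<le> c \<longrightarrow> dg K \<le> dg N)"
    using ex_has_greatest_nat[of "\<lambda>N. standard0 N \<and> dg N \<le> c" "{#}" dg "Suc c"] by (auto simp: less_Suc_eq_le)
  then obtain N where N: "standard0 N" "dg N \<le> c" "\<And>K. standard0 K \<Longrightarrow> dg K \<le> c \<Longrightarrow> dg K \<le> dg N"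
    by blast
  have "wt K \<le> wt N" if "standard0 K" "dg K \<le> c" for K
    using standard0_linear[OF that(1) N(1)] N(3)[OF that] by (cases "K = N") auto
  then show ?thesis using N(1,2) by blast
qed

lemma I_zero: "f \<in> I 0"
  using ring_ideal_mult[OF ring_ideal_I mon_mem_I[of "{#}" 0], of f] by simp

text \<open>If the weights \<open>\<gamma>\<close> with \<open>f \<in> I \<gamma>\<close> had no maximum, then \<open>f\<close> would lie in the union \<open>J\<close> of
  the remaining ideals modulo every power of \<open>x\<close>, hence in \<open>J\<close> by Krull's intersection theorem.\<close>

lemma value_exists:
  assumes "f \<noteq> 0"
  shows "\<exists>M. idx M \<and> f \<in> I (wt M) \<and> f \<notin> Igt (wt M)"
proof (rule ccontr)
  assume none: "\<not> ?thesis"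
  define G where "G = {M. idx M \<and> f \<in> I (wt M)}"
  define U where "U = {M. idx M \<and> f \<notin> I (wt M)}"
  have no_max: "\<exists>M'\<in>G. wt M < wt M'" if "M \<in> G" for M
    using none Igt_mem[of M f] that by (auto simp: G_def)
  have GU: "I (wt M') \<subseteq> I (wt M)" if "M \<in> G" "M' \<in> U" for M M'
  proof (rule I_antimono)
    have "\<not> wt M' \<le> wt M" using that I_antimono by (auto simp: G_def U_def)
    then show "wt M \<le> wt M'" by simp
  qed
  define E where "E = {g. \<forall>M\<in>G. g \<in> I (wt M)}"
  have E: "ring_ideal E" unfolding E_def
    by (rule ring_idealI)
      (auto simp: ring_ideal_zero[OF ring_ideal_I] ring_ideal_add[OF ring_ideal_I] ring_ideal_mult[OF ring_ideal_I])
  have fE: "f \<in> E" by (simp add: E_def G_def)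
  \<comment> \<open>\<open>N\<close> is the heaviest standard monomial without \<open>x\<close> that
    fits into the degree of \<open>g\<close>. Its product with x^k bounds all weights from
    \<open>G\<close>, because those ideals contain x^k g; since \<open>G\<close> has no greatest
    weight, the product belongs to \<open>U\<close>.\<close>
  have key: "\<exists>a h M. M \<in> U \<and> x ^ k * g = a * mon M + x ^ Suc k * h"
    if g: "x ^ k * g \<in> E" "\<not> x dvd g" for k g
  proof -
    obtain c where c: "has_degree g c" using has_degree_exists[OF g(2)] by blast
    obtain N where N: "standard0 N" "dg N \<le> c" "\<And>K. standard0 K \<Longrightarrow> dg K \<le> c \<Longrightarrow> wt K \<le> wt N"
      using best_standard0 by blast
    have N': "idx N" "0 \<notin># N" using N(1) by (auto simp: standard0_def standard_def)
    define M where "M = N + replicate_mset k 0"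
    have M: "idx M" using N' by (simp add: M_def)
    have le: "wt K \<le> wt M" if "K \<in> G" for K
    proof -
      have "x ^ k * g \<in> I (wt K)" using g(1) that by (simp add: E_def)
      then have "g \<in> I (wt K - k \<cdot> \<beta> 0)" by (rule I_colon_x_power)
      then obtain L where "standard0 L" "wt K - k \<cdot> \<beta> 0 \<le> wt L" "dg L \<le> c"
        using I_degree_bound[OF _ c] by blast
      then have "wt K - k \<cdot> \<beta> 0 \<le> wt N" using N(3) order_trans by blast
      then show ?thesis by (simp add: M_def algebra_simps)
    qed
    have "M \<notin> G"
    proof
      assume "M \<in> G"
      then obtain M' where "M' \<in> G" "wt M < wt M'" using no_max by blast
      then show False using le[of M'] by simp
    qed
    then have "M \<in> U" using M by (auto simp: G_def U_def)
    moreover obtain u h where "g = u * y ^ (c - dg N) * mon N + x * h"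
      using has_degree_divide[OF c mon_has_degree[OF N'] N(2)] by blast
    then have "x ^ k * g = (u * y ^ (c - dg N)) * mon M + x ^ Suc k * h"
      by (simp add: M_def P_0 algebra_simps)
    ultimately show ?thesis by blast
  qed
  define J where "J = (\<Union>M\<in>U. I (wt M))"
  obtain k g where fk: "f = x ^ k * g" "\<not> x dvd g" using x_factor[OF assms] by blast
  then have "U \<noteq> {}" using key[of k g] fE by auto
  moreover have "I (wt M) \<subseteq> I (wt N) \<or> I (wt N) \<subseteq> I (wt M)" for M N
    by (cases "wt M \<le> wt N") (use I_antimono in \<open>simp_all\<close>)
  ultimately have J: "ring_ideal J"
    unfolding J_def by (intro ring_ideal_UN_chain ring_ideal_I)
  have JE: "J \<subseteq> E" using GU by (auto simp: J_def E_def)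
  have "\<exists>j\<in>J. \<exists>a. f = j + x ^ m * a" for m
  proof (induction m)
    case 0
    show ?case by (intro bexI[of _ 0] exI[of _ f]) (simp_all add: ring_ideal_zero[OF J])
  next
    case (Suc m)
    then obtain j a where ja: "j \<in> J" "f = j + x ^ m * a" by blast
    show ?case
    proof (cases "a = 0")
      case True
      then show ?thesis using ja by (intro bexI[of _ j] exI[of _ 0]) simp_all
    next
      case False
      then obtain k g where kg: "a = x ^ k * g" "\<not> x dvd g" using x_factor by blast
      have "x ^ m * a = f - j" using ja(2) by simp
      then have "x ^ (m + k) * g \<in> E"
        using ring_ideal_diff[OF E fE, of j] ja(1) JE kg(1) by (auto simp: power_add mult.assoc)
      then obtain b h M where M: "M \<in> U" "x ^ (m + k) * g = b * mon M + x ^ Suc (m + k) * h"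
        using key kg(2) by blast
      have "mon M \<in> I (wt M)" using M(1) by (intro mon_mem_I) (auto simp: U_def)
      then have "b * mon M \<in> J" using M(1) ring_ideal_mult[OF ring_ideal_I] by (auto simp: J_def)
      then have "j + b * mon M \<in> J" using ring_ideal_add[OF J ja(1)] by blast
      moreover have "f = (j + b * mon M) + x ^ Suc m * (x ^ k * h)"
      proof -
        have "f = j + x ^ (m + k) * g" using ja(2) kg(1) by (simp add: power_add mult.assoc)
        also have "\<dots> = (j + b * mon M) + x ^ Suc (m + k) * h" unfolding M(2) by (simp add: add.assoc)
        also have "x ^ Suc (m + k) * h = x ^ Suc m * (x ^ k * h)" by (simp add: power_add mult.assoc)
        finally show ?thesis .
      qed
      ultimately show ?thesis by blast
    qed
  qed
  then have "f \<in> J" by (rule krull_intersection[OF J x_nonunit])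
  then show False by (auto simp: J_def U_def)
qed

section \<open>The valuation defined by the ideals\<close>

definition val :: "'a \<Rightarrow> 'g"
  where "val f = wt (SOME M. idx M \<and> f \<in> I (wt M) \<and> f \<notin> Igt (wt M))"

lemma val_weight:
  assumes "f \<noteq> 0" shows "\<exists>M. idx M \<and> val f = wt M \<and> f \<in> I (wt M) \<and> f \<notin> Igt (wt M)"
  using someI_ex[OF value_exists[OF assms]] unfolding val_def by blast

lemma mem_I_iff:
  assumes "f \<noteq> 0" shows "f \<in> I \<gamma> \<longleftrightarrow> \<gamma> \<le> val f"
proof -
  obtain M where M: "val f = wt M" "f \<in> I (wt M)" "f \<notin> Igt (wt M)" using val_weight[OF assms] by blast
  have "f \<notin> I \<gamma>" if "wt M < \<gamma>" using that I_subset_Igt M(3) by blast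
  moreover have "f \<in> I \<gamma>" if "\<gamma> \<le> wt M" using that I_antimono M(2) by blast
  ultimately show ?thesis using M(1) by (cases "wt M < \<gamma>") auto
qed

lemma not_mem_Igt_val: "f \<noteq> 0 \<Longrightarrow> f \<notin> Igt (val f)"
  using val_weight by metis

lemma val_eqI:
  assumes "f \<in> I \<gamma>" "f \<notin> Igt \<gamma>"
  shows "f \<noteq> 0 \<and> val f = \<gamma>"
proof -
  have f: "f \<noteq> 0" using assms(2) ring_ideal_zero[OF ring_ideal_Igt] by blast
  then have "\<gamma> \<le> val f" "f \<in> I (val f)" using assms(1) mem_I_iff by blast+
  moreover have "\<not> \<gamma> < val f" using calculation(2) assms(2) I_subset_Igt by blast
  ultimately show ?thesis using f by simp
qed

lemma Igt_mult_x: "f \<in> I \<gamma> \<Longrightarrow> x * f \<in> Igt \<gamma>"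
  and Igt_mult_y: "f \<in> I \<gamma> \<Longrightarrow> y * f \<in> Igt \<gamma>"
proof -
  have "P i * f \<in> Igt \<gamma>" if f: "f \<in> I \<gamma>" and i: "enat i \<le> \<Lambda>" for i f
  proof -
    have "I \<gamma> \<subseteq> {f. P i * f \<in> Igt \<gamma>}"
    proof (rule I_least)
      show "ring_ideal {f. P i * f \<in> Igt \<gamma>}"
        by (rule ring_idealI)
          (auto simp: distrib_left mult.left_commute[of "P i"] ring_ideal_zero[OF ring_ideal_Igt]
            intro: ring_ideal_add[OF ring_ideal_Igt] ring_ideal_mult[OF ring_ideal_Igt])
      fix M assume M: "idx M" "\<gamma> \<le> wt M"
      have "mon (add_mset i M) \<in> Igt \<gamma>"
        using M i pos[OF i] by (intro mon_mem_Igt) (simp_all add: add_pos_nonneg less_le_trans add_strict_increasing)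
      then show "mon M \<in> {f. P i * f \<in> Igt \<gamma>}" by simp
    qed
    then show ?thesis using f by blast
  qed
  from this[of f 0] this[of f "Suc 0"]
  show "f \<in> I \<gamma> \<Longrightarrow> x * f \<in> Igt \<gamma>" "f \<in> I \<gamma> \<Longrightarrow> y * f \<in> Igt \<gamma>"
    by (simp_all add: P_0 P_1)
qed

text \<open>All monomials of weight \<open>val f\<close> agree, up to larger weights, with the
  unique standard monomial of that weight, so \<open>f\<close> is a multiple of it modulo
  \<open>Igt (val f)\<close>. A nonunit coefficient, being a combination of \<open>x\<close> and
  \<open>y\<close>, would raise the weight.\<close>

lemma leading_term:
  assumes "f \<noteq> 0"
  shows "\<exists>K u r. standard K \<and> wt K = val f \<and> u dvd 1 \<and> r \<in> Igt (val f) \<and> f = u * mon K + r"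
proof -
  obtain M where M: "idx M" "val f = wt M" "f \<in> I (wt M)" using val_weight[OF assms] by blast
  obtain K where K: "standard K" "wt K = wt M" using reduce_to_standard[OF M(1)] by blast
  have "I (wt M) \<subseteq> {r + a * mon K | r a. r \<in> Igt (wt M)}"
  proof (rule I_least[OF ring_ideal_plus_multiples[OF ring_ideal_Igt]])
    fix L assume L: "idx L" "wt M \<le> wt L"
    show "mon L \<in> {r + a * mon K | r a. r \<in> Igt (wt M)}"
    proof (cases "wt M < wt L")
      case True
      then have "mon L \<in> Igt (wt M)" using mon_mem_Igt L(1) by blast
      moreover have "mon L = mon L + 0 * mon K" by simp
      ultimately show ?thesis by blast
    next
      case False
      then have eq: "wt L = wt M" using L(2) by simp
      obtain K' where K': "standard K'" "wt K' = wt L" "mon L - mon K' \<in> Igt (wt L)"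
        using reduce_to_standard[OF L(1)] by blast
      have "K' = K" using standard_weight_inj[OF K'(1) K(1)] K'(2) K(2) eq by simp
      then have "mon L = (mon L - mon K') + 1 * mon K" by simp
      moreover have "mon L - mon K' \<in> Igt (wt M)" using K'(3) eq by simp
      ultimately show ?thesis by blast
    qed
  qed
  then obtain r a where ra: "r \<in> Igt (wt M)" "f = r + a * mon K" using M(3) by blast
  have "a dvd 1"
  proof (rule ccontr)
    assume "\<not> a dvd 1"
    then obtain b c where "a = b * x + c * y" using nonunit_iff by blast
    then have a: "a * mon K = b * (x * mon K) + c * (y * mon K)" by (simp add: algebra_simps)
    have "mon K \<in> I (wt M)" using K by (intro mon_mem_I) (simp_all add: standard_def)
    then have "a * mon K \<in> Igt (wt M)"
      unfolding a by (intro ring_ideal_add[OF ring_ideal_Igt] ring_ideal_mult[OF ring_ideal_Igt]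
          Igt_mult_x Igt_mult_y)
    then have "f \<in> Igt (wt M)" unfolding ra(2) by (intro ring_ideal_add[OF ring_ideal_Igt] ra(1))
    then show False using not_mem_Igt_val[OF assms] M(2) by simp
  qed
  moreover have "f = a * mon K + r" using ra(2) by simp
  ultimately show ?thesis using K ra(1) M(2) by auto
qed

text \<open>Once the power of \<open>x\<close> is removed, membership would yield a standard
  monomial without \<open>x\<close> that is heavier than \<open>K0\<close> but of no larger degree,
  contrary to the common order of weights and degrees.\<close>

lemma standard_not_mem_Igt:
  assumes "standard K" shows "mon K \<notin> Igt (wt K)"
proof
  assume "mon K \<in> Igt (wt K)"
  moreover have "idx K" using assms by (simp add: standard_def)
  ultimately obtain M where M: "wt K < wt M" "mon K \<in> I (wt M)" using Igt_mem by blast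
  define k where "k = count K 0"
  define K0 where "K0 = filter_mset (\<lambda>j. 0 < j) K"
  have "filter_mset (\<lambda>j. j < 0) K = {#}" by simp
  then have K: "K = replicate_mset k 0 + K0" using mset_split[of K 0] by (simp add: k_def K0_def)
  have K0: "standard0 K0" using assms by (auto simp: standard0_def standard_def K0_def idx_def)
  then have K0': "idx K0" "0 \<notin># K0" by (auto simp: standard0_def standard_def)
  have "x ^ k * mon K0 \<in> I (wt M)" using M(2) by (simp add: K P_0)
  then have "mon K0 \<in> I (wt M - k \<cdot> \<beta> 0)" by (rule I_colon_x_power)
  then obtain N where N: "standard0 N" "wt M - k \<cdot> \<beta> 0 \<le> wt N" "dg N \<le> dg K0"
    using I_degree_bound mon_has_degree[OF K0'] by blast
  have "wt K = k \<cdot> \<beta> 0 + wt K0" by (simp add: K)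
  then have "wt K0 < wt M - k \<cdot> \<beta> 0" using M(1) by (simp add: less_diff_eq add.commute)
  then have "wt K0 < wt N" using N(2) by (rule less_le_trans)
  then show False using standard0_linear[OF N(1) K0] N(3) by (cases "N = K0") auto
qed

lemma val_monomial:
  assumes "standard K" shows "mon K \<noteq> 0 \<and> val (mon K) = wt K"
  using assms by (intro val_eqI mon_mem_I standard_not_mem_Igt) (simp_all add: standard_def)

lemma Igt_mult_I:
  assumes "f \<in> Igt \<gamma>" "g \<in> I \<delta>" shows "f * g \<in> Igt (\<gamma> + \<delta>)"
proof -
  have ideal: "ring_ideal {f. f * g \<in> Igt \<eta>}" for g \<eta>
    by (rule ring_idealI)
      (auto simp: distrib_right mult.assoc ring_ideal_zero[OF ring_ideal_Igt]
        intro: ring_ideal_add[OF ring_ideal_Igt] ring_ideal_mult[OF ring_ideal_Igt])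
  have "I \<delta> \<subseteq> {g. g * mon M \<in> Igt (\<gamma> + \<delta>)}" if "idx M" "\<gamma> < wt M" for M
  proof (rule I_least[OF ideal])
    fix N assume "idx N" "\<delta> \<le> wt N"
    then have "mon (N + M) \<in> Igt (\<gamma> + \<delta>)"
      using that by (intro mon_mem_Igt) (simp_all add: add.commute[of \<gamma>] add_le_less_mono)
    then show "mon N \<in> {g. g * mon M \<in> Igt (\<gamma> + \<delta>)}" by simp
  qed
  then have "mon M * g \<in> Igt (\<gamma> + \<delta>)" if "idx M" "\<gamma> < wt M" for M
    using that assms(2) by (auto simp: mult.commute)
  then have "Igt \<gamma> \<subseteq> {f. f * g \<in> Igt (\<gamma> + \<delta>)}"
    by (intro Igt_least[OF ideal]) simp
  then show ?thesis using assms(1) by blast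
qed

text \<open>Initial forms multiply because a product of two standard monomials reduces to the
  unique standard monomial of the same weight.\<close>

lemma val_mult:
  assumes f: "f \<noteq> 0" and g: "g \<noteq> 0" shows "val (f * g) = val f + val g"
proof -
  obtain K u r where K: "standard K" "wt K = val f" "u dvd 1" "r \<in> Igt (val f)" "f = u * mon K + r"
    using leading_term[OF f] by blast
  obtain L w s where L: "standard L" "wt L = val g" "w dvd 1" "s \<in> Igt (val g)" "g = w * mon L + s"
    using leading_term[OF g] by blast
  let ?\<gamma> = "val f + val g"
  have KL: "idx K" "idx L" using K L by (simp_all add: standard_def)
  obtain N where N: "standard N" "wt N = ?\<gamma>" "mon (K + L) - mon N \<in> Igt ?\<gamma>"
    using reduce_to_standard[of "K + L"] KL K(2) L(2) by auto
  define t where "t = u * w * (mon (K + L) - mon N) + r * g + s * (u * mon K)"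
  have fI: "u * mon K \<in> I (val f)" and gI: "g \<in> I (val g)"
    using mem_I_iff[OF g, of "val g"] KL K(2)
    by (auto intro!: ring_ideal_mult[OF ring_ideal_I] mon_mem_I)
  have rg: "r * g \<in> Igt ?\<gamma>" by (rule Igt_mult_I[OF K(4) gI])
  have su: "s * (u * mon K) \<in> Igt ?\<gamma>"
    using Igt_mult_I[OF L(4) fI] by (simp only: add.commute[of "val g"])
  have t: "t \<in> Igt ?\<gamma>"
    unfolding t_def
    by (rule ring_ideal_add[OF ring_ideal_Igt ring_ideal_add[OF ring_ideal_Igt
          ring_ideal_mult[OF ring_ideal_Igt N(3)] rg] su])
  have "f * g = u * mon K * g + r * g" by (subst K(5)) (simp add: algebra_simps)
  also have "u * mon K * g = u * mon K * (w * mon L + s)" by (subst L(5)) (rule refl)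
  finally have fg: "f * g = u * w * mon N + t" by (simp add: t_def algebra_simps)
  have "u * w * mon N \<in> I ?\<gamma>"
    using N by (intro ring_ideal_mult[OF ring_ideal_I] mon_mem_I) (simp_all add: standard_def)
  then have "f * g \<in> I ?\<gamma>"
    unfolding fg using t Igt_subset_I by (intro ring_ideal_add[OF ring_ideal_I]) blast+
  moreover have "f * g \<notin> Igt ?\<gamma>"
  proof
    assume "f * g \<in> Igt ?\<gamma>"
    then have "f * g - t \<in> Igt ?\<gamma>" by (rule ring_ideal_diff[OF ring_ideal_Igt _ t])
    then have m: "u * w * mon N \<in> Igt ?\<gamma>" by (simp add: fg)
    obtain u' where u': "1 = u * u'" using K(3) ..
    obtain w' where w': "1 = w * w'" using L(3) ..
    have "(u' * w') * (u * w * mon N) = (u * u') * (w * w') * mon N" by (simp only: ac_simps)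
    then have "(u' * w') * (u * w * mon N) = mon N" by (simp flip: u' w')
    then have "mon N \<in> Igt ?\<gamma>"
      using ring_ideal_mult[OF ring_ideal_Igt m, of "u' * w'"] by (simp only:)
    then show False using standard_not_mem_Igt[OF N(1)] N(2) by simp
  qed
  ultimately show ?thesis using val_eqI by blast
qed

lemma val_add:
  assumes "f \<noteq> 0" "g \<noteq> 0" "f + g \<noteq> 0" shows "min (val f) (val g) \<le> val (f + g)"
  using ring_ideal_add[OF ring_ideal_I, of f "min (val f) (val g)" g] assms
  by (simp add: mem_I_iff)

lemma val_nonneg: "f \<noteq> 0 \<Longrightarrow> 0 \<le> val f"
  using mem_I_iff I_zero by blast

lemma val_pos_iff:
  assumes "f \<noteq> 0" shows "0 < val f \<longleftrightarrow> \<not> f dvd 1"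
proof
  assume pos: "0 < val f"
  show "\<not> f dvd 1"
  proof
    assume "f dvd 1"
    then obtain g where g: "1 = f * g" ..
    then have "g \<noteq> 0" by auto
    then have "val 1 = val f + val g" "0 \<le> val g"
      using val_mult[OF assms, of g] val_nonneg by (simp_all flip: g)
    moreover have "val 1 = val 1 + val 1" using val_mult[of 1 1] by simp
    ultimately show False using pos add_pos_nonneg[of "val f" "val g"] by simp
  qed
next
  assume "\<not> f dvd 1"
  then obtain a b where "f = a * x + b * y" using nonunit_iff by blast
  moreover have "x \<in> Igt 0" "y \<in> Igt 0"
    using Igt_mult_x[OF I_zero[of 1]] Igt_mult_y[OF I_zero[of 1]] by simp_all
  ultimately have "f \<in> Igt 0"
    by (simp add: ring_ideal_add[OF ring_ideal_Igt] ring_ideal_mult[OF ring_ideal_Igt])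
  then have "val f \<noteq> 0" using not_mem_Igt_val[OF assms] by auto
  then show "0 < val f" using val_nonneg[OF assms] by simp
qed

lemma val_image: "val ` (- {0}) = {wt M | M. idx M}"
proof
  show "val ` (- {0}) \<subseteq> {wt M | M. idx M}" using val_weight by blast
  show "{wt M | M. idx M} \<subseteq> val ` (- {0})"
  proof clarify
    fix M assume "idx M"
    then obtain K where "standard K" "wt K = wt M" using reduce_to_standard by blast
    then show "wt M \<in> val ` (- {0})" using val_monomial[of K] by (intro image_eqI[of _ _ "mon K"]) auto
  qed
qed

end

section \<open>Realization of semigroups\<close>

lemma valuation_fract_extension:
  fixes v :: "'a::idom \<Rightarrow> 'g::linordered_ab_group_add"
  assumes mult: "\<And>f g. f \<noteq> 0 \<Longrightarrow> g \<noteq> 0 \<Longrightarrow> v (f * g) = v f + v g"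
    and add: "\<And>f g. f \<noteq> 0 \<Longrightarrow> g \<noteq> 0 \<Longrightarrow> f + g \<noteq> 0 \<Longrightarrow> min (v f) (v g) \<le> v (f + g)"
  shows "\<exists>\<nu>. valuation \<nu> \<and> (\<forall>f. f \<noteq> 0 \<longrightarrow> \<nu> (to_fract f) = v f)"
proof -
  have "\<exists>a b. a \<noteq> 0 \<and> b \<noteq> 0 \<and> q * to_fract b = to_fract a" if "q \<noteq> 0" for q :: "'a fract"
  proof -
    obtain a b where q: "q = Fract a b" "b \<noteq> 0" by (cases q)
    have eq: "q * to_fract b = to_fract a"
      using q by (simp add: to_fract_def eq_fract)
    moreover have "to_fract a \<noteq> 0" using that q(2) unfolding eq[symmetric] by simp
    ultimately show ?thesis using q(2) by auto
  qed
  then obtain A B where AB: "\<And>q :: 'a fract. q \<noteq> 0 \<Longrightarrow> A q \<noteq> 0 \<and> B q \<noteq> 0 \<and> q * to_fract (B q) = to_fract (A q)"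
    by metis
  define \<nu> where "\<nu> q = v (A q) - v (B q)" for q
  have \<nu>: "\<nu> q = v a - v b" if q: "q \<noteq> 0" "b \<noteq> 0" "q * to_fract b = to_fract a" for q a b
  proof -
    have "to_fract (A q * b) = to_fract (A q) * to_fract b" by simp
    also have "\<dots> = to_fract (B q) * (q * to_fract b)" using AB[OF q(1)] by (metis mult.assoc mult.commute)
    also have "\<dots> = to_fract (B q * a)" using q(3) by simp
    finally have eq: "A q * b = B q * a" by (simp only: to_fract_eq_iff)
    have "to_fract a \<noteq> 0" using q unfolding q(3)[symmetric] by simp
    then have "a \<noteq> 0" by simp
    then have "v (A q) + v b = v (B q) + v a"
      using mult[of "A q" b] mult[of "B q" a] AB[OF q(1)] q(2) eq by simp
    then show ?thesis by (simp add: \<nu>_def algebra_simps)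
  qed
  have "valuation \<nu>"
    unfolding valuation_def
  proof (intro conjI allI impI)
    fix q r :: "'a fract" assume q: "q \<noteq> 0" and r: "r \<noteq> 0"
    note Q = AB[OF q] and R = AB[OF r]
    have "q * r * to_fract (B q * B r) = (q * to_fract (B q)) * (r * to_fract (B r))"
      by (simp add: ac_simps)
    then have "q * r * to_fract (B q * B r) = to_fract (A q * A r)" using Q R by simp
    then have "\<nu> (q * r) = v (A q * A r) - v (B q * B r)" using q r Q R by (intro \<nu>) simp_all
    then show "\<nu> (q * r) = \<nu> q + \<nu> r" using Q R mult by (simp add: \<nu>_def)
    assume qr: "q + r \<noteq> 0"
    let ?a = "A q * B r" and ?b = "A r * B q"
    have "(q + r) * to_fract (B q * B r) = (q * to_fract (B q)) * to_fract (B r) + (r * to_fract (B r)) * to_fract (B q)"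
      by (simp add: algebra_simps)
    then have eq: "(q + r) * to_fract (B q * B r) = to_fract (?a + ?b)" using Q R by simp
    then have "to_fract (?a + ?b) \<noteq> 0" using qr Q R by (metis mult_eq_0_iff to_fract_eq_0_iff)
    then have ab: "?a + ?b \<noteq> 0" by (metis to_fract_eq_0_iff)
    have "\<nu> (q + r) = v (?a + ?b) - v (B q * B r)" using qr Q R eq by (intro \<nu>) simp_all
    moreover have "min (v ?a) (v ?b) \<le> v (?a + ?b)" using ab Q R by (intro add) simp_all
    moreover have "\<nu> q = v ?a - v (B q * B r)" "\<nu> r = v ?b - v (B q * B r)"
      using Q R mult by (simp_all add: \<nu>_def)
    ultimately show "min (\<nu> q) (\<nu> r) \<le> \<nu> (q + r)" by (auto simp: min_def split: if_splits)
  qed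
  moreover have "\<nu> (to_fract f) = v f" if "f \<noteq> 0" for f
  proof -
    have "v 1 = 0" using mult[of 1 1] by simp
    then show ?thesis using \<nu>[of "to_fract f" 1 f] that by simp
  qed
  ultimately show ?thesis by blast
qed

text \<open>Everything is stated on the ring, so that values can still be projected to another group
  before the extension to the quotient field.\<close>

definition realizes :: "('a::idom \<Rightarrow> 'g::linordered_ab_group_add) \<Rightarrow> 'g set \<Rightarrow> bool"
  where "realizes v M \<longleftrightarrow>
    (\<forall>f g. f \<noteq> 0 \<longrightarrow> g \<noteq> 0 \<longrightarrow> v (f * g) = v f + v g) \<and>
    (\<forall>f g. f \<noteq> 0 \<longrightarrow> g \<noteq> 0 \<longrightarrow> f + g \<noteq> 0 \<longrightarrow> min (v f) (v g) \<le> v (f + g)) \<and>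
    (\<forall>f. f \<noteq> 0 \<longrightarrow> 0 \<le> v f \<and> (0 < v f \<longleftrightarrow> \<not> f dvd 1)) \<and>
    v ` (- {0}) = M"

lemma realizes_imp_valuation:
  fixes v :: "'a::idom \<Rightarrow> 'g::linordered_ab_group_add"
  assumes v: "realizes v M" and m: "\<mm> = {f. \<not> f dvd 1}"
  shows "\<exists>\<nu> :: 'a fract \<Rightarrow> 'g. valuation \<nu> \<and> dominates \<nu> \<mm> \<and> value_semigroup \<nu> = M"
proof -
  have mult: "v (f * g) = v f + v g" if "f \<noteq> 0" "g \<noteq> 0" for f g
    using v that by (simp add: realizes_def)
  have add: "min (v f) (v g) \<le> v (f + g)" if "f \<noteq> 0" "g \<noteq> 0" "f + g \<noteq> 0" for f g
    using v that by (simp add: realizes_def)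
  have nonneg: "0 \<le> v f" and pos: "0 < v f \<longleftrightarrow> \<not> f dvd 1" if "f \<noteq> 0" for f
    using v that by (simp_all add: realizes_def)
  have im: "v ` (- {0}) = M" using v by (simp add: realizes_def)
  have "\<exists>\<nu>. valuation \<nu> \<and> (\<forall>f. f \<noteq> 0 \<longrightarrow> \<nu> (to_fract f) = v f)"
    by (rule valuation_fract_extension[OF mult add])
  then obtain \<nu> :: "'a fract \<Rightarrow> 'g" where \<nu>: "valuation \<nu>" "\<And>f. f \<noteq> 0 \<Longrightarrow> \<nu> (to_fract f) = v f"
    by auto
  have "to_fract f \<in> valuation_ring \<nu>" for f
    using nonneg[of f] \<nu>(2)[of f] by (cases "f = 0") (auto simp: valuation_ring_def)
  moreover have "to_fract f \<in> valuation_ideal \<nu> \<longleftrightarrow> f \<in> \<mm>" for f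
    using pos[of f] \<nu>(2)[of f] by (cases "f = 0") (auto simp: valuation_ideal_def m)
  then have "valuation_ideal \<nu> \<inter> range to_fract = to_fract ` \<mm>" by auto
  ultimately have "dominates \<nu> \<mm>" by (auto simp: dominates_def)
  moreover have "value_semigroup \<nu> = M"
    unfolding im[symmetric] value_semigroup_def using \<nu>(2) by (auto simp: image_iff) metis+
  ultimately show ?thesis using \<nu>(1) by blast
qed

context key_sequence
begin

lemma realizes_val: "realizes val (monoid_generated (\<beta> ` {i. enat i \<le> \<Lambda>}))"
proof -
  have "{wt M | M. idx M} = {wt M | M. set_mset M \<subseteq> {i. enat i \<le> \<Lambda>}}"
    by (auto simp: idx_def subset_iff)
  then show ?thesis
    unfolding realizes_def monoid_generated_eq_weights
    using val_mult val_add val_nonneg val_pos_iff val_image by auto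
qed

end

section \<open>Key elements and relations from the gap condition\<close>

lemma monomial_cong: "(\<And>i. i \<in># M \<Longrightarrow> P i = Q i) \<Longrightarrow> monomial P M = monomial Q M"
  unfolding monomial_def by (intro arg_cong[of _ _ prod_mset] image_mset_cong) simp

lemma key_elements_exist:
  fixes x y :: "'a::comm_ring_1" and R :: "nat \<Rightarrow> nat multiset"
  shows "\<exists>P. P 0 = x \<and> P (Suc 0) = y \<and>
    (\<forall>i\<ge>1. set_mset (R i) \<subseteq> {..<i} \<longrightarrow> P (Suc i) = P i ^ n i - monomial P (R i))"
proof -
  \<comment> \<open>Course-of-values recursion, with \<open>cut\<close> supplying the earlier key
    elements. The filter keeps the monomial to earlier indices; under the stated inclusion the
    filtered multiset is \<open>R i\<close>.\<close>
  define F where "F f k = (case k of 0 \<Rightarrow> x | Suc 0 \<Rightarrow> y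
    | Suc i \<Rightarrow> f i ^ n i - monomial f (filter_mset (\<lambda>j. j < i) (R i)))" for f :: "nat \<Rightarrow> 'a" and k
  define P where "P = wfrec less_than F"
  have P: "P k = F (cut P less_than k) k" for k
    unfolding P_def by (rule wfrec) simp
  have "P 0 = x" "P (Suc 0) = y" by (subst P, simp add: F_def)+
  moreover have "P (Suc i) = P i ^ n i - monomial P (R i)" if i: "1 \<le> i" "set_mset (R i) \<subseteq> {..<i}" for i
  proof -
    obtain j where j: "i = Suc j" using i(1) by (cases i) auto
    let ?f = "cut P less_than (Suc i)"
    have f: "?f k = P k" if "k < Suc i" for k using that by (simp add: cut_apply)
    have "filter_mset (\<lambda>j. j < i) (R i) = filter_mset (\<lambda>_. True) (R i)"
      using i(2) by (intro filter_mset_cong) auto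
    then have "filter_mset (\<lambda>j. j < i) (R i) = R i" by (simp only: filter_mset_True)
    then have "P (Suc i) = ?f i ^ n i - monomial ?f (R i)"
      by (subst P) (simp add: F_def j)
    moreover have "monomial ?f (R i) = monomial P (R i)"
      using i(2) by (intro monomial_cong f) auto
    ultimately show ?thesis using f[of i] by simp
  qed
  ultimately show ?thesis by blast
qed

locale gap_sequence =
  fixes \<beta> :: "nat \<Rightarrow> 'g::linordered_ab_group_add" and \<Lambda> :: enat and n :: "nat \<Rightarrow> nat"
  assumes \<Lambda>: "1 \<le> \<Lambda>"
    and pos: "enat i \<le> \<Lambda> \<Longrightarrow> 0 < \<beta> i"
    and n_pos: "1 \<le> i \<Longrightarrow> enat i < \<Lambda> \<Longrightarrow> 0 < n i"
    and n_mem: "1 \<le> i \<Longrightarrow> enat i < \<Lambda> \<Longrightarrow> n i \<cdot> \<beta> i \<in> group_closure (\<beta> ` {..<i})"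
    and n_least: "1 \<le> i \<Longrightarrow> enat i < \<Lambda> \<Longrightarrow> 0 < m \<Longrightarrow> m < n i \<Longrightarrow> m \<cdot> \<beta> i \<notin> group_closure (\<beta> ` {..<i})"
    and gap: "1 \<le> i \<Longrightarrow> enat i < \<Lambda> \<Longrightarrow> n i \<cdot> \<beta> i < \<beta> (Suc i)"
begin

lemma idx_1: "enat 1 \<le> \<Lambda>"
  using \<Lambda> by (simp add: one_enat_def)

text \<open>Division with remainder, from the highest generator down, bounds all exponents except
  that of \<open>\<beta> 0\<close>, whose integer coefficient is written as the difference of
  \<open>l\<close> and \<open>k\<close>.\<close>

lemma normal_form:
  assumes "1 \<le> i" "enat i \<le> \<Lambda>" "g \<in> group_closure (\<beta> ` {..<i})"
  shows "\<exists>M k l. set_mset M \<subseteq> {1..<i} \<and> (\<forall>j. 1 \<le> j \<longrightarrow> j < i \<longrightarrow> count M j < n j) \<and>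
    g + k \<cdot> \<beta> 0 = weight \<beta> M + l \<cdot> \<beta> 0"
  using assms
proof (induction i arbitrary: g rule: dec_induct)
  case base
  have "\<beta> ` {..<1} = insert (\<beta> 0) {}" by auto
  then obtain m k where "g = m \<cdot> \<beta> 0 - k \<cdot> \<beta> 0"
    using base.prems(2) by (auto simp: group_closure_insert simp del: insert_is_Un)
  then have "g + k \<cdot> \<beta> 0 = weight \<beta> {#} + m \<cdot> \<beta> 0" by simp
  then show ?case by (intro exI[of _ "{#}"] exI[of _ k] exI[of _ m]) simp
next
  case (step i)
  have i: "enat i < \<Lambda>" "enat i \<le> \<Lambda>" using enat_less_downward enat_le_downward step.prems(1) by auto
  have "\<beta> ` {..<Suc i} = insert (\<beta> i) (\<beta> ` {..<i})" by (simp add: lessThan_Suc)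
  then obtain h r where h: "h \<in> group_closure (\<beta> ` {..<i})" "r < n i" "g = h + r \<cdot> \<beta> i"
    using group_closure_insert_remainder[OF n_pos n_mem] step.hyps(1) i(1) step.prems(2) by metis
  obtain M k l where M: "set_mset M \<subseteq> {1..<i}" "\<forall>j. 1 \<le> j \<longrightarrow> j < i \<longrightarrow> count M j < n j"
    "h + k \<cdot> \<beta> 0 = weight \<beta> M + l \<cdot> \<beta> 0"
    using step.IH[OF i(2) h(1)] by blast
  have "count M i = 0" using M(1) by (auto simp: count_eq_zero_iff)
  then have "\<forall>j. 1 \<le> j \<longrightarrow> j < Suc i \<longrightarrow> count (M + replicate_mset r i) j < n j"
    using M(2) h(2) by (auto simp: less_Suc_eq)
  moreover have "set_mset (M + replicate_mset r i) \<subseteq> {1..<Suc i}"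
    using M(1) step.hyps(1) by (auto split: if_splits)
  moreover have "g + k \<cdot> \<beta> 0 = weight \<beta> (M + replicate_mset r i) + l \<cdot> \<beta> 0"
    using M(3) h(3) by (simp add: algebra_simps)
  ultimately show ?case by blast
qed

text \<open>In the normal form of \<open>n i \<cdot> \<beta> i\<close> the generators other than
  \<open>\<beta> 0\<close> contribute less than \<open>\<beta> i\<close>, by the gaps. The
  coefficient of \<open>\<beta> 0\<close> is therefore positive, and the relation has no negative
  terms.\<close>

lemma relation_exists:
  assumes i: "1 \<le> i" "enat i < \<Lambda>"
  shows "\<exists>R. set_mset R \<subseteq> {..<i} \<and> 0 \<in># R \<and> weight \<beta> R = n i \<cdot> \<beta> i"
proof -
  have i': "enat i \<le> \<Lambda>" using i(2) by simp
  obtain M k l where M: "set_mset M \<subseteq> {1..<i}" "\<forall>j. 1 \<le> j \<longrightarrow> j < i \<longrightarrow> count M j < n j"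
    and eq: "n i \<cdot> \<beta> i + k \<cdot> \<beta> 0 = weight \<beta> M + l \<cdot> \<beta> 0"
    using normal_form[OF i(1) i' n_mem[OF i]] by blast
  have "weight \<beta> M < \<beta> i"
    using i(1) M pos[OF idx_1] enat_less_downward[OF i'] enat_le_downward[OF i'] less_imp_le[OF pos] less_imp_le[OF gap]
    by (intro weight_less_of_gaps[of i \<beta> n]) simp_all
  also have "\<dots> \<le> n i \<cdot> \<beta> i"
    using nat_multiple_mono[of 1 "n i" "\<beta> i"] n_pos[OF i] pos[OF i'] by simp
  finally have "weight \<beta> M + k \<cdot> \<beta> 0 < n i \<cdot> \<beta> i + k \<cdot> \<beta> 0" by simp
  then have "k \<cdot> \<beta> 0 < l \<cdot> \<beta> 0" unfolding eq by simp
  then have kl: "k < l"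
    using nat_multiple_mono[of l k "\<beta> 0"] pos[OF enat_le_downward[OF i', of 0]] by (meson less_imp_le not_le zero_le)
  define R where "R = M + replicate_mset (l - k) 0"
  have "weight \<beta> R = n i \<cdot> \<beta> i" using eq kl by (simp add: R_def nat_multiple_diff algebra_simps)
  moreover have "0 \<in># R" "set_mset R \<subseteq> {..<i}" using kl M(1) i(1) by (auto simp: R_def split: if_splits)
  ultimately show ?thesis by blast
qed

lemma weight_independent:
  assumes "1 \<le> i" "enat i < \<Lambda>" "0 < m" "m < n i" "set_mset M \<subseteq> {..<i}" "set_mset N \<subseteq> {..<i}"
  shows "weight \<beta> M + m \<cdot> \<beta> i \<noteq> weight \<beta> N"
proof
  assume eq: "weight \<beta> M + m \<cdot> \<beta> i = weight \<beta> N"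
  have w: "weight \<beta> M \<in> group_closure (\<beta> ` {..<i})" if "set_mset M \<subseteq> {..<i}" for M
    using that monoid_generated_subset_closure[of "\<beta> ` {..<i}"] unfolding monoid_generated_eq_weights by blast
  have "m \<cdot> \<beta> i = weight \<beta> N - weight \<beta> M" using eq by (simp add: algebra_simps)
  then have "m \<cdot> \<beta> i \<in> group_closure (\<beta> ` {..<i})" using w assms(5,6) by (simp add: group_closure.diff)
  then show False using n_least assms(1-4) by blast
qed

end

lemma realization_infinite:
  fixes x y :: "'a::idom" and \<beta> :: "nat \<Rightarrow> 'g::linordered_ab_group_add"
  assumes xy: "regular_parameters x y" and seq: "gap_sequence \<beta> \<infinity> n"
    and inf: "\<And>N. \<exists>i>N. n i \<noteq> 1"
  shows "\<exists>v :: 'a \<Rightarrow> 'g. realizes v (monoid_generated (range \<beta>))"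
proof -
  interpret regular_parameters x y by (rule xy)
  interpret gap_sequence \<beta> \<infinity> n by (rule seq)
  obtain R where R: "\<And>i. 1 \<le> i \<Longrightarrow> set_mset (R i) \<subseteq> {..<i} \<and> 0 \<in># R i \<and> weight \<beta> (R i) = n i \<cdot> \<beta> i"
    using relation_exists by (metis enat_ord_code(4))
  obtain P where P: "P 0 = x" "P (Suc 0) = y" "\<And>i. 1 \<le> i \<Longrightarrow> P (Suc i) = P i ^ n i - monomial P (R i)"
    using key_elements_exist[of x y R n] R by blast
  have n: "1 \<le> n i" if "1 \<le> i" for i using n_pos[OF that] by simp
  have mono: "key_degree n i \<le> key_degree n j" if "1 \<le> i" "i \<le> j" for i j
    using that(2)
  proof (induction j rule: dec_induct)
    case (step j)
    have j: "1 \<le> j" using that(1) step.hyps by simp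
    have "key_degree n i \<le> 1 * key_degree n j" using step.IH by simp
    also have "\<dots> \<le> n j * key_degree n j" by (intro mult_right_mono n[OF j]) simp
    also have "\<dots> = key_degree n (Suc j)" using key_degree_Suc[OF j, of n] by simp
    finally show ?case .
  qed simp
  \<comment> \<open>Each index with \<open>n i\<close> \<noteq> 1 at least doubles the degree, and
    the other indices preserve it.\<close>
  have "\<exists>B\<ge>1. c < key_degree n B" for c
  proof (induction c)
    case 0
    show ?case by (intro exI[of _ 1]) simp
  next
    case (Suc c)
    then obtain B where B: "1 \<le> B" "c < key_degree n B" by blast
    obtain i where i: "i > B" "n i \<noteq> 1" using inf by blast
    then have i2: "1 \<le> i" "2 \<le> n i" using B(1) n[of i] by auto
    have "Suc c < 2 * key_degree n i" using B mono[OF B(1), of i] i(1) by simp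
    also have "\<dots> \<le> n i * key_degree n i" using i2(2) by simp
    also have "\<dots> = key_degree n (Suc i)" using key_degree_Suc[OF i2(1), of n] by simp
    finally show ?case by (intro exI[of _ "Suc i"]) simp
  qed
  then have unbounded: "\<exists>B. \<forall>i. enat i \<le> \<infinity> \<longrightarrow> key_degree n i \<le> c \<longrightarrow> i \<le> B" for c
    using mono by (metis leD le_less_trans nat_le_linear)
  interpret key_sequence x y \<beta> \<infinity> n R P
    by unfold_locales
      (use R P n_pos pos \<Lambda> gap weight_independent unbounded in simp_all)
  have "{i. enat i \<le> \<infinity>} = UNIV" by simp
  then show ?thesis using realizes_val by auto
qed

instance prod :: (linordered_ab_group_add, linordered_ab_group_add) linordered_ab_group_add
  by standard (auto simp: less_eq_prod_def)

lemma nat_multiple_Pair: "m \<cdot> (a, b) = (m \<cdot> a, m \<cdot> b)"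
  by (induction m) (simp_all add: nat_multiple_Suc zero_prod_def)

lemma weight_Pair: "weight (\<lambda>i. (\<beta> i, e i)) M = (weight \<beta> M, weight e M)"
  by (induction M) (simp_all add: zero_prod_def)

text \<open>If the last index \<open>L\<close> is finite, \<open>\<beta> L\<close> is made rationally independent of its predecessors
  by an infinitesimal decrease: the valuation below has values in the lexicographic product
  with the integers, and it is then projected to the first component.\<close>

lemma realization_finite:
  fixes x y :: "'a::idom" and \<beta> :: "nat \<Rightarrow> 'g::linordered_ab_group_add"
  assumes xy: "regular_parameters x y" and seq: "gap_sequence \<beta> (enat L) n"
  shows "\<exists>v :: 'a \<Rightarrow> 'g. realizes v (monoid_generated (\<beta> ` {..L}))"
proof -
  interpret regular_parameters x y by (rule xy)
  interpret gap_sequence \<beta> "enat L" n by (rule seq)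
  have "\<exists>R. 1 \<le> i \<longrightarrow> enat i < enat L \<longrightarrow> set_mset R \<subseteq> {..<i} \<and> 0 \<in># R \<and> weight \<beta> R = n i \<cdot> \<beta> i" for i
    using relation_exists by blast
  then obtain R where R: "\<And>i. 1 \<le> i \<Longrightarrow> enat i < enat L \<Longrightarrow>
      set_mset (R i) \<subseteq> {..<i} \<and> 0 \<in># R i \<and> weight \<beta> (R i) = n i \<cdot> \<beta> i"
    by metis
  obtain P where P: "P 0 = x" "P (Suc 0) = y"
      "\<And>i. 1 \<le> i \<Longrightarrow> enat i < enat L \<Longrightarrow> P (Suc i) = P i ^ n i - monomial P (R i)"
    using key_elements_exist[of x y R n] R by blast
  \<comment> \<open>Only the last generator has a nonzero second component. Up to sign that
    component counts its multiplicity, which rules out any relation between its multiples and the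
    earlier generators.\<close>
  define e :: "nat \<Rightarrow> int" where "e i = (if i = L then - 1 else 0)" for i
  have e0: "weight e M = 0" if "set_mset M \<subseteq> {..<L}" for M
    using that by (induction M) (auto simp: e_def)
  have eL: "m \<cdot> e L = - int m" for m
    by (induction m) (simp_all add: nat_multiple_Suc e_def)
  define \<beta>' where "\<beta>' = (\<lambda>i. (\<beta> i, e i))"
  have nz: "m \<cdot> (0::int) = 0" for m by (induction m) (simp_all add: nat_multiple_Suc)
  have L: "1 \<le> L" using \<Lambda> by (simp add: one_enat_def)
  have \<beta>_pos: "0 < \<beta> i" if "i \<le> L" for i using pos that by simp
  interpret key_sequence x y \<beta>' "enat L" n R P
  proof unfold_locales
    show "1 \<le> enat L" by (rule \<Lambda>)
    show "0 < \<beta>' i" if "enat i \<le> enat L" for i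
      using pos[OF that] by (simp add: \<beta>'_def zero_prod_def)
    show "P 0 = x" "P (Suc 0) = y" by fact+
    fix i assume i: "1 \<le> i" "enat i < enat L"
    show "P (Suc i) = P i ^ n i - monomial P (R i)" using P(3) i by blast
    show "set_mset (R i) \<subseteq> {..<i}" "0 \<in># R i" using R i by blast+
    then have "weight e (R i) = 0" using i(2) by (intro e0) auto
    moreover have "e i = 0" using i(2) by (simp add: e_def)
    ultimately show "weight \<beta>' (R i) = n i \<cdot> \<beta>' i"
      using R i by (simp add: \<beta>'_def weight_Pair nat_multiple_Pair nz)
    show "0 < n i" using n_pos i by blast
    show "n i \<cdot> \<beta>' i < \<beta>' (Suc i)"
      using gap[OF i] by (simp add: \<beta>'_def nat_multiple_Pair)
  next
    fix i m M N assume i: "1 \<le> i" "enat i \<le> enat L" "0 < m" "enat i < enat L \<longrightarrow> m < n i"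
      "set_mset M \<subseteq> {..<i}" "set_mset N \<subseteq> {..<i}"
    show "weight \<beta>' M + m \<cdot> \<beta>' i \<noteq> weight \<beta>' N"
    proof (cases "i = L")
      case True
      then have "weight e M + m \<cdot> e i \<noteq> weight e N" using i e0 eL by simp
      then show ?thesis by (simp add: \<beta>'_def weight_Pair nat_multiple_Pair)
    next
      case False
      then have "weight \<beta> M + m \<cdot> \<beta> i \<noteq> weight \<beta> N"
        using i by (intro weight_independent) simp_all
      then show ?thesis by (simp add: \<beta>'_def weight_Pair nat_multiple_Pair)
    qed
  next
    show "\<exists>B. \<forall>i. enat i \<le> enat L \<longrightarrow> key_degree n i \<le> c \<longrightarrow> i \<le> B" for c
      by (intro exI[of _ L]) simp
  qed
  define v where "v f = fst (val f)" for f
  have fst_mono: "fst p \<le> fst q" if "p \<le> q" for p q :: "'g \<times> int"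
    using that by (auto simp: less_eq_prod_def)
  have weights: "\<exists>M. set_mset M \<subseteq> {..L} \<and> val f = (weight \<beta> M, weight e M)" if "f \<noteq> 0" for f
    using val_weight[OF that] by (auto simp: \<beta>'_def weight_Pair idx_def subset_iff)
  have "realizes v (monoid_generated (\<beta> ` {..L}))"
    unfolding realizes_def
  proof (intro conjI allI impI)
    fix f g :: 'a assume fg: "f \<noteq> 0" "g \<noteq> 0"
    show "v (f * g) = v f + v g" using val_mult[OF fg] by (simp add: v_def)
    assume s: "f + g \<noteq> 0"
    show "min (v f) (v g) \<le> v (f + g)"
      using fst_mono[OF val_add[OF fg s]] by (auto simp: v_def min_def split: if_splits intro: order_trans)
  next
    fix f :: 'a assume f: "f \<noteq> 0"
    show nn: "0 \<le> v f" using fst_mono[OF val_nonneg[OF f]] by (simp add: v_def)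
    obtain M where M: "set_mset M \<subseteq> {..L}" "val f = (weight \<beta> M, weight e M)" using weights[OF f] by blast
    show "0 < v f \<longleftrightarrow> \<not> f dvd 1"
    proof
      assume "0 < v f"
      then have "0 < val f" by (simp add: v_def less_prod_def)
      then show "\<not> f dvd 1" using val_pos_iff[OF f] by simp
    next
      assume "\<not> f dvd 1"
      then have "0 < val f" using val_pos_iff[OF f] by simp
      \<comment> \<open>The projection could send a positive infinitesimal to 0. It does not: a
        positive value is the weight of a nonempty multiset, whose first component is
        positive.\<close>
      then have "M \<noteq> {#}" using M(2) by (auto simp: zero_prod_def)
      then obtain i M' where iM: "M = add_mset i M'" by (cases M) auto
      have "0 \<le> weight \<beta> M'" using M(1) iM by (intro weight_nonneg) (auto intro: less_imp_le \<beta>_pos)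
      moreover have "0 < \<beta> i" using M(1) \<beta>_pos iM by auto
      ultimately show "0 < v f" by (simp add: v_def M(2) iM add_pos_nonneg)
    qed
  next
    have "v ` (- {0}) = fst ` (val ` (- {0}))" by (auto simp: v_def image_iff)
    also have "\<dots> = {weight \<beta> M | M. set_mset M \<subseteq> {..L}}"
      unfolding val_image by (auto simp: \<beta>'_def weight_Pair idx_def subset_iff image_iff) metis
    finally show "v ` (- {0}) = monoid_generated (\<beta> ` {..L})"
      unfolding monoid_generated_eq_weights .
  qed
  then show ?thesis by blast
qed

text \<open>If \<open>n i\<close> is 1 from some point on, the degrees stay bounded and the infinite
  construction does not apply. Each later generator is then a combination of earlier ones, so a
  finite initial part generates the same monoid.\<close>

lemma realization:
  fixes x y :: "'a::idom" and \<beta> :: "nat \<Rightarrow> 'g::linordered_ab_group_add"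
  assumes xy: "regular_parameters x y" and seq: "gap_sequence \<beta> \<Lambda> n"
  shows "\<exists>v :: 'a \<Rightarrow> 'g. realizes v (monoid_generated (\<beta> ` {i. enat i \<le> \<Lambda>}))"
proof (cases \<Lambda>)
  case (enat L)
  then show ?thesis using realization_finite[OF xy, of \<beta> L n] seq by (simp add: atMost_def)
next
  case infinity
  interpret gap_sequence \<beta> \<Lambda> n by (rule seq)
  show ?thesis
  proof (cases "\<forall>N. \<exists>i>N. n i \<noteq> 1")
    case True
    then show ?thesis using realization_infinite[OF xy, of \<beta> n] seq infinity by simp
  next
    case False
    then obtain N where N: "\<And>i. N < i \<Longrightarrow> n i = 1" by auto
    \<comment> \<open>The successor ensures that the truncated sequence has a last index of at least
      1.\<close>
    define L where "L = Suc N"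
    have "gap_sequence \<beta> (enat L) n"
      by unfold_locales
        (use pos n_pos n_mem n_least gap infinity in \<open>simp_all add: L_def one_enat_def\<close>)
    then obtain v :: "'a \<Rightarrow> 'g" where v: "realizes v (monoid_generated (\<beta> ` {..L}))"
      using realization_finite[OF xy] by blast
    have "\<beta> i \<in> monoid_generated (\<beta> ` {..L})" for i
    proof (induction i rule: less_induct)
      case (less i)
      show ?case
      proof (cases "i \<le> L")
        case True
        then show ?thesis by (intro monoid_generated_base) simp
      next
        case False
        then have "1 \<le> i" "n i = 1" using N by (simp_all add: L_def)
        then obtain R where "set_mset R \<subseteq> {..<i}" "weight \<beta> R = \<beta> i"
          using relation_exists[of i] infinity by auto
        then have "\<beta> i \<in> monoid_generated (\<beta> ` {..<i})"
          unfolding monoid_generated_eq_weights by (metis (mono_tags, lifting) mem_Collect_eq)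
        moreover have "monoid_generated (\<beta> ` {..<i}) \<subseteq> monoid_generated (\<beta> ` {..L})"
          using less by (intro monoid_generated_least monoid_generated.zero monoid_generated_add) auto
        ultimately show ?thesis by blast
      qed
    qed
    then have "monoid_generated (range \<beta>) \<subseteq> monoid_generated (\<beta> ` {..L})"
      by (intro monoid_generated_least monoid_generated.zero monoid_generated_add) auto
    moreover have "monoid_generated (\<beta> ` {..L}) \<subseteq> monoid_generated (range \<beta>)"
      by (intro monoid_generated_mono) auto
    ultimately have "monoid_generated (\<beta> ` {i. enat i \<le> \<Lambda>}) = monoid_generated (\<beta> ` {..L})"
      using infinity by simp
    then show ?thesis using v by auto
  qed
qed

lemma gap_sequence_of_nbar:
  fixes \<beta> :: "nat \<Rightarrow> 'g::linordered_ab_group_add"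
  assumes \<Lambda>: "1 \<le> \<Lambda>" and pos: "\<And>i. enat i \<le> \<Lambda> \<Longrightarrow> 0 < \<beta> i"
    and gap: "\<And>i. 1 \<le> i \<Longrightarrow> enat i < \<Lambda> \<Longrightarrow> nbar \<beta> i < \<infinity> \<and> the_enat (nbar \<beta> i) \<cdot> \<beta> i < \<beta> (Suc i)"
  shows "gap_sequence \<beta> \<Lambda> (\<lambda>i. the_enat (nbar \<beta> i))"
proof -
  have n: "0 < the_enat (nbar \<beta> i) \<and> the_enat (nbar \<beta> i) \<cdot> \<beta> i \<in> group_closure (\<beta> ` {..<i}) \<and>
      (\<forall>m. 0 < m \<longrightarrow> m < the_enat (nbar \<beta> i) \<longrightarrow> m \<cdot> \<beta> i \<notin> group_closure (\<beta> ` {..<i}))"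
    if "1 \<le> i" "enat i < \<Lambda>" for i
    using gap[OF that] unfolding nbar_insert
    by (cases rule: subgroup_index_insert_cases[of "\<beta> i" "\<beta> ` {..<i}"]) simp_all
  show ?thesis
    by unfold_locales (use \<Lambda> pos gap n in blast)+
qed

theorem theorem1p2:
  fixes \<mm> :: "'a::idom set"
    and S :: "'g::linordered_ab_group_add set"
  assumes "regular_local_ring \<mm> 2"
    and "subsemigroup S"
    and "S \<subseteq> {0<..}"
  shows "(\<exists>\<nu> :: 'a fract \<Rightarrow> 'g.
            valuation \<nu> \<and> dominates \<nu> \<mm> \<and> value_semigroup \<nu> = S \<union> {0})
    \<longleftrightarrow>
         (\<exists>(\<Lambda> :: enat) (\<beta> :: nat \<Rightarrow> 'g).
            1 \<le> \<Lambda> \<and>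
            (\<forall>i. enat i \<le> \<Lambda> \<longrightarrow> \<beta> i \<in> S) \<and>
            S = semigroup_generated (\<beta> ` {i. enat i \<le> \<Lambda>}) \<and>
            (\<forall>i\<ge>1. enat i < \<Lambda> \<longrightarrow>
               nbar \<beta> i < \<infinity> \<and> nat_multiple (the_enat (nbar \<beta> i)) (\<beta> i) < \<beta> (Suc i)))"
proof
  assume "\<exists>\<nu> :: 'a fract \<Rightarrow> 'g. valuation \<nu> \<and> dominates \<nu> \<mm> \<and> value_semigroup \<nu> = S \<union> {0}"
  then show "\<exists>(\<Lambda> :: enat) (\<beta> :: nat \<Rightarrow> 'g).
      1 \<le> \<Lambda> \<and> (\<forall>i. enat i \<le> \<Lambda> \<longrightarrow> \<beta> i \<in> S) \<and> S = semigroup_generated (\<beta> ` {i. enat i \<le> \<Lambda>}) \<and>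
      (\<forall>i\<ge>1. enat i < \<Lambda> \<longrightarrow> nbar \<beta> i < \<infinity> \<and> nat_multiple (the_enat (nbar \<beta> i)) (\<beta> i) < \<beta> (Suc i))"
    using value_semigroup_structure[OF assms(1,3)] by blast
next
  assume "\<exists>(\<Lambda> :: enat) (\<beta> :: nat \<Rightarrow> 'g).
      1 \<le> \<Lambda> \<and> (\<forall>i. enat i \<le> \<Lambda> \<longrightarrow> \<beta> i \<in> S) \<and> S = semigroup_generated (\<beta> ` {i. enat i \<le> \<Lambda>}) \<and>
      (\<forall>i\<ge>1. enat i < \<Lambda> \<longrightarrow> nbar \<beta> i < \<infinity> \<and> nat_multiple (the_enat (nbar \<beta> i)) (\<beta> i) < \<beta> (Suc i))"
  then obtain \<Lambda> :: enat and \<beta> :: "nat \<Rightarrow> 'g" where \<Lambda>: "1 \<le> \<Lambda>" and \<beta>: "\<And>i. enat i \<le> \<Lambda> \<Longrightarrow> \<beta> i \<in> S"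
    and gen: "S = semigroup_generated (\<beta> ` {i. enat i \<le> \<Lambda>})"
    and gap: "\<And>i. 1 \<le> i \<Longrightarrow> enat i < \<Lambda> \<Longrightarrow> nbar \<beta> i < \<infinity> \<and> the_enat (nbar \<beta> i) \<cdot> \<beta> i < \<beta> (Suc i)"
    by blast
  have pos: "0 < \<beta> i" if "enat i \<le> \<Lambda>" for i using \<beta>[OF that] assms(3) by auto
  obtain x y :: 'a where xy: "regular_parameters x y" and m: "\<mm> = {f. \<not> f dvd 1}"
    using regular_local_ring_parameters[OF assms(1)] by blast
  obtain v :: "'a \<Rightarrow> 'g" where "realizes v (monoid_generated (\<beta> ` {i. enat i \<le> \<Lambda>}))"
    using realization[OF xy gap_sequence_of_nbar[OF \<Lambda> pos gap]] by blast
  moreover have "monoid_generated (\<beta> ` {i. enat i \<le> \<Lambda>}) = S \<union> {0}"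
    unfolding semigroup_generated_Un_zero[symmetric] gen[symmetric] ..
  ultimately show "\<exists>\<nu> :: 'a fract \<Rightarrow> 'g. valuation \<nu> \<and> dominates \<nu> \<mm> \<and> value_semigroup \<nu> = S \<union> {0}"
    using realizes_imp_valuation[OF _ m] by metis
qed

end
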